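(* Let $K$ be a field, let $I=I(\mathcal{D})\subset K[x_1,\ldots,x_n]$ be the edge ideal of a vertex-weighted oriented graph $\mathcal{D}$ with vertices $x_1,\ldots,x_n$, and let $d_i$ be the weight of $x_i$. If $\mathcal{U}$ is the weighted digraph obtained from $\mathcal{D}$ by assigning weight $2$ to every vertex $x_i$ with $d_i\geq 2$, then $I$ is Cohen--Macaulay if and only if $I(\mathcal{U})$ is Cohen--Macaulay.
   Context: An oriented graph $\mathcal{D}$ is a finite simple graph together with an orientation of each of its edges; $V(\mathcal{D})$ is its vertex set and $E(\mathcal{D})$ is its set of arrows $(x_i,x_j)$ (from $x_i$ to $x_j$). It is vertex-weighted if it is endowed with a function $d\colon V(\mathcal{D})\to\mathbb{N}_+=\{1,2,\ldots\}$; write $d_i=d(x_i)$. Standing convention: if a vertex $x_i$ is a source (it has only arrows leaving it), then $d_i=1$. The edge ideal is $I(\mathcal{D})=(x_ix_j^{d_j}\mid (x_i,x_j)\in E(\mathcal{D}))\subset R=K[x_1,\ldots,x_n]$. An ideal $J\subset R$ is called Cohen--Macaulay if $R/J$ is a Cohen--Macaulay ring. *)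

theory Defs
  imports "HOL-Algebra.Algebraic_Closure_Type" "HOL-Library.Poly_Mapping"
    "HOL-Library.Extended_Nat"
begin

definition frac_rel :: "('a, 'b) ring_scheme \<Rightarrow> 'a set \<Rightarrow> (('a \<times> 'a) \<times> ('a \<times> 'a)) set"
  where "frac_rel A S =
    {((a, s), (b, t)). a \<in> carrier A \<and> s \<in> S \<and> b \<in> carrier A \<and> t \<in> S \<and>
       (\<exists>u\<in>S. u \<otimes>\<^bsub>A\<^esub> (t \<otimes>\<^bsub>A\<^esub> a) = u \<otimes>\<^bsub>A\<^esub> (s \<otimes>\<^bsub>A\<^esub> b))}"

definition fraction :: "('a, 'b) ring_scheme \<Rightarrow> 'a set \<Rightarrow> 'a \<Rightarrow> 'a \<Rightarrow> ('a \<times> 'a) set"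
  where "fraction A S a s = frac_rel A S `` {(a, s)}"

text \<open>The union over all representatives collapses to a single class, because the
  operations respect the equivalence of fractions.\<close>

definition localization :: "('a, 'b) ring_scheme \<Rightarrow> 'a set \<Rightarrow> ('a \<times> 'a) set ring"
  where "localization A S =
    \<lparr>carrier = (carrier A \<times> S) // frac_rel A S,
     monoid.mult = (\<lambda>x y. \<Union>(a, s)\<in>x. \<Union>(b, t)\<in>y. fraction A S (a \<otimes>\<^bsub>A\<^esub> b) (s \<otimes>\<^bsub>A\<^esub> t)),
     one = fraction A S \<one>\<^bsub>A\<^esub> \<one>\<^bsub>A\<^esub>,
     ring.zero = fraction A S \<zero>\<^bsub>A\<^esub> \<one>\<^bsub>A\<^esub>,
     add = (\<lambda>x y. \<Union>(a, s)\<in>x. \<Union>(b, t)\<in>y.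
              fraction A S ((t \<otimes>\<^bsub>A\<^esub> a) \<oplus>\<^bsub>A\<^esub> (s \<otimes>\<^bsub>A\<^esub> b)) (s \<otimes>\<^bsub>A\<^esub> t))\<rparr>"

definition krull_dim :: "('a, 'b) ring_scheme \<Rightarrow> enat"
  where "krull_dim A =
    Sup {enat n | n. \<exists>P :: nat \<Rightarrow> 'a set.
      (\<forall>i\<le>n. primeideal (P i) A) \<and> (\<forall>i<n. P i \<subset> P (Suc i))}"

text \<open>The middle conjunct says that \<open>xs ! i\<close> is a nonzerodivisor modulo the ideal
  generated by its predecessors.\<close>

definition regular_sequence :: "('a, 'b) ring_scheme \<Rightarrow> 'a list \<Rightarrow> bool"
  where "regular_sequence A xs \<longleftrightarrow>
    set xs \<subseteq> carrier A \<and>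
    (\<forall>i<length xs. \<forall>b\<in>carrier A.
       (xs ! i) \<otimes>\<^bsub>A\<^esub> b \<in> Idl\<^bsub>A\<^esub> (set (take i xs)) \<longrightarrow> b \<in> Idl\<^bsub>A\<^esub> (set (take i xs))) \<and>
    Idl\<^bsub>A\<^esub> (set xs) \<noteq> carrier A"

definition depth :: "('a, 'b) ring_scheme \<Rightarrow> 'a set \<Rightarrow> enat"
  where "depth A J = Sup {enat (length xs) | xs. regular_sequence A xs \<and> set xs \<subseteq> J}"

definition cohen_macaulay_local :: "('a, 'b) ring_scheme \<Rightarrow> bool"
  where "cohen_macaulay_local A \<longleftrightarrow>
    cring A \<and> noetherian_ring A \<and>
    (\<exists>!M. maximalideal M A) \<and>
    (\<forall>M. maximalideal M A \<longrightarrow> depth A M = krull_dim A)"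

definition cohen_macaulay_ring :: "('a, 'b) ring_scheme \<Rightarrow> bool"
  where "cohen_macaulay_ring A \<longleftrightarrow>
    cring A \<and> noetherian_ring A \<and>
    (\<forall>M. maximalideal M A \<longrightarrow> cohen_macaulay_local (localization A (carrier A - M)))"

text \<open>A monomial is a finitely supported exponent vector; multiplication of polynomials is
  the convolution product on \<^typ>\<open>('v \<Rightarrow>\<^sub>0 nat) \<Rightarrow>\<^sub>0 'k\<close>. For finite \<open>'v\<close> this is the ring of
  polynomials over \<open>'k\<close> in \<open>CARD('v)\<close> variables.\<close>

type_synonym ('v, 'k) mpoly = "('v \<Rightarrow>\<^sub>0 nat) \<Rightarrow>\<^sub>0 'k"

abbreviation poly_ring :: "('v, 'k::field) mpoly ring"
  where "poly_ring \<equiv> ring_of_type_algebra"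

definition var :: "'v \<Rightarrow> ('v, 'k::field) mpoly"
  where "var v = Poly_Mapping.single (Poly_Mapping.single v 1) 1"

definition cohen_macaulay_ideal :: "('v, 'k::field) mpoly set \<Rightarrow> bool"
  where "cohen_macaulay_ideal J \<longleftrightarrow> cohen_macaulay_ring (poly_ring Quot J)"

text \<open>The vertex set is the whole type \<open>'v\<close> and \<open>(u, v) \<in> E\<close> is an arrow from \<open>u\<close> to \<open>v\<close>.
  Asymmetry of \<open>E\<close> says that there are no loops and that every edge of the underlying
  simple graph carries exactly one orientation.\<close>

definition oriented_graph :: "('v \<times> 'v) set \<Rightarrow> bool"
  where "oriented_graph E \<longleftrightarrow> asym E"

text \<open>A source has at least one arrow leaving it; an isolated vertex may have any positive
  weight, which does not enter the edge ideal.\<close>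

definition source :: "('v \<times> 'v) set \<Rightarrow> 'v \<Rightarrow> bool"
  where "source E v \<longleftrightarrow> (\<exists>w. (v, w) \<in> E) \<and> (\<nexists>u. (u, v) \<in> E)"

definition weighted_oriented_graph :: "('v \<times> 'v) set \<Rightarrow> ('v \<Rightarrow> nat) \<Rightarrow> bool"
  where "weighted_oriented_graph E d \<longleftrightarrow>
    oriented_graph E \<and> (\<forall>v. d v \<ge> 1) \<and> (\<forall>v. source E v \<longrightarrow> d v = 1)"

definition edge_ideal :: "('v \<times> 'v) set \<Rightarrow> ('v \<Rightarrow> nat) \<Rightarrow> ('v, 'k::field) mpoly set"
  where "edge_ideal E d = Idl\<^bsub>poly_ring\<^esub> {var u * var v ^ d v | u v. (u, v) \<in> E}"

end

theory Submission
  imports Defs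
begin

text \<open>
  The idea is to find a test for the Cohen--Macaulay property that is compatible with
  substitutions \<open>x\<^sub>v \<mapsto> x\<^sub>v\<^bsup>e v\<^esup>\<close>, and then to compare the two edge ideals by such substitutions.

  Through \<open>x\<^sub>v \<mapsto> x\<^sub>v\<^bsup>e v\<^esup>\<close> the polynomial ring \<open>R\<close> becomes a free module over itself, with the
  monomials \<open>x\<^bsup>\<rho>\<^esup>\<close>, \<open>\<rho> v < e v\<close>, as a basis, and the residue ring of a monomial ideal becomes a
  direct sum of residue modules \<open>R / I\<^sub>\<rho>\<close> by monomial ideals \<open>I\<^sub>\<rho>\<close>. Take the edge ideal \<open>I\<close> with
  weights \<open>d\<close> and \<open>e v = max 1 (d v - 1)\<close>. Then \<open>I\<^sub>\<rho>\<close> is the colon ideal of \<open>I\<^sub>U\<close> by the product of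
  the variables \<open>x\<^sub>v\<close> with \<open>\<rho> v > 0\<close>; in particular \<open>I\<^sub>0 = I\<^sub>U\<close>. So \<open>R / I\<^sub>U\<close> is a direct summand
  of \<open>R / I\<close>. On the other hand, the residue ring of each of these colon ideals is a direct
  summand of \<open>R / I\<^sub>U\<close> itself, for the substitution that squares the variables with \<open>\<rho> v > 0\<close>
  (\<open>exponent_position\<close>). Since a sequence
  is regular on a direct sum if and only if it is regular on every summand
  (\<open>coordinatewise_regular_seq\<close>), regularity of suitable sequences passes from one ideal to the
  other in both directions.

  The test consists of powers of the first \<open>r\<close> elementary symmetric polynomials in the elements
  \<open>x\<^sub>v\<^bsup>c v\<^esup>\<close>, where \<open>r\<close> is the independence number of the graph, which is the dimension of both
  residue rings. If the residue ring is Cohen--Macaulay, these are regular sequences for all \<open>c\<close>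
  and all powers (\<open>cohen_macaulay_imp_regular\<close>): at the irrelevant ideal they are systems of
  parameters in a local ring of depth at least \<open>r\<close>, hence locally regular
  (\<open>parameters_regular\<close>), and homogeneity makes them globally regular. Conversely it suffices that
  they are regular for one \<open>c\<close> and all powers (\<open>regular_imp_cohen_macaulay\<close>): by Zariski's lemma
  a maximal ideal \<open>M\<close> contains a monic polynomial in each of the parameters, these polynomials
  have powers of the parameters as leading forms, and so they form a regular sequence of length
  \<open>r\<close> in \<open>M\<close>. In both directions dimensions are bounded by the growth of the number of independent
  polynomials of bounded degree (\<open>prime_chain_bound\<close>).

  Ideals of the localizations of the residue ring correspond to saturated ideals of \<open>R\<close>. This
  dictionary (\<open>cohen_macaulay_ring_iff\<close>) expresses depth and dimension of all local rings in
  terms of ideals of \<open>R\<close>, so that the commutative algebra takes place in a ring given as a type.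
\<close>



section \<open>Ideals of a commutative ring, localized at a prime\<close>

definition is_ideal :: "'a::comm_ring_1 set \<Rightarrow> bool"
  where "is_ideal J \<longleftrightarrow> 0 \<in> J \<and> (\<forall>a\<in>J. \<forall>b\<in>J. a + b \<in> J) \<and> (\<forall>r. \<forall>a\<in>J. r * a \<in> J)"

definition adjoin :: "'a::comm_ring_1 set \<Rightarrow> 'a \<Rightarrow> 'a set"
  where "adjoin J x = {j + a * x | j a. j \<in> J}"

definition is_prime :: "'a::comm_ring_1 set \<Rightarrow> bool"
  where "is_prime P \<longleftrightarrow> is_ideal P \<and> 1 \<notin> P \<and> (\<forall>a b. a * b \<in> P \<longrightarrow> a \<in> P \<or> b \<in> P)"

definition colon :: "'a::comm_ring_1 set \<Rightarrow> 'a \<Rightarrow> 'a set"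
  where "colon J b = {a. a * b \<in> J}"

definition nonzerodivisor_mod :: "'a::comm_ring_1 \<Rightarrow> 'a set \<Rightarrow> bool"
  where "nonzerodivisor_mod x J \<longleftrightarrow> (\<forall>b. x * b \<in> J \<longrightarrow> b \<in> J)"

fun regular_seq :: "'a::comm_ring_1 set \<Rightarrow> 'a list \<Rightarrow> bool"
  where "regular_seq J [] \<longleftrightarrow> True"
  | "regular_seq J (x # xs) \<longleftrightarrow> nonzerodivisor_mod x J \<and> regular_seq (adjoin J x) xs"

text \<open>The ideals of the local ring at a prime \<open>M\<close>, pulled back to the ring itself, are the
  saturated ideals.\<close>

definition saturated :: "'a::comm_ring_1 set \<Rightarrow> 'a set \<Rightarrow> bool"
  where "saturated M J \<longleftrightarrow> is_ideal J \<and> (\<forall>s b. s \<notin> M \<longrightarrow> s * b \<in> J \<longrightarrow> b \<in> J)"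

definition saturation :: "'a::comm_ring_1 set \<Rightarrow> 'a set \<Rightarrow> 'a set"
  where "saturation M J = {b. \<exists>s. s \<notin> M \<and> s * b \<in> J}"

definition associated_prime :: "'a::comm_ring_1 set \<Rightarrow> 'a set \<Rightarrow> bool"
  where "associated_prime J P \<longleftrightarrow> is_prime P \<and> (\<exists>b. P = colon J b)"

definition prime_chain :: "(nat \<Rightarrow> 'a::comm_ring_1 set) \<Rightarrow> nat \<Rightarrow> bool"
  where "prime_chain P k \<longleftrightarrow> (\<forall>i\<le>k. is_prime (P i)) \<and> (\<forall>i<k. P i \<subset> P (Suc i))"

definition noetherian :: "'a::comm_ring_1 itself \<Rightarrow> bool"
  where "noetherian _ \<longleftrightarrow>
    (\<forall>F :: 'a set set. F \<noteq> {} \<and> (\<forall>J\<in>F. is_ideal J) \<longrightarrow> (\<exists>J\<in>F. \<forall>J'\<in>F. J \<subseteq> J' \<longrightarrow> J' = J))"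

lemma is_idealI:
  assumes "0 \<in> J" "\<And>a b. a \<in> J \<Longrightarrow> b \<in> J \<Longrightarrow> a + b \<in> J" "\<And>r a. a \<in> J \<Longrightarrow> r * a \<in> J"
  shows "is_ideal J"
  using assms by (auto simp: is_ideal_def)

lemma ideal_zero: "is_ideal J \<Longrightarrow> 0 \<in> J"
  and ideal_add: "is_ideal J \<Longrightarrow> a \<in> J \<Longrightarrow> b \<in> J \<Longrightarrow> a + b \<in> J"
  and ideal_mult: "is_ideal J \<Longrightarrow> a \<in> J \<Longrightarrow> r * a \<in> J"
  by (auto simp: is_ideal_def)

lemma ideal_mult_right: "is_ideal J \<Longrightarrow> a \<in> J \<Longrightarrow> a * r \<in> J"
  by (metis ideal_mult mult.commute)

lemma ideal_uminus: "is_ideal J \<Longrightarrow> a \<in> J \<Longrightarrow> - a \<in> J"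
  by (metis ideal_mult mult_minus1)

lemma ideal_diff: "is_ideal J \<Longrightarrow> a \<in> J \<Longrightarrow> b \<in> J \<Longrightarrow> a - b \<in> J"
  by (metis ideal_add ideal_uminus diff_conv_add_uminus)

lemma ideal_sum: "is_ideal J \<Longrightarrow> (\<And>i. i \<in> A \<Longrightarrow> f i \<in> J) \<Longrightarrow> sum f A \<in> J"
  by (induction A rule: infinite_finite_induct) (auto intro: ideal_zero ideal_add)

lemma ideal_add_cancel: "is_ideal J \<Longrightarrow> a \<in> J \<Longrightarrow> a + b \<in> J \<longleftrightarrow> b \<in> J"
  by (metis ideal_add ideal_diff add_diff_cancel_left')

lemma ideal_cong: "is_ideal J \<Longrightarrow> a - b \<in> J \<Longrightarrow> a \<in> J \<longleftrightarrow> b \<in> J"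
  by (metis ideal_add_cancel diff_add_cancel)

lemma ideal_adjoin: "is_ideal J \<Longrightarrow> is_ideal (adjoin J x)"
proof (rule is_idealI)
  assume J: "is_ideal J"
  show "0 \<in> adjoin J x"
    unfolding adjoin_def using ideal_zero[OF J] by (auto intro!: exI[of _ 0])
  show "a + b \<in> adjoin J x" if ab: "a \<in> adjoin J x" "b \<in> adjoin J x" for a b
  proof -
    obtain j c j' c' where "j \<in> J" "a = j + c * x" "j' \<in> J" "b = j' + c' * x"
      using ab unfolding adjoin_def by blast
    then have "a + b = (j + j') + (c + c') * x" "j + j' \<in> J"
      using ideal_add[OF J] by (auto simp: algebra_simps)
    then show ?thesis unfolding adjoin_def by blast
  qed
  show "r * a \<in> adjoin J x" if a: "a \<in> adjoin J x" for r a
  proof -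
    obtain j c where "j \<in> J" "a = j + c * x" using a by (auto simp: adjoin_def)
    then have "r * a = r * j + (r * c) * x" "r * j \<in> J"
      using ideal_mult[OF J] by (auto simp: algebra_simps)
    then show ?thesis unfolding adjoin_def by blast
  qed
qed

lemma adjoin_superset: "J \<subseteq> adjoin J x"
proof
  fix j assume "j \<in> J"
  moreover have "j = j + 0 * x" by simp
  ultimately show "j \<in> adjoin J x" unfolding adjoin_def by blast
qed

lemma adjoin_self: "is_ideal J \<Longrightarrow> x \<in> adjoin J x"
proof -
  assume "is_ideal J"
  then have "0 \<in> J" by (rule ideal_zero)
  moreover have "x = 0 + 1 * x" by simp
  ultimately show ?thesis unfolding adjoin_def by blast
qed

lemma adjoin_least: "is_ideal J' \<Longrightarrow> J \<subseteq> J' \<Longrightarrow> x \<in> J' \<Longrightarrow> adjoin J x \<subseteq> J'"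
  unfolding adjoin_def by (auto intro: ideal_add ideal_mult)

lemma prime_is_ideal: "is_prime P \<Longrightarrow> is_ideal P"
  and prime_one: "is_prime P \<Longrightarrow> 1 \<notin> P"
  and prime_mult: "is_prime P \<Longrightarrow> a * b \<in> P \<Longrightarrow> a \<in> P \<or> b \<in> P"
  by (auto simp: is_prime_def)

lemma prime_mult_notin: "is_prime P \<Longrightarrow> a \<notin> P \<Longrightarrow> b \<notin> P \<Longrightarrow> a * b \<notin> P"
  by (auto simp: is_prime_def)

lemma prime_power: "is_prime P \<Longrightarrow> a ^ n \<in> P \<Longrightarrow> a \<in> P"
  by (induction n) (auto dest: prime_mult prime_one)

lemma prime_prod:
  assumes "is_prime P" "finite A" "prod f A \<in> P"
  obtains a where "a \<in> A" "f a \<in> P"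
  using assms(2,3,1)
proof (induction A arbitrary: thesis rule: finite_induct)
  case empty
  then show ?case by (simp add: prime_one)
next
  case (insert x A)
  then have "f x \<in> P \<or> prod f A \<in> P" by (metis prime_mult prod.insert)
  then show ?case using insert by blast
qed

lemma ideal_colon: "is_ideal J \<Longrightarrow> is_ideal (colon J b)"
  unfolding colon_def
  by (rule is_idealI) (auto simp: ideal_zero ideal_add ideal_mult distrib_right mult.assoc)

lemma colon_superset: "is_ideal J \<Longrightarrow> J \<subseteq> colon J b"
  by (auto simp: colon_def ideal_mult_right)

lemma noetherian_maximal:
  assumes "noetherian TYPE('a::comm_ring_1)" "J0 \<in> F" "\<And>J. J \<in> F \<Longrightarrow> is_ideal (J :: 'a set)"
  shows "\<exists>J\<in>F. \<forall>J'\<in>F. J \<subseteq> J' \<longrightarrow> J' = J"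
proof -
  have "F \<noteq> {} \<and> (\<forall>J\<in>F. is_ideal J)" using assms by auto
  then show ?thesis
    using assms(1)[unfolded noetherian_def, rule_format] by simp
qed

lemma noetherianD:
  assumes "noetherian TYPE('a::comm_ring_1)" "J0 \<in> F" "\<And>J. J \<in> F \<Longrightarrow> is_ideal (J :: 'a set)"
  obtains J where "J \<in> F" "\<And>J'. J' \<in> F \<Longrightarrow> J \<subseteq> J' \<Longrightarrow> J' = J"
  using noetherian_maximal[OF assms] that by auto

text \<open>An ideal that is maximal among the proper annihilators containing a given one is
  prime: this is how all associated primes are found.\<close>

lemma associated_exists:
  assumes noeth: "noetherian TYPE('a::comm_ring_1)" and J: "is_ideal (J :: 'a set)" and b: "b \<notin> J"
  obtains P where "associated_prime J P" "colon J b \<subseteq> P"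
proof -
  let ?F = "{colon J c | c. c \<notin> J \<and> colon J b \<subseteq> colon J c}"
  have "colon J b \<in> ?F" using b by blast
  moreover have "is_ideal K" if "K \<in> ?F" for K using that ideal_colon[OF J] by blast
  ultimately have "\<exists>P\<in>?F. \<forall>J'\<in>?F. P \<subseteq> J' \<longrightarrow> J' = P"
    by (rule noetherian_maximal[OF noeth])
  then obtain P where P: "P \<in> ?F" and max: "\<And>J'. J' \<in> ?F \<Longrightarrow> P \<subseteq> J' \<Longrightarrow> J' = P"
    by (elim bexE) (simp only: Ball_def)
  then obtain c where c: "P = colon J c" "c \<notin> J" "colon J b \<subseteq> colon J c" by blast
  have "is_prime P"
    unfolding is_prime_def
  proof (intro conjI allI impI)
    show "is_ideal P" using c ideal_colon[OF J] by simp
    show "1 \<notin> P" using c by (simp add: colon_def)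
    fix x y assume xy: "x * y \<in> P"
    show "x \<in> P \<or> y \<in> P"
    proof (rule disjCI)
      assume "y \<notin> P"
      then have yc: "y * c \<notin> J" using c by (simp add: colon_def)
      have "P \<subseteq> colon J (y * c)"
      proof
        fix a assume "a \<in> P"
        then have "y * (a * c) \<in> J" unfolding c colon_def using ideal_mult[OF J] by blast
        then show "a \<in> colon J (y * c)" by (simp add: colon_def mult.left_commute)
      qed
      then have "colon J (y * c) = P" using max c yc by blast
      moreover have "x \<in> colon J (y * c)" using xy c by (simp add: colon_def mult.assoc)
      ultimately show "x \<in> P" by simp
    qed
  qed
  then show ?thesis using that c by (auto simp: associated_prime_def)
qed

text \<open>The associated primes of \<open>J\<close> other than the annihilator \<open>colon J b\<close> of \<open>b\<close> survive
  modulo \<open>b\<close>, so that finiteness follows by Noetherian induction.\<close>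

lemma finite_associated:
  assumes noeth: "noetherian TYPE('a::comm_ring_1)" and "is_ideal (J :: 'a set)"
  shows "finite {P. associated_prime J P}"
proof (rule ccontr)
  let ?F = "{J :: 'a set. is_ideal J \<and> infinite {P. associated_prime J P}}"
  assume "\<not> ?thesis"
  then have "J \<in> ?F" using assms by simp
  then obtain J where J: "J \<in> ?F" and max: "\<And>J'. J' \<in> ?F \<Longrightarrow> J \<subseteq> J' \<Longrightarrow> J' = J"
    by (rule noetherianD[OF noeth, of J ?F]) auto
  then have iJ: "is_ideal J" by simp
  obtain P1 where "associated_prime J P1" using J by (metis (mono_tags) Collect_empty_eq finite.emptyI mem_Collect_eq)
  then obtain b where b: "P1 = colon J b" "is_prime P1" by (auto simp: associated_prime_def)
  have "b \<notin> J" using b prime_one[of P1] by (auto simp: colon_def)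
  then have "adjoin J b \<noteq> J" using adjoin_self[OF iJ] by blast
  then have fin: "finite {P. associated_prime (adjoin J b) P}"
    using max[of "adjoin J b"] adjoin_superset[of J b] ideal_adjoin[OF iJ] by blast
  have "{P. associated_prime J P} \<subseteq> insert P1 {P. associated_prime (adjoin J b) P}"
  proof
    fix P assume "P \<in> {P. associated_prime J P}"
    then obtain u where u: "P = colon J u" "is_prime P" by (auto simp: associated_prime_def)
    show "P \<in> insert P1 {P. associated_prime (adjoin J b) P}"
    proof (cases "\<exists>c e. c \<notin> P \<and> c * u - e * b \<in> J")
      case True
      then obtain c e where ce: "c \<notin> P" "c * u - e * b \<in> J" by blast
      have eq: "a * (c * u) \<in> J \<longleftrightarrow> a * (e * b) \<in> J" for a
      proof (rule ideal_cong[OF iJ])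
        show "a * (c * u) - a * (e * b) \<in> J"
          using ideal_mult[OF iJ ce(2)] by (simp add: right_diff_distrib)
      qed
      have l: "a * (c * u) \<in> J \<longleftrightarrow> a \<in> P" for a
      proof -
        have "a * (c * u) \<in> J \<longleftrightarrow> a * c \<in> P" using u by (simp add: colon_def mult.assoc)
        also have "\<dots> \<longleftrightarrow> a \<in> P"
          using prime_mult[OF u(2)] ce(1) ideal_mult_right[OF prime_is_ideal[OF u(2)]] by blast
        finally show ?thesis .
      qed
      have e: "e \<notin> P1"
        using l[of 1] eq[of 1] prime_one[OF u(2)] b by (auto simp: colon_def)
      have r: "a * (e * b) \<in> J \<longleftrightarrow> a \<in> P1" for a
      proof -
        have "a * (e * b) \<in> J \<longleftrightarrow> a * e \<in> P1" using b by (simp add: colon_def mult.assoc)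
        also have "\<dots> \<longleftrightarrow> a \<in> P1"
          using prime_mult[OF b(2)] e ideal_mult_right[OF prime_is_ideal[OF b(2)]] by blast
        finally show ?thesis .
      qed
      have "P = P1" using l r eq by blast
      then show ?thesis by simp
    next
      case False
      have "colon (adjoin J b) u = P"
      proof (rule equalityI; rule subsetI)
        fix a assume "a \<in> P"
        then show "a \<in> colon (adjoin J b) u"
          using u adjoin_superset[of J b] by (auto simp: colon_def)
      next
        fix a assume "a \<in> colon (adjoin J b) u"
        then obtain j e where "a * u = j + e * b" "j \<in> J" by (auto simp: colon_def adjoin_def)
        then have "a * u - e * b \<in> J" by simp
        then show "a \<in> P" using False by blast
      qed
      then show ?thesis using u by (auto simp: associated_prime_def)
    qed
  qed
  then have "finite {P. associated_prime J P}" using fin by (metis finite.insertI finite_subset)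
  then show False using J by simp
qed

text \<open>Prime avoidance: a minimal counterexample has elements \<open>x P\<close> lying in exactly one of
  the primes, and then one of them plus the product of the others lies in none.\<close>

lemma prime_avoidance:
  assumes "finite \<P>" "\<And>P. P \<in> \<P> \<Longrightarrow> is_prime P" "is_ideal J" "J \<subseteq> \<Union>\<P>"
  shows "\<exists>P\<in>\<P>. J \<subseteq> P"
  using assms
proof (induction \<P> rule: finite_psubset_induct)
  case (psubset \<P>)
  show ?case
  proof (cases "\<exists>P\<in>\<P>. J \<subseteq> \<Union>(\<P> - {P})")
    case True
    then obtain P where P: "P \<in> \<P>" "J \<subseteq> \<Union>(\<P> - {P})" by blast
    have "\<P> - {P} \<subset> \<P>" using P by blast
    then have "\<exists>P'\<in>\<P> - {P}. J \<subseteq> P'" using psubset.IH psubset.prems P by blast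
    then show ?thesis by blast
  next
    case False
    have "\<exists>x. x \<in> J \<and> x \<in> P \<and> x \<notin> \<Union>(\<P> - {P})" if P: "P \<in> \<P>" for P
    proof -
      obtain x where "x \<in> J" "x \<notin> \<Union>(\<P> - {P})" using False P by blast
      then show ?thesis using psubset.prems(3) by blast
    qed
    then obtain x where x: "\<And>P. P \<in> \<P> \<Longrightarrow> x P \<in> J \<and> x P \<in> P \<and> x P \<notin> \<Union>(\<P> - {P})" by metis
    have "0 \<in> J" using psubset.prems ideal_zero by blast
    then obtain P where P: "P \<in> \<P>" using psubset.prems by blast
    show ?thesis
    proof (cases "\<P> = {P}")
      case True
      then show ?thesis using psubset.prems by simp
    next
      case ne: False
      let ?y = "\<Prod>P'\<in>\<P> - {P}. x P'"
      obtain P' where P': "P' \<in> \<P> - {P}" using ne P by blast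
      have y_mem: "?y \<in> K" if "is_ideal K" "P'' \<in> \<P> - {P}" "x P'' \<in> K" for K P''
        using that psubset.hyps
        by (metis (no_types, lifting) finite_Diff ideal_mult_right prod.remove)
      have "?y \<in> J" using y_mem[OF psubset.prems(2) P'] x P' by blast
      then have "x P + ?y \<in> J" using x[OF P] psubset.prems ideal_add by blast
      then obtain P0 where P0: "P0 \<in> \<P>" "x P + ?y \<in> P0" using psubset.prems by blast
      have i0: "is_ideal P0" using P0 psubset.prems prime_is_ideal by blast
      show ?thesis
      proof (cases "P0 = P")
        case True
        then have "?y \<in> P"
          using P0 x[OF P] ideal_add_cancel[OF i0] by blast
        moreover have "is_prime P" "finite (\<P> - {P})" using P psubset by auto
        ultimately obtain P'' where "P'' \<in> \<P> - {P}" "x P'' \<in> P" by (metis prime_prod)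
        then show ?thesis using x P by blast
      next
        case neq: False
        then have "?y \<in> P0" using y_mem[OF i0] P0 x by blast
        then have "x P \<in> P0"
          using P0 ideal_add_cancel[OF i0, of ?y "x P"] by (simp add: add.commute)
        then show ?thesis using x[OF P] P0 neq by blast
      qed
    qed
  qed
qed

lemma nonzerodivisor_iff:
  assumes noeth: "noetherian TYPE('a::comm_ring_1)" and J: "is_ideal (J :: 'a set)"
  shows "nonzerodivisor_mod x J \<longleftrightarrow> (\<forall>P. associated_prime J P \<longrightarrow> x \<notin> P)"
proof
  assume x: "nonzerodivisor_mod x J"
  show "\<forall>P. associated_prime J P \<longrightarrow> x \<notin> P"
  proof (intro allI impI notI)
    fix P assume "associated_prime J P" "x \<in> P"
    then obtain b where b: "P = colon J b" "is_prime P" by (auto simp: associated_prime_def)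
    then have "b \<in> J" using \<open>x \<in> P\<close> x by (auto simp: nonzerodivisor_mod_def colon_def)
    then have "1 \<in> P" using b by (simp add: colon_def)
    then show False using b prime_one by blast
  qed
next
  assume *: "\<forall>P. associated_prime J P \<longrightarrow> x \<notin> P"
  show "nonzerodivisor_mod x J"
    unfolding nonzerodivisor_mod_def
  proof (intro allI impI, rule ccontr)
    fix b assume b: "x * b \<in> J" "b \<notin> J"
    then obtain P where "associated_prime J P" "colon J b \<subseteq> P" by (metis associated_exists[OF noeth J])
    then show False using * b by (auto simp: colon_def)
  qed
qed

section \<open>Depth of a local ring\<close>

locale local_noetherian =
  fixes M :: "'a::comm_ring_1 set"
  assumes prime_M: "is_prime M" and noeth: "noetherian TYPE('a)"
begin

lemma M_ideal: "is_ideal M" using prime_M by (simp add: is_prime_def)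

abbreviation sat :: "'a set \<Rightarrow> bool" where "sat \<equiv> saturated M"

text \<open>The ideal of a further quotient of the local ring \<open>R\<^sub>M / J\<close>, by the image of \<open>x\<close>.\<close>

definition quot :: "'a set \<Rightarrow> 'a \<Rightarrow> 'a set"
  where "quot J x = saturation M (adjoin J x)"

fun regular :: "'a set \<Rightarrow> 'a list \<Rightarrow> bool"
  where "regular J [] \<longleftrightarrow> True"
  | "regular J (x # xs) \<longleftrightarrow> nonzerodivisor_mod x J \<and> regular (quot J x) xs"

fun depth_ge :: "nat \<Rightarrow> 'a set \<Rightarrow> bool"
  where "depth_ge 0 J \<longleftrightarrow> True"
  | "depth_ge (Suc k) J \<longleftrightarrow> (\<exists>x\<in>M. nonzerodivisor_mod x J \<and> depth_ge k (quot J x))"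

lemma sat_ideal: "sat J \<Longrightarrow> is_ideal J" by (simp add: saturated_def)

lemma satD: "sat J \<Longrightarrow> s \<notin> M \<Longrightarrow> s * b \<in> J \<Longrightarrow> b \<in> J" by (auto simp: saturated_def)

lemma M_mult: "s \<notin> M \<Longrightarrow> t \<notin> M \<Longrightarrow> s * t \<notin> M" using prime_M by (auto simp: is_prime_def)

lemma saturation_superset: "J \<subseteq> saturation M J"
  unfolding saturation_def using prime_one[OF prime_M] by (auto intro: exI[of _ 1])

lemma sat_saturation:
  assumes J: "is_ideal J"
  shows "sat (saturation M J)"
  unfolding saturated_def
proof
  show "is_ideal (saturation M J)"
  proof (rule is_idealI)
    show "0 \<in> saturation M J" using ideal_zero[OF J] saturation_superset by blast
    show "a + b \<in> saturation M J" if ab: "a \<in> saturation M J" "b \<in> saturation M J" for a b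
    proof -
      obtain s t where "s \<notin> M" "s * a \<in> J" "t \<notin> M" "t * b \<in> J"
        using ab unfolding saturation_def by blast
      then have "t * (s * a) + s * (t * b) \<in> J" using J ideal_add ideal_mult by blast
      moreover have "t * (s * a) + s * (t * b) = (s * t) * (a + b)" by (simp add: algebra_simps)
      ultimately show ?thesis
        using M_mult \<open>s \<notin> M\<close> \<open>t \<notin> M\<close> unfolding saturation_def by auto
    qed
    show "r * a \<in> saturation M J" if a: "a \<in> saturation M J" for r a
    proof -
      obtain s where "s \<notin> M" "s * a \<in> J" using a unfolding saturation_def by blast
      then have "s * (r * a) \<in> J" using ideal_mult[OF J, of "s * a" r] by (simp add: mult.left_commute)
      then show ?thesis using \<open>s \<notin> M\<close> unfolding saturation_def by blast
    qed
  qed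
  show "\<forall>s b. s \<notin> M \<longrightarrow> s * b \<in> saturation M J \<longrightarrow> b \<in> saturation M J"
    unfolding saturation_def using M_mult by (auto simp flip: mult.assoc)
qed

lemma saturation_least: "sat J' \<Longrightarrow> J \<subseteq> J' \<Longrightarrow> saturation M J \<subseteq> J'"
  unfolding saturation_def by (auto dest: satD)

lemma sat_quot: "sat J \<Longrightarrow> sat (quot J x)"
  unfolding quot_def by (intro sat_saturation ideal_adjoin sat_ideal)

lemma quot_superset: "J \<subseteq> quot J x"
  unfolding quot_def using adjoin_superset saturation_superset by blast

lemma quot_self: "sat J \<Longrightarrow> x \<in> quot J x"
  unfolding quot_def using adjoin_self[OF sat_ideal] saturation_superset by blast

lemma quot_least: "sat J' \<Longrightarrow> J \<subseteq> J' \<Longrightarrow> x \<in> J' \<Longrightarrow> quot J x \<subseteq> J'"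
  unfolding quot_def by (intro saturation_least adjoin_least sat_ideal)

lemma adjoin_subset_quot: "adjoin J x \<subseteq> quot J x"
  unfolding quot_def by (rule saturation_superset)

lemma quot_commute:
  assumes "sat J" shows "quot (quot J x) y = quot (quot J y) x"
proof -
  have "quot (quot J x) y \<subseteq> quot (quot J y) x" for x y
  proof (rule quot_least)
    show "sat (quot (quot J y) x)" using assms sat_quot by blast
    show "quot J x \<subseteq> quot (quot J y) x"
      using assms quot_superset sat_quot quot_self by (meson quot_least subset_trans)
    show "y \<in> quot (quot J y) x"
      using assms quot_superset sat_quot quot_self by blast
  qed
  then show ?thesis by blast
qed

lemma quotE:
  assumes "b \<in> quot J x"
  obtains s j a where "s \<notin> M" "j \<in> J" "s * b = j + a * x"
  using assms by (auto simp: quot_def saturation_def adjoin_def)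

lemma quotI: "s \<notin> M \<Longrightarrow> j \<in> J \<Longrightarrow> s * b = j + a * x \<Longrightarrow> b \<in> quot J x"
  by (auto simp: quot_def saturation_def adjoin_def)

lemma associated_subset_M:
  assumes "sat J" "associated_prime J P" shows "P \<subseteq> M"
proof
  fix a assume "a \<in> P"
  obtain b where b: "P = colon J b" "is_prime P" using assms by (auto simp: associated_prime_def)
  show "a \<in> M"
  proof (rule ccontr)
    assume "a \<notin> M"
    then have "b \<in> J" using \<open>a \<in> P\<close> b assms satD by (auto simp: colon_def)
    then have "1 \<in> P" using b by (simp add: colon_def)
    then show False using b prime_one by blast
  qed
qed

lemma M_associatedI:
  assumes J: "sat J" and u: "u \<notin> J" and "\<And>m. m \<in> M \<Longrightarrow> m * u \<in> J"
  shows "associated_prime J M"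
proof -
  obtain P where P: "associated_prime J P" "colon J u \<subseteq> P"
    using associated_exists[OF noeth sat_ideal[OF J] u] .
  have "M \<subseteq> colon J u" using assms(3) by (auto simp: colon_def)
  then show ?thesis using P associated_subset_M[OF J] by (metis subset_antisym subset_trans)
qed

text \<open>Kaplansky's exchange of two nonzerodivisors: if \<open>u\<close> spans a copy of the residue field
  modulo \<open>x\<close> and \<open>y u = x w\<close>, then \<open>w\<close> does so modulo \<open>y\<close>.\<close>

lemma M_associated_exchange:
  assumes J: "sat J" and x: "nonzerodivisor_mod x J" "x \<in> M" and y: "nonzerodivisor_mod y J" "y \<in> M"
    and ass: "associated_prime (quot J x) M"
  shows "associated_prime (quot J y) M"
proof -
  have iJ: "is_ideal J" by (rule sat_ideal[OF J])
  have satx: "sat (quot J x)" and saty: "sat (quot J y)" using J sat_quot by blast+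
  obtain u0 where "M = colon (quot J x) u0" using ass unfolding associated_prime_def by blast
  then have u0: "m \<in> M \<longleftrightarrow> m * u0 \<in> quot J x" for m
    unfolding colon_def by blast
  have u0n: "u0 \<notin> quot J x" using u0[of 1] prime_one[OF prime_M] by simp
  have "y * u0 \<in> quot J x" using u0 y by blast
  then obtain s j w where s: "s \<notin> M" "j \<in> J" "s * (y * u0) = j + w * x" by (rule quotE)
  define u where "u = s * u0"
  have un: "u \<notin> quot J x" unfolding u_def using s u0n satD[OF satx] by blast
  have Mu: "m * u \<in> quot J x" if "m \<in> M" for m
  proof -
    have "m * u0 \<in> quot J x" using that u0 by blast
    then have "s * (m * u0) \<in> quot J x" using satx sat_ideal ideal_mult by blast
    then show ?thesis by (simp add: u_def mult.left_commute)
  qed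
  have yu: "y * u = j + x * w" using s by (simp add: u_def algebra_simps)
  show ?thesis
  proof (rule M_associatedI[OF saty])
    show "w \<notin> quot J y"
    proof
      assume "w \<in> quot J y"
      then obtain t j' w' where t: "t \<notin> M" "j' \<in> J" "t * w = j' + w' * y" by (rule quotE)
      have "y * (t * u - x * w') = t * j + x * j'"
      proof -
        have "y * (t * u) = t * j + x * (t * w)" using yu by (simp add: algebra_simps)
        then show ?thesis using t(3) by (simp add: algebra_simps)
      qed
      also have "\<dots> \<in> J" using s t iJ ideal_add ideal_mult by blast
      finally have "t * u - x * w' \<in> J" using y by (auto simp: nonzerodivisor_mod_def)
      then have "u \<in> quot J x"
        by (rule quotI[OF t(1), where a = w']) (simp add: mult.commute)
      then show False using un by simp
    qed
    fix m assume "m \<in> M"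
    then have "m * u \<in> quot J x" by (rule Mu)
    then obtain t j' v where t: "t \<notin> M" "j' \<in> J" "t * (m * u) = j' + v * x" by (rule quotE)
    have "x * (t * m * w - v * y) = y * j' - t * m * j"
    proof -
      have "x * (t * m * w) = t * m * (y * u) - t * m * j" using yu by (simp add: algebra_simps)
      also have "t * m * (y * u) = y * (j' + v * x)" by (simp flip: t(3) add: mult_ac)
      finally show ?thesis by (simp add: algebra_simps)
    qed
    also have "\<dots> \<in> J" using s t iJ ideal_diff ideal_mult by blast
    finally have "t * m * w - v * y \<in> J" using x by (auto simp: nonzerodivisor_mod_def)
    then show "m * w \<in> quot J y"
      by (rule quotI[OF t(1), where a = v]) (simp add: mult.assoc)
  qed
qed

text \<open>As \<open>x, z\<close> is a regular sequence, a relation \<open>x a = z b\<close> forces \<open>b\<close> to be a multiple of \<open>x\<close>, and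
  \<open>x\<close> can be cancelled.\<close>

lemma nonzerodivisor_exchange:
  assumes J: "sat J" and "nonzerodivisor_mod z J" "nonzerodivisor_mod x J" "nonzerodivisor_mod z (quot J x)"
  shows "nonzerodivisor_mod x (quot J z)"
  unfolding nonzerodivisor_mod_def
proof (intro allI impI)
  fix a assume "x * a \<in> quot J z"
  then obtain s j b where s: "s \<notin> M" "j \<in> J" "s * (x * a) = j + b * z" by (rule quotE)
  have iJ: "is_ideal J" by (rule sat_ideal[OF J])
  have "z * b = (- j) + (s * a) * x" using s by (simp add: algebra_simps)
  then have "z * b \<in> adjoin J x" unfolding adjoin_def using ideal_uminus[OF iJ s(2)] by blast
  then have "b \<in> quot J x" using adjoin_subset_quot assms(4) by (auto simp: nonzerodivisor_mod_def)
  then obtain t j' c where t: "t \<notin> M" "j' \<in> J" "t * b = j' + c * x" by (rule quotE)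
  have "x * (t * s * a - c * z) = t * j + z * j'"
  proof -
    have "x * (t * s * a) = t * (j + b * z)" by (simp flip: s(3) add: mult_ac)
    also have "\<dots> = t * j + z * (j' + c * x)" by (simp flip: t(3) add: algebra_simps)
    finally show ?thesis by (simp add: algebra_simps)
  qed
  also have "\<dots> \<in> J" using s t iJ ideal_add ideal_mult by blast
  finally have "t * s * a - c * z \<in> J" using assms(3) by (auto simp: nonzerodivisor_mod_def)
  then show "a \<in> quot J z"
    by (rule quotI[OF M_mult[OF t(1) s(1)], where a = c]) simp
qed

lemma M_not_associated:
  "x \<in> M \<Longrightarrow> sat J \<Longrightarrow> nonzerodivisor_mod x J \<Longrightarrow> \<not> associated_prime J M"
  using nonzerodivisor_iff[OF noeth sat_ideal] by blast

text \<open>Otherwise \<open>M\<close> would be covered by the finitely many associated primes of these ideals, and so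
  be one of them.\<close>

lemma common_nonzerodivisor:
  assumes "finite \<J>" "\<And>J. J \<in> \<J> \<Longrightarrow> sat J \<and> \<not> associated_prime J M"
  obtains z where "z \<in> M" "\<And>J. J \<in> \<J> \<Longrightarrow> nonzerodivisor_mod z J"
proof -
  let ?P = "\<Union>J\<in>\<J>. {P. associated_prime J P}"
  have "finite ?P" using assms finite_associated[OF noeth] sat_ideal by blast
  moreover have "\<And>P. P \<in> ?P \<Longrightarrow> is_prime P" by (auto simp: associated_prime_def)
  moreover have "\<not> (\<exists>P\<in>?P. M \<subseteq> P)" using assms(2) associated_subset_M by (blast dest: subset_antisym)
  ultimately have "\<not> M \<subseteq> \<Union>?P" using prime_avoidance[OF _ _ M_ideal] by metis
  then obtain z where "z \<in> M" "z \<notin> \<Union>?P" by blast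
  then show ?thesis using that assms nonzerodivisor_iff[OF noeth sat_ideal] by blast
qed

text \<open>Rees's theorem on the length of regular sequences. If the given sequence starts with \<open>y\<close>, a common nonzerodivisor \<open>z\<close> modulo \<open>J\<close>, modulo \<open>x\<close> and modulo
  \<open>y\<close> connects \<open>y\<close> to \<open>x\<close> through \<open>quot J z\<close>.\<close>

lemma depth_ge_quot:
  assumes "sat J" "depth_ge (Suc k) J" "x \<in> M" "nonzerodivisor_mod x J"
  shows "depth_ge k (quot J x)"
  using assms
proof (induction k arbitrary: J x)
  case 0
  then show ?case by simp
next
  case (Suc k)
  then obtain y where y: "y \<in> M" "nonzerodivisor_mod y J" "depth_ge (Suc k) (quot J y)" by auto
  then obtain y2 where y2: "y2 \<in> M" "nonzerodivisor_mod y2 (quot J y)" by auto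
  have sy: "sat (quot J y)" and sx: "sat (quot J x)" using Suc sat_quot by blast+
  have nJ: "\<not> associated_prime J M" using M_not_associated y Suc.prems by blast
  have ny: "\<not> associated_prime (quot J y) M" using M_not_associated y2 sy by blast
  have nx: "\<not> associated_prime (quot J x) M" using M_associated_exchange Suc.prems y ny by blast
  obtain z where z: "z \<in> M" and zr: "\<And>K. K \<in> {J, quot J y, quot J x} \<Longrightarrow> nonzerodivisor_mod z K"
    by (rule common_nonzerodivisor[of "{J, quot J y, quot J x}"]) (use Suc.prems sy sx nJ ny nx in auto)
  have sz: "sat (quot J z)" using Suc sat_quot by blast
  have "depth_ge k (quot (quot J y) z)" using Suc.IH[OF sy y(3) z] zr by blast
  then have "depth_ge k (quot (quot J z) y)" using quot_commute Suc.prems by metis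
  moreover have "nonzerodivisor_mod y (quot J z)" using nonzerodivisor_exchange Suc.prems y zr by blast
  ultimately have "depth_ge (Suc k) (quot J z)" using y by auto
  moreover have "nonzerodivisor_mod x (quot J z)" using nonzerodivisor_exchange Suc.prems zr by blast
  ultimately have "depth_ge k (quot (quot J z) x)" using Suc.IH[OF sz] Suc.prems by blast
  then have "depth_ge k (quot (quot J x) z)" using quot_commute Suc.prems by metis
  then show ?case using z zr by auto
qed

text \<open>If no associated prime of \<open>J + (y)\<close> contained \<open>P\<close>, every element killed by \<open>P\<close> modulo \<open>J\<close> would
  be divisible by \<open>y\<close>, again and again.\<close>

lemma associated_step:
  assumes J: "sat J" and P: "associated_prime J P" and y: "y \<in> M" "nonzerodivisor_mod y J"
  obtains Q where "associated_prime (quot J y) Q" "P \<subset> Q"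
proof -
  have iJ: "is_ideal J" by (rule sat_ideal[OF J])
  have sy: "sat (quot J y)" using J sat_quot by blast
  obtain b where b: "P = colon J b" "is_prime P" using P by (auto simp: associated_prime_def)
  have bJ: "b \<notin> J" using b prime_one[of P] by (auto simp: colon_def)
  let ?N = "{u. u \<notin> J \<and> (\<forall>p\<in>P. p * u \<in> J)}"
  have bN: "b \<in> ?N" using b bJ by (auto simp: colon_def)
  have "\<exists>u\<in>?N. u \<notin> quot J y"
  proof (rule ccontr)
    assume neg: "\<not> ?thesis"
    let ?F = "{quot J u | u. u \<in> ?N}"
    have "quot J b \<in> ?F" using bN by blast
    moreover have "is_ideal K" if "K \<in> ?F" for K using that J sat_quot sat_ideal by blast
    ultimately have "\<exists>K\<in>?F. \<forall>K'\<in>?F. K \<subseteq> K' \<longrightarrow> K' = K"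
      by (rule noetherian_maximal[OF noeth])
    then obtain K where K: "K \<in> ?F" and max: "\<And>K'. K' \<in> ?F \<Longrightarrow> K \<subseteq> K' \<Longrightarrow> K' = K"
      by (elim bexE) (simp only: Ball_def)
    then obtain u where u: "u \<in> ?N" "K = quot J u" by blast
    then have "u \<in> quot J y" using neg by blast
    then obtain s j w where s: "s \<notin> M" "j \<in> J" "s * u = j + w * y" by (rule quotE)
    \<comment> \<open>The element \<open>w = u / y\<close> is again killed by \<open>P\<close>, and it generates the same ideal as \<open>u\<close> by the
      maximal choice of \<open>u\<close>. So \<open>w\<close> is a multiple of \<open>u = y w\<close>, which makes \<open>w\<close> vanish as
      \<open>y\<close> lies in the maximal ideal.\<close>
    have wJ: "w \<notin> J"
    proof
      assume "w \<in> J"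
      then have "s * u \<in> J" using s ideal_add[OF iJ] ideal_mult_right[OF iJ] by simp
      then show False using s u satD[OF J] by blast
    qed
    have "p * w \<in> J" if "p \<in> P" for p
    proof -
      have "y * (p * w) = s * (p * u) - p * j" using s by (simp add: algebra_simps)
      also have "\<dots> \<in> J" using u s that iJ ideal_diff ideal_mult by blast
      finally show ?thesis using y by (auto simp: nonzerodivisor_mod_def)
    qed
    then have wN: "w \<in> ?N" using wJ by blast
    have "u \<in> quot J w" by (rule quotI[OF s(1,2), where a = y]) (simp add: s mult.commute)
    then have "quot J u \<subseteq> quot J w"
      using quot_least[OF sat_quot[OF J]] quot_superset by blast
    then have "quot J w = quot J u" using max wN u by blast
    then have "w \<in> quot J u" using quot_self[OF J] by blast
    then obtain t i c where t: "t \<notin> M" "i \<in> J" "t * w = i + c * u" by (rule quotE)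
    have "s * t - y * c \<notin> M"
    proof
      assume "s * t - y * c \<in> M"
      then have "s * t \<in> M" using ideal_cong[OF M_ideal] ideal_mult_right[OF M_ideal y(1)] by blast
      then show False using M_mult s t by blast
    qed
    moreover have "(s * t - y * c) * w \<in> J"
    proof -
      have "(s * t - y * c) * w = s * i + c * j"
      proof -
        have "s * (t * w) = s * i + c * (s * u)" using t by (simp add: algebra_simps)
        then show ?thesis using s by (simp add: algebra_simps)
      qed
      also have "\<dots> \<in> J" using s t iJ ideal_add ideal_mult by blast
      finally show ?thesis .
    qed
    ultimately show False using wJ satD[OF J] by blast
  qed
  then obtain u where u: "u \<in> ?N" "u \<notin> quot J y" by blast
  obtain Q where Q: "associated_prime (quot J y) Q" "colon (quot J y) u \<subseteq> Q"
    using associated_exists[OF noeth sat_ideal[OF sy] u(2)] .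
  have "P \<subseteq> Q" using u Q quot_superset[of J y] by (auto simp: colon_def)
  moreover have "y \<in> Q"
    using Q quot_self[OF J] ideal_mult_right[OF sat_ideal[OF sy]] by (auto simp: colon_def)
  moreover have "y \<notin> P" using nonzerodivisor_iff[OF noeth iJ] P y by blast
  ultimately show ?thesis using that Q by blast
qed

lemma associated_chain:
  assumes "sat J" "depth_ge k J" "associated_prime J P"
  shows "\<exists>Ps. Ps 0 = P \<and> prime_chain Ps k"
  using assms
proof (induction k arbitrary: J P)
  case 0
  then show ?case by (auto simp: prime_chain_def associated_prime_def intro!: exI[of _ "\<lambda>_. P"])
next
  case (Suc k)
  then obtain y where y: "y \<in> M" "nonzerodivisor_mod y J" "depth_ge k (quot J y)" by auto
  obtain Q where Q: "associated_prime (quot J y) Q" "P \<subset> Q" using associated_step Suc.prems y by blast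
  then obtain Ps where Ps: "Ps 0 = Q" "prime_chain Ps k"
    using Suc.IH[OF sat_quot] Suc.prems y by blast
  have "prime_chain (case_nat P Ps) (Suc k)"
    using Ps Q Suc.prems unfolding prime_chain_def associated_prime_def
    by (auto split: nat.split simp: less_Suc_eq_0_disj)
  then show ?case by (auto intro!: exI[of _ "case_nat P Ps"])
qed

text \<open>If the first element of a system of parameters of a Cohen--Macaulay local ring were a zero
  divisor, it would lie in an associated prime, and a chain of primes as long as the depth
  would start there, although modulo a parameter all chains are shorter. After division by it
  the depth has dropped by one only, and induction applies. That \<open>ts\<close> is a system of parameters
  enters through the bound on the chains that start above some of its elements.\<close>

theorem parameters_regular:
  assumes "sat J" "depth_ge (length ts) J" "set ts \<subseteq> M"
    and "\<And>i k Ps. i \<le> length ts \<Longrightarrow> prime_chain Ps k \<Longrightarrow> J \<subseteq> Ps 0 \<Longrightarrow> set (take i ts) \<subseteq> Ps 0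
      \<Longrightarrow> k + i \<le> length ts"
  shows "regular J ts"
  using assms
proof (induction ts arbitrary: J)
  case Nil
  then show ?case by simp
next
  case (Cons t ts)
  have iJ: "is_ideal J" using Cons.prems sat_ideal by blast
  have "t \<notin> P" if P: "associated_prime J P" for P
  proof
    assume "t \<in> P"
    obtain Ps where Ps: "Ps 0 = P" "prime_chain Ps (length (t # ts))"
      using associated_chain Cons.prems P by blast
    have "J \<subseteq> P" using P colon_superset[OF iJ] by (auto simp: associated_prime_def)
    then have "length (t # ts) + 1 \<le> length (t # ts)"
      using Cons.prems(4)[of 1 Ps "length (t # ts)"] Ps \<open>t \<in> P\<close> by simp
    then show False by simp
  qed
  then have t: "nonzerodivisor_mod t J" using nonzerodivisor_iff[OF noeth iJ] by blast
  have "regular (quot J t) ts"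
  proof (rule Cons.IH)
    show "sat (quot J t)" using Cons.prems sat_quot by blast
    show "depth_ge (length ts) (quot J t)"
      by (rule depth_ge_quot) (use Cons.prems t in auto)
    show "set ts \<subseteq> M" using Cons.prems by auto
    fix i k Ps
    assume *: "i \<le> length ts" "prime_chain Ps k" "quot J t \<subseteq> Ps 0" "set (take i ts) \<subseteq> Ps 0"
    have "t \<in> Ps 0" using * quot_self Cons.prems by blast
    moreover have "J \<subseteq> Ps 0" using * quot_superset by blast
    ultimately have "k + Suc i \<le> length (t # ts)" using Cons.prems(4)[of "Suc i" Ps k] * by simp
    then show "k + i \<le> length ts" by simp
  qed
  then show ?case using t by simp
qed

lemma regular_imp_depth_ge: "regular J ts \<Longrightarrow> set ts \<subseteq> M \<Longrightarrow> depth_ge (length ts) J"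
  by (induction ts arbitrary: J) auto

lemma nonzerodivisor_saturation:
  assumes "is_ideal J" "nonzerodivisor_mod x J"
  shows "nonzerodivisor_mod x (saturation M J)"
  unfolding nonzerodivisor_mod_def
proof (intro allI impI)
  fix b assume "x * b \<in> saturation M J"
  then obtain s where s: "s \<notin> M" "s * (x * b) \<in> J" unfolding saturation_def by blast
  then have "x * (s * b) \<in> J" by (simp add: mult.left_commute)
  then have "s * b \<in> J" using assms(2) by (simp add: nonzerodivisor_mod_def)
  then show "b \<in> saturation M J" using s(1) unfolding saturation_def by blast
qed

lemma quot_saturation:
  assumes J: "is_ideal J"
  shows "quot (saturation M J) x = saturation M (adjoin J x)"
proof
  have s: "sat (saturation M (adjoin J x))" using J by (intro sat_saturation ideal_adjoin)
  have sup: "adjoin J x \<subseteq> saturation M (adjoin J x)" by (rule saturation_superset)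
  show "quot (saturation M J) x \<subseteq> saturation M (adjoin J x)"
  proof (rule quot_least[OF s])
    show "saturation M J \<subseteq> saturation M (adjoin J x)"
      by (rule saturation_least[OF s]) (use adjoin_superset[of J x] sup in blast)
    show "x \<in> saturation M (adjoin J x)" using adjoin_self[OF J] sup by blast
  qed
  have q: "sat (quot (saturation M J) x)" using J by (intro sat_quot sat_saturation)
  show "saturation M (adjoin J x) \<subseteq> quot (saturation M J) x"
  proof (rule saturation_least[OF q], rule adjoin_least[OF sat_ideal[OF q]])
    show "J \<subseteq> quot (saturation M J) x" using saturation_superset quot_superset by blast
    show "x \<in> quot (saturation M J) x" using quot_self[OF sat_saturation[OF J]] .
  qed
qed

lemma regular_seq_localize:
  "is_ideal J \<Longrightarrow> regular_seq J ts \<Longrightarrow> regular (saturation M J) ts"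
  by (induction ts arbitrary: J)
    (auto simp: nonzerodivisor_saturation quot_saturation ideal_adjoin)

text \<open>An ideal that is maximal among those above \<open>J\<close> without a product \<open>s y\<^sup>n\<close>, \<open>s \<notin> Q\<close>, is prime; and
  \<open>J\<close> contains no such product because \<open>y\<close> is a nonzerodivisor modulo \<open>J\<close>.\<close>

lemma prime_below:
  assumes J: "sat J" "J \<subseteq> Q" and Q: "is_prime Q" "Q \<subseteq> M" and y: "nonzerodivisor_mod y J"
  obtains P where "is_prime P" "J \<subseteq> P" "P \<subseteq> Q" "y \<notin> P"
proof -
  let ?T = "{s * y ^ n | s n. s \<notin> Q}"
  have iJ: "is_ideal J" by (rule sat_ideal[OF J(1)])
  have disj: "J \<inter> ?T = {}"
  proof -
    have "s * y ^ n \<notin> J" if "s \<notin> Q" for s n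
    proof (induction n)
      case 0
      then show ?case using that J by auto
    next
      case (Suc n)
      have "s * y ^ Suc n = y * (s * y ^ n)" by (simp add: algebra_simps)
      then show ?case using Suc y by (metis nonzerodivisor_mod_def)
    qed
    then show ?thesis by blast
  qed
  let ?F = "{K. is_ideal K \<and> J \<subseteq> K \<and> K \<inter> ?T = {}}"
  have "J \<in> ?F" using disj iJ by blast
  then obtain P where P: "P \<in> ?F" and max: "\<And>K. K \<in> ?F \<Longrightarrow> P \<subseteq> K \<Longrightarrow> K = P"
    by (rule noetherianD[OF noeth, of J ?F]) auto
  have T1: "1 \<in> ?T"
    using prime_one[OF Q(1)] by (metis (mono_tags, lifting) mem_Collect_eq mult_1 power_0)
  have Tmult: "a * b \<in> ?T" if ab: "a \<in> ?T" "b \<in> ?T" for a b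
  proof -
    obtain s n s' n' where "s \<notin> Q" "s' \<notin> Q" "a = s * y ^ n" "b = s' * y ^ n'" using ab by blast
    then have "a * b = (s * s') * y ^ (n + n')" "s * s' \<notin> Q"
      using prime_mult_notin[OF Q(1)] by (auto simp: power_add algebra_simps)
    then show ?thesis by blast
  qed
  have iP: "is_ideal P" using P by blast
  have "is_prime P"
    unfolding is_prime_def
  proof (intro conjI allI impI)
    show "is_ideal P" by (rule iP)
    show "1 \<notin> P" using P T1 by blast
    fix a b assume ab: "a * b \<in> P"
    show "a \<in> P \<or> b \<in> P"
    proof (rule ccontr)
      assume n: "\<not> (a \<in> P \<or> b \<in> P)"
      have "\<exists>t\<in>?T. t \<in> adjoin P c" if "c \<notin> P" for c
      proof (rule ccontr)
        assume "\<not> (\<exists>t\<in>?T. t \<in> adjoin P c)"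
        then have "adjoin P c \<in> ?F"
          using P ideal_adjoin[OF iP] adjoin_superset[of P c] by blast
        then have "adjoin P c = P" using max adjoin_superset[of P c] by blast
        then show False using adjoin_self[OF iP] that by blast
      qed
      then have "\<exists>t\<in>?T. t \<in> adjoin P a" "\<exists>t\<in>?T. t \<in> adjoin P b" using n by simp_all
      then obtain t t' where t: "t \<in> ?T" "t \<in> adjoin P a" "t' \<in> ?T" "t' \<in> adjoin P b" by (elim bexE)
      then obtain p c p' c' where p: "p \<in> P" "t = p + c * a" "p' \<in> P" "t' = p' + c' * b"
        unfolding adjoin_def by blast
      have "t * t' = t' * p + c * a * p' + (c * c') * (a * b)" using p by (simp add: algebra_simps)
      also have "\<dots> \<in> P"
        by (simp add: ideal_add[OF iP] ideal_mult[OF iP] ab p(1,3))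
      finally show False using Tmult[OF t(1,3)] P by blast
    qed
  qed
  moreover have "P \<subseteq> Q"
  proof
    fix a assume "a \<in> P"
    show "a \<in> Q"
    proof (rule ccontr)
      assume "a \<notin> Q"
      then have "a * y ^ 0 \<in> ?T" by blast
      then show False using \<open>a \<in> P\<close> P by auto
    qed
  qed
  moreover have "y \<notin> P"
  proof
    assume "y \<in> P"
    moreover have "1 * y ^ 1 \<in> ?T" using prime_one[OF Q(1)] by blast
    ultimately show False using P by auto
  qed
  ultimately show ?thesis using that P by blast
qed

text \<open>Every element of a regular sequence allows a further step down in a chain of primes that
  starts at \<open>M\<close>; so depth is at most dimension.\<close>

theorem regular_chain:
  assumes "sat J" "J \<subseteq> M" "set ys \<subseteq> M" "regular J ys"
  shows "\<exists>Ps. prime_chain Ps (length ys) \<and> J \<subseteq> Ps 0 \<and> (\<forall>i\<le>length ys. Ps i \<subseteq> M)"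
  using assms
proof (induction ys arbitrary: J)
  case Nil
  then show ?case using prime_M by (auto simp: prime_chain_def intro!: exI[of _ "\<lambda>_. M"])
next
  case (Cons y ys)
  have "y \<in> M" using Cons.prems by simp
  have satM: "sat M"
    unfolding saturated_def using M_ideal prime_mult[OF prime_M] by blast
  have "quot J y \<subseteq> M" using quot_least[OF satM] Cons.prems by simp
  then obtain Ps where Ps: "prime_chain Ps (length ys)" "quot J y \<subseteq> Ps 0" "\<And>i. i \<le> length ys \<Longrightarrow> Ps i \<subseteq> M"
    using Cons.IH[of "quot J y"] Cons.prems sat_quot by auto
  have y0: "y \<in> Ps 0" "J \<subseteq> Ps 0" using Ps quot_self quot_superset Cons.prems by blast+
  have "is_prime (Ps 0)" "Ps 0 \<subseteq> M" using Ps by (auto simp: prime_chain_def)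
  then obtain P where P: "is_prime P" "J \<subseteq> P" "P \<subseteq> Ps 0" "y \<notin> P"
    using prime_below[of J "Ps 0" y] Cons.prems y0 by auto
  then have "P \<subset> Ps 0" using y0 by blast
  then have "prime_chain (case_nat P Ps) (Suc (length ys))"
    using Ps P unfolding prime_chain_def
    by (auto split: nat.split simp: less_Suc_eq_0_disj)
  moreover have "\<forall>i\<le>Suc (length ys). case_nat P Ps i \<subseteq> M"
    using P \<open>Ps 0 \<subseteq> M\<close> Ps(3) by (auto split: nat.split)
  ultimately show ?case using P(2)
    by (intro exI[of _ "case_nat P Ps"]) simp
qed

end

section \<open>Monomials and gradings of the polynomial ring\<close>

abbreviation const :: "'k::field \<Rightarrow> ('v, 'k) mpoly"
  where "const c \<equiv> Poly_Mapping.single 0 c"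

abbreviation monom :: "('v \<Rightarrow>\<^sub>0 nat) \<Rightarrow> ('v, 'k::field) mpoly"
  where "monom a \<equiv> Poly_Mapping.single a 1"

abbreviation exponent :: "('v \<Rightarrow>\<^sub>0 nat) \<Rightarrow> 'v \<Rightarrow> nat"
  where "exponent \<equiv> Poly_Mapping.lookup"

abbreviation coefficient :: "('v, 'k::field) mpoly \<Rightarrow> ('v \<Rightarrow>\<^sub>0 nat) \<Rightarrow> 'k"
  where "coefficient \<equiv> Poly_Mapping.lookup"

abbreviation support :: "('v, 'k::field) mpoly \<Rightarrow> ('v \<Rightarrow>\<^sub>0 nat) set"
  where "support \<equiv> Poly_Mapping.keys"

lemma poly_eq_sum_terms:
  "f = (\<Sum>a\<in>support f. Poly_Mapping.single a (coefficient f a))" for f :: "('v, 'k::field) mpoly"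
  by (rule poly_mapping_eqI)
    (simp add: lookup_sum lookup_single when_def in_keys_iff sum.delta' cong: if_cong)

lemma term_eq_const_mult: "Poly_Mapping.single a c = const c * monom a"
  by (simp add: mult_single)

lemma poly_induct [case_names zero add monomial]:
  fixes f :: "('v, 'k::field) mpoly"
  assumes "Q 0" "\<And>f g. Q f \<Longrightarrow> Q g \<Longrightarrow> Q (f + g)" "\<And>a c. a \<in> support f \<Longrightarrow> Q (Poly_Mapping.single a c)"
  shows "Q f"
proof -
  have "Q (\<Sum>a\<in>A. Poly_Mapping.single a (coefficient f a))" if "A \<subseteq> support f" for A
    using finite_subset[OF that finite_keys] that
    by (induction A rule: finite_induct) (auto intro: assms)
  then show ?thesis using poly_eq_sum_terms[of f] by (metis subset_refl)
qed

lemma var_power: "var v ^ n = (monom (Poly_Mapping.single v n) :: ('v, 'k::field) mpoly)"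
proof (induction n)
  case (Suc n)
  have "Poly_Mapping.single v (Suc n) = Poly_Mapping.single v 1 + Poly_Mapping.single v n"
    by (simp flip: single_add)
  then show ?case using Suc by (simp add: var_def mult_single)
qed simp

lemma var_eq_monom: "var v = monom (Poly_Mapping.single v 1)"
  by (simp add: var_def)

definition exponent_of :: "('v::finite \<Rightarrow> nat) \<Rightarrow> ('v \<Rightarrow>\<^sub>0 nat)"
  where "exponent_of h = (\<Sum>v\<in>UNIV. Poly_Mapping.single v (h v))"

lemma exponent_exponent_of [simp]: "exponent (exponent_of h) v = h v"
  unfolding exponent_of_def by (simp add: lookup_sum lookup_single when_def sum.delta' cong: if_cong)

lemma exponent_minus:
  assumes "\<And>v. exponent a v \<le> exponent b v"
  obtains d where "b = a + (d :: 'v::finite \<Rightarrow>\<^sub>0 nat)"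
proof -
  have "b = a + exponent_of (\<lambda>v. exponent b v - exponent a v)"
    by (rule poly_mapping_eqI) (simp add: lookup_add assms)
  then show ?thesis by (rule that)
qed

lemma coefficient_term_mult:
  "coefficient (Poly_Mapping.single a c * g) (a + b) = c * coefficient g b"
  for g :: "('v, 'k::field) mpoly"
proof (induction g rule: poly_induct)
  case (add f g)
  then show ?case by (simp add: distrib_left lookup_add)
next
  case (monomial a' c')
  then show ?case by (simp add: mult_single lookup_single when_def)
qed simp

lemma coefficient_term_mult_eq_0:
  fixes g :: "('v, 'k::field) mpoly"
  assumes "\<And>b'. b \<noteq> a + b'"
  shows "coefficient (Poly_Mapping.single a c * g) b = 0"
proof (induction g rule: poly_induct)
  case (add f g)
  then show ?case by (simp add: distrib_left lookup_add)
next
  case (monomial a' c')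
  then show ?case using assms[of a'] by (simp add: mult_single lookup_single when_def)
qed simp

lemma coefficient_const_mult [simp]: "coefficient (const c * g) b = c * coefficient g b"
  using coefficient_term_mult[of 0 c g b] by simp

definition wdeg :: "('v::finite \<Rightarrow> nat) \<Rightarrow> ('v \<Rightarrow>\<^sub>0 nat) \<Rightarrow> nat"
  where "wdeg w a = (\<Sum>v\<in>UNIV. w v * exponent a v)"

definition component :: "('v::finite \<Rightarrow> nat) \<Rightarrow> nat \<Rightarrow> ('v, 'k::field) mpoly \<Rightarrow> ('v, 'k) mpoly"
  where "component w n f =
    (\<Sum>a\<in>support f \<inter> {a. wdeg w a = n}. Poly_Mapping.single a (coefficient f a))"

definition deg_less :: "('v::finite \<Rightarrow> nat) \<Rightarrow> nat \<Rightarrow> ('v, 'k::field) mpoly \<Rightarrow> bool"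
  where "deg_less w n f \<longleftrightarrow> (\<forall>a\<in>support f. wdeg w a < n)"

definition homogeneous :: "('v::finite \<Rightarrow> nat) \<Rightarrow> nat \<Rightarrow> ('v, 'k::field) mpoly \<Rightarrow> bool"
  where "homogeneous w n f \<longleftrightarrow> (\<forall>a\<in>support f. wdeg w a = n)"

definition homogeneous_ideal :: "('v::finite \<Rightarrow> nat) \<Rightarrow> ('v, 'k::field) mpoly set \<Rightarrow> bool"
  where "homogeneous_ideal w J \<longleftrightarrow> is_ideal J \<and> (\<forall>f\<in>J. \<forall>n. component w n f \<in> J)"

lemma wdeg_add [simp]: "wdeg w (a + b) = wdeg w a + wdeg w b"
  by (simp add: wdeg_def lookup_add distrib_left sum.distrib)

lemma wdeg_zero [simp]: "wdeg w 0 = 0"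
  by (simp add: wdeg_def)

lemma wdeg_single [simp]: "wdeg w (Poly_Mapping.single v n) = w v * n"
  by (simp add: wdeg_def lookup_single when_def if_distrib sum.delta cong: if_cong)

lemma wdeg_pos: "(\<And>v. 0 < w v) \<Longrightarrow> a \<noteq> 0 \<Longrightarrow> 0 < wdeg w a"
proof -
  assume w: "\<And>v. 0 < w v" and "a \<noteq> 0"
  then obtain v where "exponent a v \<noteq> 0" by (metis lookup_zero poly_mapping_eqI)
  then have "0 < w v * exponent a v" using w by simp
  also have "\<dots> \<le> wdeg w a" unfolding wdeg_def by (rule member_le_sum) auto
  finally show ?thesis .
qed

lemma coefficient_component:
  "coefficient (component w n f) a = (if wdeg w a = n then coefficient f a else 0)"
  unfolding component_def
  by (auto simp: lookup_sum lookup_single when_def in_keys_iff sum.delta' cong: if_cong)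

lemma component_add: "component w n (f + g) = component w n f + component w n g"
  by (rule poly_mapping_eqI) (simp add: coefficient_component lookup_add)

lemma component_diff: "component w n (f - g) = component w n f - component w n g"
  by (rule poly_mapping_eqI) (simp add: coefficient_component lookup_minus)

lemma component_zero [simp]: "component w n 0 = 0"
  by (rule poly_mapping_eqI) (simp add: coefficient_component)

lemma component_sum: "component w n (sum f A) = (\<Sum>i\<in>A. component w n (f i))"
  by (induction A rule: infinite_finite_induct) (auto simp: component_add)

lemma component_homogeneous:
  "homogeneous w n f \<Longrightarrow> component w m f = (if m = n then f else 0)"
  by (rule poly_mapping_eqI)
    (auto simp: coefficient_component homogeneous_def in_keys_iff)

lemma homogeneous_component: "homogeneous w n (component w n f)"
  by (auto simp: homogeneous_def in_keys_iff coefficient_component split: if_splits)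

lemma homogeneous_term: "homogeneous w (wdeg w a) (Poly_Mapping.single a c)"
  by (simp add: homogeneous_def)

lemma homogeneous_zero: "homogeneous w n 0"
  by (simp add: homogeneous_def)

lemma homogeneous_add: "homogeneous w n f \<Longrightarrow> homogeneous w n g \<Longrightarrow> homogeneous w n (f + g)"
  using keys_add[of f g] by (auto simp: homogeneous_def)

lemma homogeneous_sum: "(\<And>i. i \<in> A \<Longrightarrow> homogeneous w n (f i)) \<Longrightarrow> homogeneous w n (sum f A)"
  by (induction A rule: infinite_finite_induct) (auto simp: homogeneous_zero homogeneous_add)

lemma homogeneous_mult:
  "homogeneous w m f \<Longrightarrow> homogeneous w n g \<Longrightarrow> homogeneous w (m + n) (f * g)"
  using keys_mult[of f g] by (fastforce simp: homogeneous_def)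

lemma homogeneous_one: "homogeneous w 0 (1 :: ('v::finite, 'k::field) mpoly)"
  by (simp add: homogeneous_def)

lemma homogeneous_power: "homogeneous w m f \<Longrightarrow> homogeneous w (n * m) (f ^ n)"
  by (induction n) (auto simp: homogeneous_one intro: homogeneous_mult)

lemma homogeneous_prod:
  "(\<And>i. i \<in> A \<Longrightarrow> homogeneous w (m i) (f i)) \<Longrightarrow> homogeneous w (sum m A) (prod f A)"
  by (induction A rule: infinite_finite_induct) (auto simp: homogeneous_one intro: homogeneous_mult)

lemma deg_less_add: "deg_less w n f \<Longrightarrow> deg_less w n g \<Longrightarrow> deg_less w n (f + g)"
  using keys_add[of f g] by (auto simp: deg_less_def)

lemma deg_less_uminus: "deg_less w n f \<Longrightarrow> deg_less w n (- f)"
  by (simp add: deg_less_def in_keys_iff)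

lemma deg_less_diff: "deg_less w n f \<Longrightarrow> deg_less w n g \<Longrightarrow> deg_less w n (f - g)"
  using deg_less_add[of w n f "- g"] deg_less_uminus by fastforce

lemma deg_less_zero [simp]: "deg_less w n 0"
  by (simp add: deg_less_def)

lemma deg_less_0_iff [simp]: "deg_less w 0 f \<longleftrightarrow> f = 0"
  by (auto simp: deg_less_def)

lemma deg_less_mono: "deg_less w m f \<Longrightarrow> m \<le> n \<Longrightarrow> deg_less w n f"
  by (auto simp: deg_less_def)

lemma deg_less_exists: obtains n where "deg_less w n f"
proof
  show "deg_less w (Suc (\<Sum>a\<in>support f. wdeg w a)) f"
    unfolding deg_less_def using member_le_sum[of _ "support f" "wdeg w"]
    by (auto simp: less_Suc_eq_le)
qed

lemma homogeneous_imp_deg_less: "homogeneous w n f \<Longrightarrow> n < m \<Longrightarrow> deg_less w m f"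
  by (auto simp: homogeneous_def deg_less_def)

lemma deg_less_mult:
  assumes "deg_less w (Suc m) f" "deg_less w n g"
  shows "deg_less w (m + n) (f * g)"
  unfolding deg_less_def
proof
  fix a assume "a \<in> support (f * g)"
  then obtain b c where "a = b + c" "b \<in> support f" "c \<in> support g" using keys_mult[of f g] by auto
  then show "wdeg w a < m + n" using assms by (fastforce simp: deg_less_def)
qed

lemma deg_less_pred:
  "deg_less w (Suc n) f \<Longrightarrow> component w n f = 0 \<Longrightarrow> deg_less w n f"
  unfolding deg_less_def
proof
  fix a assume f: "\<forall>a\<in>support f. wdeg w a < Suc n" "component w n f = 0" "a \<in> support f"
  then have "wdeg w a \<noteq> n" using coefficient_component[of w n f a] by (auto simp: in_keys_iff)
  then show "wdeg w a < n" using f by (auto simp: less_Suc_eq)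
qed

lemma component_eq_0: "deg_less w n f \<Longrightarrow> n \<le> m \<Longrightarrow> component w m f = 0"
  by (rule poly_mapping_eqI) (metis coefficient_component deg_less_def in_keys_iff leD lookup_zero)

lemma poly_eq_sum_components:
  assumes "deg_less w n f"
  shows "f = (\<Sum>i<n. component w i f)"
proof (rule poly_mapping_eqI)
  fix a
  show "coefficient f a = coefficient (\<Sum>i<n. component w i f) a"
    using assms by (auto simp: lookup_sum coefficient_component deg_less_def in_keys_iff)
qed

lemma component_term_mult:
  "component w n (Poly_Mapping.single a c * g) =
    (if wdeg w a \<le> n then Poly_Mapping.single a c * component w (n - wdeg w a) g else 0)"
proof (rule poly_mapping_eqI)
  fix b
  show "coefficient (component w n (Poly_Mapping.single a c * g)) b = coefficient
    (if wdeg w a \<le> n then Poly_Mapping.single a c * component w (n - wdeg w a) g else 0) b"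
  proof (cases "\<exists>b'. b = a + b'")
    case True
    then show ?thesis by (auto simp: coefficient_component coefficient_term_mult)
  next
    case False
    then show ?thesis by (auto simp: coefficient_component coefficient_term_mult_eq_0)
  qed
qed

lemma component_homogeneous_mult:
  assumes "homogeneous w m f"
  shows "component w n (f * g) = (if m \<le> n then f * component w (n - m) g else 0)"
proof -
  have "component w n (f * g) =
      (\<Sum>a\<in>support f. component w n (Poly_Mapping.single a (coefficient f a) * g))"
    by (subst poly_eq_sum_terms[of f]) (simp add: sum_distrib_right component_sum)
  also have "\<dots> = (\<Sum>a\<in>support f. if m \<le> n
      then Poly_Mapping.single a (coefficient f a) * component w (n - m) g else 0)"
    using assms by (intro sum.cong refl) (simp add: component_term_mult homogeneous_def)
  also have "\<dots> = (if m \<le> n then f * component w (n - m) g else 0)"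
    by (subst (3) poly_eq_sum_terms[of f]) (simp add: sum_distrib_right)
  finally show ?thesis .
qed

lemma component_mult_top:
  assumes "deg_less w (Suc m) f" "deg_less w (Suc n) g"
  shows "component w (m + n) (f * g) = component w m f * component w n g"
proof -
  have f: "f = component w m f + (\<Sum>i<m. component w i f)"
    using poly_eq_sum_components[OF assms(1)] by (simp add: add.commute)
  have lt: "deg_less w m (\<Sum>i<m. component w i f)"
  proof -
    have "(\<Sum>i<m. component w i f) = f - component w m f" using f by (simp add: algebra_simps)
    moreover have "deg_less w m (f - component w m f)"
    proof (rule deg_less_pred)
      show "deg_less w (Suc m) (f - component w m f)"
        by (intro deg_less_diff assms homogeneous_imp_deg_less[OF homogeneous_component]) simp
      show "component w m (f - component w m f) = 0"
        by (simp add: component_diff component_homogeneous[OF homogeneous_component])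
    qed
    ultimately show ?thesis by simp
  qed
  have "component w (m + n) (f * g) = component w (m + n) (component w m f * g)
      + component w (m + n) ((\<Sum>i<m. component w i f) * g)"
    by (subst f) (simp add: distrib_right component_add)
  also have "component w (m + n) ((\<Sum>i<m. component w i f) * g) = 0"
  proof (rule component_eq_0)
    show "deg_less w (n + m) ((\<Sum>i<m. component w i f) * g)"
      using deg_less_mult[OF assms(2) lt] by (simp add: mult.commute)
  qed simp
  also have "component w (m + n) (component w m f * g) = component w m f * component w n g"
    by (simp add: component_homogeneous_mult[OF homogeneous_component])
  finally show ?thesis by simp
qed

lemma homogeneous_ideal_is_ideal: "homogeneous_ideal w J \<Longrightarrow> is_ideal J"
  by (simp add: homogeneous_ideal_def)

lemma homogeneous_ideal_component: "homogeneous_ideal w J \<Longrightarrow> f \<in> J \<Longrightarrow> component w n f \<in> J"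
  by (simp add: homogeneous_ideal_def)

lemma homogeneous_ideal_adjoin:
  assumes J: "homogeneous_ideal w J" and F: "homogeneous w m F"
  shows "homogeneous_ideal w (adjoin J F)"
  unfolding homogeneous_ideal_def
proof (intro conjI ballI allI)
  have iJ: "is_ideal J" using J by (rule homogeneous_ideal_is_ideal)
  show "is_ideal (adjoin J F)" using iJ by (rule ideal_adjoin)
  fix f n assume "f \<in> adjoin J F"
  then obtain j a where f: "j \<in> J" "f = j + a * F" by (auto simp: adjoin_def)
  have "component w n f = component w n j + (if m \<le> n then component w (n - m) a else 0) * F"
    using component_homogeneous_mult[OF F, of n a] by (simp add: f component_add mult.commute)
  then show "component w n f \<in> adjoin J F"
    using homogeneous_ideal_component[OF J f(1)] unfolding adjoin_def by blast
qed

section \<open>Local and global regularity of homogeneous sequences\<close>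

definition irrelevant_ideal :: "('v::finite, 'k::field) mpoly set"
  where "irrelevant_ideal = {f. coefficient f 0 = 0}"

lemma coefficient_mult_zero: "coefficient (f * g) 0 = coefficient f 0 * coefficient g 0"
  for f g :: "('v::finite, 'k::field) mpoly"
proof -
  have *: "component (\<lambda>_. 1) 0 h = const (coefficient h 0)" for h :: "('v, 'k) mpoly"
  proof (rule poly_mapping_eqI)
    fix a show "coefficient (component (\<lambda>_. 1) 0 h) a = coefficient (const (coefficient h 0)) a"
      using wdeg_pos[of "\<lambda>_. 1" a] by (cases "a = 0") (auto simp: coefficient_component lookup_single)
  qed
  obtain f' where f: "f = const (coefficient f 0) + f'" "coefficient f' 0 = 0"
  proof
    show "f = const (coefficient f 0) + (f - const (coefficient f 0))" by simp
  qed (simp add: lookup_minus)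
  have "coefficient (f' * g) 0 = 0"
  proof -
    have "(f' * g) = (\<Sum>a\<in>support f'. Poly_Mapping.single a (coefficient f' a) * g)"
      by (subst poly_eq_sum_terms[of f']) (simp add: sum_distrib_right)
    moreover have "coefficient (Poly_Mapping.single a (coefficient f' a) * g) 0 = 0" if "a \<in> support f'" for a
    proof (rule coefficient_term_mult_eq_0)
      fix b' show "0 \<noteq> a + b'"
      proof
        assume "0 = a + b'"
        then have "wdeg (\<lambda>_. 1) (a + b') = 0" by (metis wdeg_zero)
        then have "a = 0" using wdeg_pos[of "\<lambda>_. 1" a] by fastforce
        then show False using that f by (simp add: in_keys_iff)
      qed
    qed
    ultimately show ?thesis by (simp add: lookup_sum)
  qed
  then show ?thesis by (subst f(1)) (simp add: distrib_right lookup_add)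
qed

lemma irrelevant_prime: "is_prime (irrelevant_ideal :: ('v::finite, 'k::field) mpoly set)"
  unfolding is_prime_def irrelevant_ideal_def
  by (auto intro!: is_idealI simp: lookup_add coefficient_mult_zero)

text \<open>An element outside the irrelevant ideal has a nonzero constant term, so the lowest
  component of a product \<open>s * b\<close> is, up to a constant, the lowest component of \<open>b\<close>.\<close>

lemma homogeneous_ideal_saturated:
  fixes J :: "('v::finite, 'k::field) mpoly set"
  assumes J: "homogeneous_ideal w J" and w: "\<And>v. 0 < w v"
  shows "saturated irrelevant_ideal J"
  unfolding saturated_def
proof (intro conjI allI impI)
  show iJ: "is_ideal J" using J by (rule homogeneous_ideal_is_ideal)
  fix s b :: "('v, 'k) mpoly" assume s: "s \<notin> irrelevant_ideal" and sb: "s * b \<in> J"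
  have s0: "coefficient s 0 \<noteq> 0" using s by (simp add: irrelevant_ideal_def)
  have "component w n b \<in> J" for n
  proof (induction n rule: less_induct)
    case (less n)
    let ?l = "\<Sum>i<n. component w i b"
    let ?g = "b - ?l"
    have l: "?l \<in> J" using less by (intro ideal_sum[OF iJ]) simp
    have "s * ?g \<in> J" using sb l iJ by (simp add: right_diff_distrib ideal_diff ideal_mult)
    then have c: "component w n (s * ?g) \<in> J" by (rule homogeneous_ideal_component[OF J])
    have low: "component w k ?g = 0" if "k < n" for k
    proof -
      have "component w k ?l = (\<Sum>i<n. if k = i then component w i b else 0)"
        by (simp add: component_sum component_homogeneous[OF homogeneous_component])
      then show ?thesis using that by (simp add: component_diff)
    qed
    have top: "component w n ?g = component w n b"
      by (simp add: component_diff component_sum component_homogeneous[OF homogeneous_component])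
    have "component w n (s * ?g) =
        (\<Sum>a\<in>support s. component w n (Poly_Mapping.single a (coefficient s a) * ?g))"
      by (subst poly_eq_sum_terms[of s]) (simp add: sum_distrib_right component_sum)
    also have "\<dots> = (\<Sum>a\<in>support s. if a = 0 then const (coefficient s 0) * component w n b else 0)"
    proof (rule sum.cong[OF refl])
      fix a assume "a \<in> support s"
      show "component w n (Poly_Mapping.single a (coefficient s a) * ?g) =
          (if a = 0 then const (coefficient s 0) * component w n b else 0)"
      proof (cases "a = 0")
        case True
        then show ?thesis by (simp add: component_term_mult top)
      next
        case False
        then have "0 < wdeg w a" using w by (intro wdeg_pos)
        then have "n - wdeg w a < n \<or> \<not> wdeg w a \<le> n" by linarith
        then show ?thesis using False low by (auto simp: component_term_mult)
      qed
    qed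
    also have "\<dots> = const (coefficient s 0) * component w n b"
      using s0 by (simp add: in_keys_iff sum.delta)
    finally have "const (inverse (coefficient s 0)) * (const (coefficient s 0) * component w n b) \<in> J"
      using c ideal_mult[OF iJ] by metis
    then show ?case using s0 by (simp add: mult_single flip: mult.assoc)
  qed
  moreover obtain N where "deg_less w N b" by (rule deg_less_exists)
  ultimately show "b \<in> J" using poly_eq_sum_components[of w N b] ideal_sum[OF iJ, of "{..<N}"] by metis
qed

text \<open>\<open>J0\<close> is the ideal generated by the leading forms of \<open>J\<close>. Sequences that are regular modulo
  \<open>J0\<close> lift to sequences that are regular modulo \<open>J\<close>.\<close>

definition top_forms :: "('v::finite \<Rightarrow> nat) \<Rightarrow> ('v, 'k::field) mpoly set \<Rightarrow> ('v, 'k) mpoly set \<Rightarrow> bool"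
  where "top_forms w J J0 \<longleftrightarrow> is_ideal J \<and> homogeneous_ideal w J0 \<and>
    (\<forall>g\<in>J. \<forall>n. deg_less w (Suc n) g \<longrightarrow> component w n g \<in> J0) \<and>
    (\<forall>h\<in>J0. \<forall>n. homogeneous w n h \<longrightarrow> (\<exists>g\<in>J. deg_less w (Suc n) g \<and> component w n g = h))"

lemma top_forms_homogeneous: "homogeneous_ideal w J \<Longrightarrow> top_forms w J J"
  unfolding top_forms_def
  by (auto simp: homogeneous_ideal_is_ideal homogeneous_ideal_component component_homogeneous
      intro!: bexI homogeneous_imp_deg_less)

lemma top_forms_reduce:
  assumes J: "top_forms w J J0" and a: "deg_less w (Suc n) a" "component w n a \<in> J0"
  obtains g where "g \<in> J" "deg_less w (Suc n) g" "deg_less w n (a - g)"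
proof -
  have "\<exists>g\<in>J. deg_less w (Suc n) g \<and> component w n g = component w n a"
    using J a(2) homogeneous_component[of w n a] unfolding top_forms_def by blast
  then obtain g where g: "g \<in> J" "deg_less w (Suc n) g" "component w n g = component w n a" by blast
  have "component w n (a - g) = 0" using g(3) by (simp add: component_diff)
  then have "deg_less w n (a - g)" by (rule deg_less_pred[OF deg_less_diff[OF a(1) g(2)]])
  then show ?thesis using that g by blast
qed

text \<open>If \<open>f b \<in> J\<close>, then the leading form of \<open>b\<close> is killed by that of \<open>f\<close>, so that it is the leading
  form of an element of \<open>J\<close>, which can be subtracted from \<open>b\<close>.\<close>

lemma nonzerodivisor_of_top_form:
  assumes J: "top_forms w J J0" and f: "deg_less w (Suc m) f"
    and F: "nonzerodivisor_mod (component w m f) J0"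
  shows "nonzerodivisor_mod f J"
proof -
  have iJ: "is_ideal J" using J by (simp add: top_forms_def)
  have "deg_less w n b \<Longrightarrow> f * b \<in> J \<Longrightarrow> b \<in> J" for n b
  proof (induction n arbitrary: b)
    case 0
    then show ?case using ideal_zero[OF iJ] by simp
  next
    case (Suc n)
    have "component w (m + n) (f * b) \<in> J0"
      using J Suc.prems deg_less_mult[OF f Suc.prems(1)] by (simp add: top_forms_def)
    then have "component w n b \<in> J0"
      using F by (simp add: component_mult_top[OF f Suc.prems(1)] nonzerodivisor_mod_def)
    then obtain g where g: "g \<in> J" "deg_less w (Suc n) g" "deg_less w n (b - g)"
      using top_forms_reduce[OF J Suc.prems(1)] by blast
    have "f * (b - g) \<in> J" using Suc.prems g iJ by (simp add: right_diff_distrib ideal_diff ideal_mult)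
    then have "b - g \<in> J" using Suc.IH g by blast
    then show ?case using g ideal_cong[OF iJ] by blast
  qed
  then show ?thesis unfolding nonzerodivisor_mod_def by (metis deg_less_exists)
qed

lemma top_forms_adjoin:
  assumes J: "top_forms w J J0" and f: "deg_less w (Suc m) f"
    and F: "nonzerodivisor_mod (component w m f) J0"
  shows "top_forms w (adjoin J f) (adjoin J0 (component w m f))"
proof -
  let ?F = "component w m f"
  have iJ: "is_ideal J" and hJ0: "homogeneous_ideal w J0" using J by (auto simp: top_forms_def)
  have iJ0: "is_ideal J0" using hJ0 by (rule homogeneous_ideal_is_ideal)
  have hF: "homogeneous w m ?F" by (rule homogeneous_component)
  have J_top: "component w n g \<in> J0" if "g \<in> J" "deg_less w (Suc n) g" for g n
    using J that by (auto simp: top_forms_def)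
  \<comment> \<open>Induction on the degree of the cofactor \<open>a\<close>: if the leading forms of \<open>j\<close> and \<open>a * f\<close>
    cancel, then the leading form of \<open>a\<close> lies in \<open>J0\<close> and \<open>a\<close> can be reduced modulo \<open>J\<close>.\<close>
  have top: "deg_less w N a \<Longrightarrow> j \<in> J \<Longrightarrow> deg_less w (Suc n) (j + a * f) \<Longrightarrow>
      component w n (j + a * f) \<in> adjoin J0 ?F" for N a j n
  proof (induction N arbitrary: a j)
    case 0
    then show ?case using J_top adjoin_superset[of J0] by auto
  next
    case (Suc N)
    have af: "deg_less w (Suc (m + N)) (a * f)"
      using deg_less_mult[OF f Suc.prems(1)] by (simp add: mult.commute)
    have caf: "component w (m + N) (a * f) = component w N a * ?F"
      using component_mult_top[OF f Suc.prems(1)] by (simp add: mult.commute)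
    have j: "j = (j + a * f) - a * f" by simp
    show ?case
    proof (cases "m + N \<le> n")
      case True
      have "deg_less w (Suc n) j"
        by (subst j, rule deg_less_diff[OF Suc.prems(3)], rule deg_less_mono[OF af]) (use True in simp)
      then have "component w n j \<in> J0" using J_top Suc.prems by blast
      moreover have "component w n (a * f) = (if n = m + N then component w N a else 0) * ?F"
        using caf component_eq_0[OF af, of n] True by auto
      then have "component w n (j + a * f) =
          component w n j + (if n = m + N then component w N a else 0) * ?F"
        by (simp only: component_add)
      ultimately show ?thesis unfolding adjoin_def by blast
    next
      case False
      have dj: "deg_less w (Suc (m + N)) j"
        by (subst j, rule deg_less_diff[OF deg_less_mono[OF Suc.prems(3)] af]) (use False in simp)
      have "component w (m + N) (j + a * f) = 0"
        using component_eq_0[OF Suc.prems(3)] False by simp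
      then have "component w N a * ?F = - component w (m + N) j"
        by (simp add: component_add caf add_eq_0_iff2)
      then have "?F * component w N a \<in> J0"
        using J_top[OF Suc.prems(2) dj] ideal_uminus[OF iJ0] by (simp add: mult.commute)
      then have "component w N a \<in> J0" using F by (simp add: nonzerodivisor_mod_def)
      then obtain g where g: "g \<in> J" "deg_less w (Suc N) g" "deg_less w N (a - g)"
        using top_forms_reduce[OF J Suc.prems(1)] by blast
      have "j + g * f \<in> J" using g Suc.prems iJ ideal_add ideal_mult_right by blast
      moreover have eq: "j + a * f = (j + g * f) + (a - g) * f" by (simp add: algebra_simps)
      ultimately show ?thesis using Suc.IH[OF g(3), of "j + g * f"] Suc.prems(3) by metis
    qed
  qed
  show ?thesis
    unfolding top_forms_def
  proof (intro conjI ballI allI impI)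
    show "is_ideal (adjoin J f)" using iJ by (rule ideal_adjoin)
    show "homogeneous_ideal w (adjoin J0 ?F)" using hJ0 hF by (rule homogeneous_ideal_adjoin)
  next
    fix g n assume "g \<in> adjoin J f" and dg: "deg_less w (Suc n) g"
    then obtain j a where g: "j \<in> J" "g = j + a * f" by (auto simp: adjoin_def)
    obtain N where "deg_less w N a" by (rule deg_less_exists)
    then show "component w n g \<in> adjoin J0 ?F" using top g dg by blast
  next
    fix h n assume "h \<in> adjoin J0 ?F" and h: "homogeneous w n h"
    then obtain j a where ja: "j \<in> J0" "h = j + a * ?F" by (auto simp: adjoin_def)
    define b where "b = (if m \<le> n then component w (n - m) a else 0)"
    have "h = component w n h" using h by (simp add: component_homogeneous)
    also have "\<dots> = component w n j + b * ?F"
      using component_homogeneous_mult[OF hF, of n a]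
      by (simp add: ja component_add b_def mult.commute)
    finally have hb: "h = component w n j + b * ?F" .
    have "component w n j \<in> J0" using ja hJ0 homogeneous_ideal_component by blast
    then have "\<exists>g\<in>J. deg_less w (Suc n) g \<and> component w n g = component w n j"
      using J homogeneous_component[of w n j] unfolding top_forms_def by blast
    then obtain g where g: "g \<in> J" "deg_less w (Suc n) g" "component w n g = component w n j" by blast
    have bf: "deg_less w (Suc n) (b * f) \<and> component w n (b * f) = b * ?F"
    proof (cases "m \<le> n")
      case True
      have db: "deg_less w (Suc (n - m)) b"
        using True by (simp add: b_def homogeneous_imp_deg_less[OF homogeneous_component])
      have "component w (n - m) b = b"
        using True by (simp add: b_def component_homogeneous[OF homogeneous_component])
      then show ?thesis
        using deg_less_mult[OF f db] component_mult_top[OF f db] True by (simp add: mult.commute)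
    qed (simp add: b_def)
    have "g + b * f \<in> adjoin J f" using g unfolding adjoin_def by blast
    moreover have "deg_less w (Suc n) (g + b * f)" using g bf deg_less_add by blast
    moreover have "component w n (g + b * f) = h" using g bf hb by (simp add: component_add)
    ultimately show "\<exists>g\<in>adjoin J f. deg_less w (Suc n) g \<and> component w n g = h" by blast
  qed
qed

lemma regular_seq_of_top_forms:
  assumes "top_forms w J J0" "regular_seq J0 Fs"
    "list_all2 (\<lambda>f F. \<exists>m. deg_less w (Suc m) f \<and> component w m f = F) fs Fs"
  shows "regular_seq J fs"
  using assms(3,1,2)
proof (induction arbitrary: J J0 rule: list_all2_induct)
  case (Cons f fs F Fs)
  then obtain m where m: "deg_less w (Suc m) f" "component w m f = F" by blast
  then show ?case
    using Cons nonzerodivisor_of_top_form[OF Cons.prems(1) m(1)]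
      top_forms_adjoin[OF Cons.prems(1) m(1)] by auto
qed simp

text \<open>Homogeneous ideals do not change under localization at the irrelevant ideal.\<close>

lemma regular_seq_of_local:
  fixes J :: "('v::finite, 'k::field) mpoly set"
  assumes loc: "local_noetherian (irrelevant_ideal :: ('v, 'k) mpoly set)"
    and w: "\<And>v. 0 < w v"
    and "homogeneous_ideal w J" "list_all (\<lambda>t. \<exists>m. homogeneous w m t) ts"
    and "local_noetherian.regular irrelevant_ideal J ts"
  shows "regular_seq J ts"
  using assms(3-)
proof (induction ts arbitrary: J)
  case (Cons t ts)
  interpret local_noetherian "irrelevant_ideal :: ('v, 'k) mpoly set" by (rule loc)
  obtain m where t: "homogeneous w m t" using Cons.prems by auto
  have h: "homogeneous_ideal w (adjoin J t)" using Cons.prems(1) t by (rule homogeneous_ideal_adjoin)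
  have s: "sat (adjoin J t)" using homogeneous_ideal_saturated[OF h w] .
  have "quot J t = adjoin J t"
    unfolding quot_def using saturation_least[OF s] saturation_superset by blast
  then show ?case using Cons h by simp
qed simp

section \<open>Chains of primes and algebraic independence\<close>

interpretation mpoly: vector_space "\<lambda>(c :: 'k::field) (f :: ('v, 'k) mpoly). const c * f"
  by unfold_locales (simp_all add: algebra_simps single_add mult_single flip: mult.assoc)

text \<open>Dimension counting in \<open>R / P\<close> without passing to the quotient space: representatives of the
  \<open>g x\<close> in the span of \<open>Y\<close> are dependent.\<close>

lemma span_mod_dependent:
  fixes g :: "'i \<Rightarrow> ('v, 'k::field) mpoly"
  assumes P: "is_ideal P" and fin: "finite A" "finite Y" and card: "card Y < card A"
    and g: "\<And>x. x \<in> A \<Longrightarrow> \<exists>y\<in>mpoly.span Y. g x - y \<in> P"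
  shows "\<exists>c. (\<exists>x\<in>A. c x \<noteq> 0) \<and> (\<Sum>x\<in>A. const (c x) * g x) \<in> P"
proof -
  obtain h where h: "\<And>x. x \<in> A \<Longrightarrow> h x \<in> mpoly.span Y \<and> g x - h x \<in> P" using g by metis
  have eq: "(\<Sum>x\<in>A. const (c x) * g x) \<in> P" if "(\<Sum>x\<in>A. const (c x) * h x) = 0" for c
  proof -
    have "(\<Sum>x\<in>A. const (c x) * g x) = (\<Sum>x\<in>A. const (c x) * (g x - h x)) + (\<Sum>x\<in>A. const (c x) * h x)"
      by (simp add: right_diff_distrib sum_subtractf)
    then show ?thesis using that h by (simp add: ideal_sum[OF P] ideal_mult[OF P])
  qed
  show ?thesis
  proof (cases "inj_on h A")
    case True
    then have "card Y < card (h ` A)" using card by (simp add: card_image)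
    moreover have "h ` A \<subseteq> mpoly.span Y" using h by blast
    ultimately have "mpoly.dependent (h ` A)"
      using mpoly.independent_span_bound[OF fin(2), of "h ` A"] by (metis not_less)
    then have "\<exists>u. (\<exists>v\<in>h ` A. u v \<noteq> 0) \<and> (\<Sum>v\<in>h ` A. const (u v) * v) = 0"
      using mpoly.dependent_finite[of "h ` A"] fin(1) by simp
    then obtain u where u: "\<exists>v\<in>h ` A. u v \<noteq> 0" "(\<Sum>v\<in>h ` A. const (u v) * v) = 0"
      by (elim exE conjE)
    then have "(\<Sum>x\<in>A. const (u (h x)) * h x) = 0" using True by (simp add: sum.reindex)
    then show ?thesis using eq[of "u \<circ> h"] u by (intro exI[of _ "u \<circ> h"]) auto
  next
    case False
    then obtain x y where xy: "x \<in> A" "y \<in> A" "x \<noteq> y" "h x = h y" by (auto simp: inj_on_def)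
    define c where "c z = (if z = x then 1 else if z = y then - 1 else (0::'k))" for z
    have "(\<Sum>z\<in>A. const (c z) * h z) = (\<Sum>z\<in>{x, y}. const (c z) * h z)"
      using fin xy by (intro sum.mono_neutral_right) (auto simp: c_def)
    also have "\<dots> = 0" using xy by (simp add: c_def single_uminus)
    finally show ?thesis using eq[of c] xy by (intro exI[of _ c]) (auto simp: c_def)
  qed
qed

fun power_product :: "(nat \<Rightarrow> 'a::comm_ring_1) \<Rightarrow> nat list \<Rightarrow> 'a"
  where "power_product f [] = 1"
  | "power_product f (a # as) = f 0 ^ a * power_product (f \<circ> Suc) as"

definition exponent_lists :: "nat \<Rightarrow> nat \<Rightarrow> nat list set"
  where "exponent_lists k N = {as. set as \<subseteq> {..<N} \<and> length as = k}"

lemma finite_exponent_lists: "finite (exponent_lists k N)"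
  and card_exponent_lists: "card (exponent_lists k N) = N ^ k"
  unfolding exponent_lists_def using finite_lists_length_eq[of "{..<N}" k] card_lists_length_eq[of "{..<N}" k]
  by simp_all

lemma exponent_lists_0: "exponent_lists 0 N = {[]}"
  by (auto simp: exponent_lists_def)

lemma exponent_lists_Suc:
  "exponent_lists (Suc k) N = (\<lambda>(a, as). a # as) ` ({..<N} \<times> exponent_lists k N)"
  by (auto simp: exponent_lists_def length_Suc_conv image_iff)

lemma prime_const: "is_prime P \<Longrightarrow> const c \<in> P \<Longrightarrow> c = 0"
proof (rule ccontr)
  assume P: "is_prime P" "const c \<in> P" "c \<noteq> 0"
  then have "const (inverse c) * const c \<in> P" by (intro ideal_mult prime_is_ideal)
  then have "1 \<in> P" using P(3) by (simp add: mult_single)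
  then show False using prime_one[OF P(1)] by blast
qed

text \<open>In a relation between elements that witness the strict inclusions of a chain, a power of the
  first witness can be cancelled modulo the bottom prime; the terms of lowest order then form a
  relation modulo the next prime. So the witnesses are algebraically independent.\<close>

lemma chain_independent:
  fixes f :: "nat \<Rightarrow> ('v, 'k::field) mpoly"
  assumes "prime_chain Ps k" "\<And>i. i < k \<Longrightarrow> f i \<in> Ps (Suc i) \<and> f i \<notin> Ps i"
    and "(\<Sum>as\<in>exponent_lists k N. const (c as) * power_product f as) \<in> Ps 0"
    and "as \<in> exponent_lists k N"
  shows "c as = 0"
  using assms
proof (induction k arbitrary: Ps f c as)
  case 0
  then have "const (c []) \<in> Ps 0" by (simp add: exponent_lists_0)
  then show ?case using 0 prime_const by (auto simp: exponent_lists_0 prime_chain_def)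
next
  case (Suc k)
  let ?A = "exponent_lists k N"
  define G where "G a = (\<Sum>as\<in>?A. const (c (a # as)) * power_product (f \<circ> Suc) as)" for a
  have P0: "is_prime (Ps 0)" "is_prime (Ps 1)" "Ps 0 \<subseteq> Ps 1"
    using Suc.prems(1) by (auto simp: prime_chain_def)
  have f0: "f 0 \<in> Ps 1" "f 0 \<notin> Ps 0" using Suc.prems(2)[of 0] by auto
  have "(\<Sum>as\<in>exponent_lists (Suc k) N. const (c as) * power_product f as) =
      (\<Sum>(a, as)\<in>{..<N} \<times> ?A. const (c (a # as)) * (f 0 ^ a * power_product (f \<circ> Suc) as))"
    unfolding exponent_lists_Suc by (subst sum.reindex) (auto simp: inj_on_def intro!: sum.cong)
  also have "\<dots> = (\<Sum>a<N. f 0 ^ a * G a)"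
    by (simp add: G_def sum_distrib_left mult.left_commute flip: sum.cartesian_product)
  finally have rel: "(\<Sum>a<N. f 0 ^ a * G a) \<in> Ps 0" using Suc.prems(3) by simp
  have chain': "prime_chain (Ps \<circ> Suc) k" using Suc.prems(1) by (auto simp: prime_chain_def)
  have IH: "\<forall>as\<in>?A. c (a # as) = 0" if "G a \<in> Ps 1" for a
  proof
    fix as assume "as \<in> ?A"
    show "c (a # as) = 0"
    proof (rule Suc.IH[where Ps = "Ps \<circ> Suc" and f = "f \<circ> Suc" and c = "\<lambda>as. c (a # as)"])
      show "prime_chain (Ps \<circ> Suc) k" by (rule chain')
      show "(f \<circ> Suc) i \<in> (Ps \<circ> Suc) (Suc i) \<and> (f \<circ> Suc) i \<notin> (Ps \<circ> Suc) i" if "i < k" for i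
        using Suc.prems(2)[of "Suc i"] that by simp
      have "(Ps \<circ> Suc) 0 = Ps 1" by simp
      then show "(\<Sum>as\<in>?A. const (c (a # as)) * power_product (f \<circ> Suc) as) \<in> (Ps \<circ> Suc) 0"
        using that unfolding G_def by metis
      show "as \<in> ?A" by fact
    qed
  qed
  have zero: "\<forall>as\<in>?A. c (a # as) = 0" if "a < N" for a
    using that
  proof (induction a rule: less_induct)
    case (less a)
    have G0: "G b = 0" if "b < a" for b
      using less.IH[OF that] less.prems that by (simp add: G_def)
    have "(\<Sum>b<N. f 0 ^ b * G b) = (\<Sum>b\<in>{a..<N}. f 0 ^ b * G b)"
      by (rule sum.mono_neutral_right) (auto simp: G0)
    also have "\<dots> = f 0 ^ a * (\<Sum>b\<in>{a..<N}. f 0 ^ (b - a) * G b)"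
      by (auto simp: sum_distrib_left mult.assoc[symmetric] power_add[symmetric] intro!: sum.cong)
    finally have "f 0 ^ a * (\<Sum>b\<in>{a..<N}. f 0 ^ (b - a) * G b) \<in> Ps 0" using rel by simp
    then have "(\<Sum>b\<in>{a..<N}. f 0 ^ (b - a) * G b) \<in> Ps 1"
      using prime_mult[OF P0(1)] prime_power[OF P0(1)] f0 P0(3) by blast
    moreover have "(\<Sum>b\<in>{a..<N}. f 0 ^ (b - a) * G b) =
        (\<Sum>b\<in>{a<..<N}. f 0 ^ (b - a) * G b) + G a"
    proof -
      have "{a..<N} = insert a {a<..<N}" using less.prems by auto
      then show ?thesis by (simp add: add.commute)
    qed
    moreover have "(\<Sum>b\<in>{a<..<N}. f 0 ^ (b - a) * G b) \<in> Ps 1"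
    proof (rule ideal_sum[OF prime_is_ideal[OF P0(2)]])
      fix b assume "b \<in> {a<..<N}"
      then have "f 0 ^ (b - a) * G b = (f 0 ^ (b - a - 1) * G b) * f 0"
        by (cases "b - a") (auto simp: mult_ac)
      then show "f 0 ^ (b - a) * G b \<in> Ps 1"
        using f0 ideal_mult[OF prime_is_ideal[OF P0(2)]] by simp
    qed
    ultimately have "G a \<in> Ps 1" using ideal_add_cancel[OF prime_is_ideal[OF P0(2)]] by auto
    then show ?case by (rule IH)
  qed
  then show ?case using Suc.prems(4) by (auto simp: exponent_lists_Suc)
qed

lemma deg_less_power_product:
  assumes "\<And>i. i < length as \<Longrightarrow> deg_less w (Suc t) (f i)"
  shows "deg_less w (Suc (t * sum_list as)) (power_product f as)"
  using assms
proof (induction as arbitrary: f)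
  case Nil
  then show ?case by (simp add: deg_less_def)
next
  case (Cons a as)
  have f0: "deg_less w (Suc t) (f 0)" using Cons.prems[of 0] by simp
  have p: "deg_less w (Suc (t * n)) (f 0 ^ n)" for n
  proof (induction n)
    case (Suc n)
    then show ?case using deg_less_mult[OF f0 Suc] by simp
  qed (simp add: deg_less_def)
  have "deg_less w (Suc (t * sum_list as)) (power_product (f \<circ> Suc) as)"
    by (rule Cons.IH) (use Cons.prems[of "Suc _"] in auto)
  from deg_less_mult[OF p[of a] this] show ?case by (simp add: distrib_left)
qed

section \<open>Elementary symmetric parameters\<close>

definition elem_sym :: "nat \<Rightarrow> ('v::finite \<Rightarrow> 'r::comm_ring_1) \<Rightarrow> 'r"
  where "elem_sym k y = (\<Sum>F | card F = k. \<Prod>v\<in>F. y v)"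

text \<open>The factor for \<open>v = u\<close> makes the product of all \<open>y u - y v\<close> vanish; expanding it gives Vieta's
  relation.\<close>

lemma elem_sym_root:
  fixes y :: "'v::finite \<Rightarrow> 'r::comm_ring_1"
  shows "y u ^ card (UNIV :: 'v set) = - (\<Sum>k=1..card (UNIV :: 'v set). (- 1) ^ k * elem_sym k y * y u ^ (card (UNIV :: 'v set) - k))"
proof -
  let ?n = "card (UNIV :: 'v set)"
  let ?h = "\<lambda>A. (- 1) ^ card A * (\<Prod>v\<in>A. y v) * y u ^ (?n - card A)"
  have "0 = (\<Prod>v\<in>UNIV. y u - y v)" by (rule sym, rule prod_zero) auto
  also have "\<dots> = (\<Sum>A\<in>UNIV. ?h A)"
    by (subst prod_diff_conv_sum) (simp_all add: card_Diff_subset)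
  also have "\<dots> = (\<Sum>k\<in>{..?n}. \<Sum>A\<in>{A. A \<in> UNIV \<and> card A = k}. ?h A)"
    by (rule sum.group[symmetric]) (auto intro: card_mono)
  also have "\<dots> = (\<Sum>k\<in>{..?n}. (- 1) ^ k * elem_sym k y * y u ^ (?n - k))"
    by (auto simp: elem_sym_def sum_distrib_left sum_distrib_right intro!: sum.cong)
  also have "{..?n} = insert 0 {1..?n}" by auto
  finally have "0 = elem_sym 0 y * y u ^ ?n + (\<Sum>k=1..?n. (- 1) ^ k * elem_sym k y * y u ^ (?n - k))"
    by simp
  moreover have "elem_sym 0 y = 1"
  proof -
    have "{F :: 'v set. card F = 0} = {{}}" by auto
    then show ?thesis by (simp add: elem_sym_def)
  qed
  ultimately show ?thesis by (simp add: eq_neg_iff_add_eq_0)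
qed

definition parameter :: "('v::finite \<Rightarrow> nat) \<Rightarrow> nat \<Rightarrow> ('v, 'k::field) mpoly"
  where "parameter c k = elem_sym k (\<lambda>v. var v ^ c v)"

text \<open>Modulo an ideal that contains the parameters with index outside \<open>Ks\<close>, these products span the
  polynomials of degree at most \<open>D\<close>.\<close>

definition reduced_products :: "('v::finite \<Rightarrow> nat) \<Rightarrow> nat set \<Rightarrow> nat \<Rightarrow> ('v, 'k::field) mpoly set"
  where "reduced_products c Ks D = (\<lambda>(\<alpha>, \<beta>). monom \<alpha> * (\<Prod>k\<in>Ks. parameter c k ^ \<beta> k)) `
    ({\<alpha>. \<forall>v. exponent \<alpha> v < c v * card (UNIV :: 'v set)} \<times> (Ks \<rightarrow>\<^sub>E {..D}))"

lemma finite_exponents_below: "finite {a :: 'v::finite \<Rightarrow>\<^sub>0 nat. \<forall>v. exponent a v < b v}"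
proof (rule finite_imageD)
  show "finite (exponent ` {a :: 'v \<Rightarrow>\<^sub>0 nat. \<forall>v. exponent a v < b v})"
    by (rule finite_subset[of _ "Pi\<^sub>E UNIV (\<lambda>v. {..<b v})"]) (auto intro: finite_PiE)
qed (auto simp: inj_on_def intro: poly_mapping_eqI)

lemma finite_reduced_products:
  fixes c :: "'v::finite \<Rightarrow> nat"
  assumes "finite Ks"
  shows "finite (reduced_products c Ks D :: ('v, 'k::field) mpoly set)"
  unfolding reduced_products_def using assms finite_exponents_below
  by (intro finite_imageI finite_cartesian_product finite_PiE) auto

lemma card_reduced_products:
  fixes c :: "'v::finite \<Rightarrow> nat"
  assumes "finite Ks"
  shows "card (reduced_products c Ks D :: ('v, 'k::field) mpoly set) \<le>
    card {\<alpha>. \<forall>v. exponent \<alpha> v < c v * card (UNIV :: 'v set)} * (D + 1) ^ card Ks"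
proof -
  have "card (reduced_products c Ks D :: ('v, 'k) mpoly set) \<le>
      card ({\<alpha>. \<forall>v. exponent \<alpha> v < c v * card (UNIV :: 'v set)} \<times> (Ks \<rightarrow>\<^sub>E {..D}))"
    unfolding reduced_products_def using assms finite_exponents_below
    by (intro card_image_le finite_cartesian_product finite_PiE) auto
  then show ?thesis using assms by (simp add: card_cartesian_product card_PiE)
qed

definition reducible :: "('v::finite \<Rightarrow> nat) \<Rightarrow> nat set \<Rightarrow> ('v, 'k::field) mpoly set \<Rightarrow> nat \<Rightarrow> ('v, 'k) mpoly set"
  where "reducible c Ks P D = {f. \<exists>y\<in>mpoly.span (reduced_products c Ks D). f - y \<in> P}"

lemma reducible_add:
  assumes "is_ideal P" "f \<in> reducible c Ks P D" "g \<in> reducible c Ks P D"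
  shows "f + g \<in> reducible c Ks P D"
proof -
  obtain y z where "y \<in> mpoly.span (reduced_products c Ks D)" "f - y \<in> P"
    "z \<in> mpoly.span (reduced_products c Ks D)" "g - z \<in> P"
    using assms by (auto simp: reducible_def)
  moreover from this have "(f - y) + (g - z) \<in> P" using assms by (intro ideal_add)
  moreover have "(f - y) + (g - z) = (f + g) - (y + z)" by simp
  ultimately show ?thesis unfolding reducible_def using mpoly.span_add by (auto intro!: bexI)
qed

lemma reducible_ideal: "f \<in> P \<Longrightarrow> f \<in> reducible c Ks P D"
  unfolding reducible_def using mpoly.span_zero by force

lemma reducible_const_mult:
  assumes "is_ideal P" "f \<in> reducible c Ks P D"
  shows "const b * f \<in> reducible c Ks P D"
proof -
  obtain y where y: "y \<in> mpoly.span (reduced_products c Ks D)" "f - y \<in> P"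
    using assms by (auto simp: reducible_def)
  then have "const b * (f - y) \<in> P" using assms by (intro ideal_mult)
  then have "const b * f - const b * y \<in> P" by (simp add: right_diff_distrib)
  moreover have "const b * y \<in> mpoly.span (reduced_products c Ks D)" using y by (intro mpoly.span_scale)
  ultimately show ?thesis unfolding reducible_def by blast
qed

lemma reducible_sum:
  "is_ideal P \<Longrightarrow> (\<And>i. i \<in> A \<Longrightarrow> f i \<in> reducible c Ks P D) \<Longrightarrow> sum f A \<in> reducible c Ks P D"
  by (induction A rule: infinite_finite_induct)
    (auto intro: reducible_add reducible_ideal ideal_zero)

lemma reducible_parameter_mult:
  fixes P :: "('v::finite, 'k::field) mpoly set"
  assumes P: "is_ideal P" and Ks: "finite Ks" "k \<in> Ks" and f: "f \<in> reducible c Ks P D"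
  shows "parameter c k * f \<in> reducible c Ks P (Suc D)"
proof -
  obtain y where y: "y \<in> mpoly.span (reduced_products c Ks D)" "f - y \<in> P"
    using f by (auto simp: reducible_def)
  have "parameter c k * y \<in> mpoly.span (reduced_products c Ks (Suc D))"
    using y(1)
  proof (induction rule: mpoly.span_induct_alt)
    case base
    then show ?case by (simp add: mpoly.span_zero)
  next
    case (step b x y)
    then obtain \<alpha> \<beta> where x: "x = monom \<alpha> * (\<Prod>k\<in>Ks. parameter c k ^ \<beta> k)"
      "\<forall>v. exponent \<alpha> v < c v * card (UNIV :: 'v set)" "\<beta> \<in> Ks \<rightarrow>\<^sub>E {..D}"
      by (auto simp: reduced_products_def)
    let ?\<beta> = "\<beta>(k := Suc (\<beta> k))"
    have "(\<Prod>l\<in>Ks. parameter c l ^ ?\<beta> l) =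
        (parameter c k * (\<Prod>l\<in>Ks. parameter c l ^ \<beta> l) :: ('v, 'k) mpoly)"
      using Ks by (simp add: prod.remove[of _ k] mult.assoc)
    then have "parameter c k * x = monom \<alpha> * (\<Prod>k\<in>Ks. parameter c k ^ ?\<beta> k)"
      by (simp only: x(1) mult.left_commute)
    moreover have "?\<beta> \<in> Ks \<rightarrow>\<^sub>E {..Suc D}"
      using x(3) Ks by (force simp: PiE_iff extensional_def)
    ultimately have "parameter c k * x \<in> reduced_products c Ks (Suc D)"
      unfolding reduced_products_def using x(2) by (intro image_eqI[of _ _ "(\<alpha>, ?\<beta>)"]) auto
    then have "const b * (parameter c k * x) + parameter c k * y \<in> mpoly.span (reduced_products c Ks (Suc D))"
      using step(2) by (intro mpoly.span_add[OF mpoly.span_scale[OF mpoly.span_base]])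
    then show ?case by (simp add: distrib_left mult.left_commute)
  qed
  moreover have "parameter c k * f - parameter c k * y \<in> P"
    using ideal_mult[OF P y(2)] by (simp add: right_diff_distrib)
  ultimately show ?thesis unfolding reducible_def by blast
qed

text \<open>The ring is finite over the subring generated by the parameters, with control of degrees:
  each \<open>x\<^sub>v\<^bsup>c v\<^esup>\<close> is a root of the polynomial with coefficients \<open>\<plusminus>parameter c k\<close>.\<close>

lemma monom_reducible:
  fixes P :: "('v::finite, 'k::field) mpoly set"
  assumes P: "is_ideal P" and Ks: "Ks \<subseteq> {1..card (UNIV :: 'v set)}" and c: "\<And>v. 0 < c v"
    and KP: "\<And>k. k \<in> {1..card (UNIV :: 'v set)} - Ks \<Longrightarrow> parameter c k \<in> P"
    and "wdeg (\<lambda>_. 1) a \<le> D"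
  shows "monom a \<in> reducible c Ks P D"
  using assms(5)
proof (induction D arbitrary: a rule: less_induct)
  case (less D)
  let ?n = "card (UNIV :: 'v set)"
  have fin: "finite Ks" using Ks finite_subset by blast
  show ?case
  proof (cases "\<forall>v. exponent a v < c v * ?n")
    case True
    have "monom a = (\<lambda>(\<alpha>, \<beta>). monom \<alpha> * (\<Prod>k\<in>Ks. parameter c k ^ \<beta> k)) (a, restrict (\<lambda>_. 0) Ks)"
      by simp
    moreover have "(a, restrict (\<lambda>_. 0) Ks) \<in> {\<alpha>. \<forall>v. exponent \<alpha> v < c v * ?n} \<times> (Ks \<rightarrow>\<^sub>E {..D})"
      using True by auto
    ultimately have "monom a \<in> reduced_products c Ks D" unfolding reduced_products_def by (rule image_eqI)
    then show ?thesis
      unfolding reducible_def using mpoly.span_base ideal_zero[OF P] by (intro CollectI bexI[of _ "monom a"]) auto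
  next
    case False
    then obtain v where v: "c v * ?n \<le> exponent a v" by (auto simp: not_less)
    obtain d where d: "a = Poly_Mapping.single v (c v * ?n) + d"
      by (rule exponent_minus[of "Poly_Mapping.single v (c v * ?n)" a]) (use v in \<open>auto simp: lookup_single when_def\<close>)
    let ?e = "\<lambda>k. Poly_Mapping.single v (c v * (?n - k)) + d"
    have e: "(var v ^ c v) ^ (?n - k) * monom d = (monom (?e k) :: ('v, 'k) mpoly)" for k
      by (subst power_mult[symmetric]) (simp add: var_power mult_single)
    have "monom a = (var v ^ c v) ^ ?n * (monom d :: ('v, 'k) mpoly)"
      using e[of 0] d by simp
    also have "\<dots> = - (\<Sum>k=1..?n. (- 1) ^ k * parameter c k * (var v ^ c v) ^ (?n - k)) * monom d"
      unfolding parameter_def using elem_sym_root[of "\<lambda>v. var v ^ c v :: ('v, 'k) mpoly" v] by simp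
    also have "\<dots> = (\<Sum>k=1..?n. - ((- 1) ^ k * parameter c k * (var v ^ c v) ^ (?n - k) * monom d))"
      by (simp add: sum_negf sum_distrib_right)
    also have "\<dots> = (\<Sum>k=1..?n. const (- ((- 1) ^ k)) * (parameter c k * monom (?e k)))"
    proof (rule sum.cong[OF refl])
      fix k
      have m1: "const ((- 1) ^ k) = ((- 1) ^ k :: ('v, 'k) mpoly)"
      proof (induction k)
        case (Suc k)
        have "const ((- 1) ^ Suc k) = const (- 1) * (const ((- 1) ^ k) :: ('v, 'k) mpoly)"
          by (simp add: mult_single)
        then show ?case using Suc by (simp add: single_uminus)
      qed simp
      show "- ((- 1) ^ k * parameter c k * (var v ^ c v) ^ (?n - k) * monom d) =
          const (- ((- 1) ^ k)) * (parameter c k * (monom (?e k) :: ('v, 'k) mpoly))"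
        by (simp add: m1 single_uminus mult.assoc flip: e)
    qed
    also have "\<dots> \<in> reducible c Ks P D"
    proof (intro reducible_sum[OF P] reducible_const_mult[OF P])
      fix k assume k: "k \<in> {1..?n}"
      show "parameter c k * monom (?e k) \<in> reducible c Ks P D"
      proof (cases "k \<in> Ks")
        case True
        have lt: "c v * (?n - k) < c v * ?n" using k c by simp
        have "wdeg (\<lambda>_. 1) (?e k) < wdeg (\<lambda>_. 1) a" using lt by (simp add: d)
        then have "wdeg (\<lambda>_. 1) (?e k) < D" using less.prems by linarith
        then obtain D' where D: "D = Suc D'" "wdeg (\<lambda>_. 1) (?e k) \<le> D'" by (cases D) auto
        then show ?thesis using reducible_parameter_mult[OF P fin True less.IH] by simp
      next
        case False
        then show ?thesis using KP k by (intro reducible_ideal ideal_mult_right[OF P]) auto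
      qed
    qed
    finally show ?thesis .
  qed
qed

lemma poly_reducible:
  fixes P :: "('v::finite, 'k::field) mpoly set"
  assumes P: "is_ideal P" and Ks: "Ks \<subseteq> {1..card (UNIV :: 'v set)}" and c: "\<And>v. 0 < c v"
    and KP: "\<And>k. k \<in> {1..card (UNIV :: 'v set)} - Ks \<Longrightarrow> parameter c k \<in> P"
    and f: "deg_less (\<lambda>_. 1) (Suc D) f"
  shows "f \<in> reducible c Ks P D"
proof (induction f rule: poly_induct)
  case zero
  then show ?case by (simp add: reducible_ideal ideal_zero P)
next
  case (add f g)
  then show ?case by (rule reducible_add[OF P])
next
  case (monomial a b)
  then have "wdeg (\<lambda>_. 1) a \<le> D" using f by (auto simp: deg_less_def less_Suc_eq_le)
  then show ?case
    using reducible_const_mult[OF P monom_reducible[OF P Ks c KP]]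
    by (subst term_eq_const_mult) blast
qed

lemma power_growth_bound:
  fixes C t j k :: nat
  assumes "\<And>N :: nat. N ^ k \<le> C * (t * N + 1) ^ j"
  shows "k \<le> j"
proof (rule ccontr)
  assume "\<not> k \<le> j"
  define N where "N = C * (t + 1) ^ j + 1"
  have N: "1 \<le> N" by (simp add: N_def)
  have "N * N ^ j = N ^ Suc j" by simp
  also have "\<dots> \<le> N ^ k" using \<open>\<not> k \<le> j\<close> N by (intro power_increasing) auto
  also have "\<dots> \<le> C * (t * N + 1) ^ j" by (rule assms)
  also have "\<dots> \<le> C * ((t + 1) * N) ^ j" using N by (intro mult_left_mono power_mono) auto
  also have "\<dots> = (C * (t + 1) ^ j) * N ^ j" by (simp only: power_mult_distrib mult.assoc)
  finally have "N \<le> C * (t + 1) ^ j" using N by simp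
  then show False by (simp add: N_def)
qed

text \<open>With growing \<open>N\<close>, the \<open>N\<^bsup>k\<^esup>\<close> independent products of the witnesses have degree linear in \<open>N\<close>, and in
  this range of degrees the residue ring has dimension \<open>O(N\<^bsup>card Ks\<^esup>)\<close>.\<close>

theorem prime_chain_bound:
  fixes Ps :: "nat \<Rightarrow> ('v::finite, 'k::field) mpoly set"
  assumes chain: "prime_chain Ps k" and Ks: "Ks \<subseteq> {1..card (UNIV :: 'v set)}" and c: "\<And>v. 0 < c v"
    and KP: "\<And>k. k \<in> {1..card (UNIV :: 'v set)} - Ks \<Longrightarrow> parameter c k \<in> Ps 0"
  shows "k \<le> card Ks"
proof -
  have fin: "finite Ks" using Ks finite_subset by blast
  have P0: "is_ideal (Ps 0)" using chain by (simp add: prime_chain_def prime_is_ideal)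
  have "\<exists>g. g \<in> Ps (Suc i) \<and> g \<notin> Ps i" if "i < k" for i
    using chain that by (auto simp: prime_chain_def)
  then obtain f where f: "\<And>i. i < k \<Longrightarrow> f i \<in> Ps (Suc i) \<and> f i \<notin> Ps i" by metis
  have "\<exists>t. \<forall>i<k. deg_less (\<lambda>_. 1) t (f i)"
  proof -
    have "\<exists>t. deg_less (\<lambda>_. 1) t (f i)" for i by (rule deg_less_exists) blast
    then obtain t where t: "\<And>i. deg_less (\<lambda>_. 1) (t i) (f i)" by metis
    have "deg_less (\<lambda>_. 1) (\<Sum>i<k. t i) (f i)" if "i < k" for i
      by (rule deg_less_mono[OF t]) (use that in \<open>auto intro: member_le_sum\<close>)
    then show ?thesis by blast
  qed
  then obtain t where t: "\<And>i. i < k \<Longrightarrow> deg_less (\<lambda>_. 1) (Suc t) (f i)"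
    using deg_less_mono le_SucI by blast
  define B where "B = card {\<alpha> :: 'v \<Rightarrow>\<^sub>0 nat. \<forall>v. exponent \<alpha> v < c v * card (UNIV :: 'v set)}"
  have "N ^ k \<le> B * ((t * k) * N + 1) ^ card Ks" for N
  proof (rule ccontr)
    let ?A = "exponent_lists k N"
    let ?Y = "reduced_products c Ks ((t * k) * N) :: ('v, 'k) mpoly set"
    assume "\<not> ?thesis"
    then have less: "card ?Y < card ?A"
      using card_reduced_products[OF fin, of c "(t * k) * N", where 'k = 'k] unfolding card_exponent_lists B_def by linarith
    have "\<exists>y\<in>mpoly.span ?Y. power_product f as - y \<in> Ps 0" if as: "as \<in> ?A" for as
    proof -
      have "sum_list as \<le> k * N"
      proof -
        have "sum_list (map (\<lambda>x. x) as) \<le> (\<Sum>x\<leftarrow>as. N)"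
          using as by (intro sum_list_mono) (auto simp: exponent_lists_def subset_iff intro: less_imp_le)
        then show ?thesis using as by (simp add: sum_list_triv exponent_lists_def)
      qed
      then have le: "t * sum_list as \<le> (t * k) * N" by (simp add: mult.assoc)
      have "deg_less (\<lambda>_. 1) (Suc (t * sum_list as)) (power_product f as)"
        by (rule deg_less_power_product) (use t as in \<open>auto simp: exponent_lists_def\<close>)
      then have "deg_less (\<lambda>_. 1) (Suc ((t * k) * N)) (power_product f as)"
        using le by (auto intro: deg_less_mono)
      then have "power_product f as \<in> reducible c Ks (Ps 0) ((t * k) * N)"
        using poly_reducible[OF P0 Ks c KP] by blast
      then show ?thesis by (simp add: reducible_def)
    qed
    then obtain b where "\<exists>as\<in>?A. b as \<noteq> 0" "(\<Sum>as\<in>?A. const (b as) * power_product f as) \<in> Ps 0"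
      using span_mod_dependent[OF P0 finite_exponent_lists finite_reduced_products[OF fin] less, where ?g = "power_product f"]
      by blast
    then show False using chain_independent[OF chain f] by blast
  qed
  then show ?thesis by (rule power_growth_bound)
qed

section \<open>Residue fields of maximal ideals\<close>

definition is_maximal :: "'a::comm_ring_1 set \<Rightarrow> bool"
  where "is_maximal M \<longleftrightarrow> is_prime M \<and> (\<forall>x. x \<notin> M \<longrightarrow> (\<exists>y. x * y - 1 \<in> M))"

definition is_subring :: "'a::comm_ring_1 set \<Rightarrow> bool"
  where "is_subring C \<longleftrightarrow> 1 \<in> C \<and> (\<forall>a\<in>C. \<forall>b\<in>C. a + b \<in> C \<and> a * b \<in> C) \<and> (\<forall>a\<in>C. - a \<in> C)"

lemma subring_one: "is_subring C \<Longrightarrow> 1 \<in> C"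
  and subring_add: "is_subring C \<Longrightarrow> a \<in> C \<Longrightarrow> b \<in> C \<Longrightarrow> a + b \<in> C"
  and subring_mult: "is_subring C \<Longrightarrow> a \<in> C \<Longrightarrow> b \<in> C \<Longrightarrow> a * b \<in> C"
  and subring_uminus: "is_subring C \<Longrightarrow> a \<in> C \<Longrightarrow> - a \<in> C"
  by (auto simp: is_subring_def)

lemma subring_diff: "is_subring C \<Longrightarrow> a \<in> C \<Longrightarrow> b \<in> C \<Longrightarrow> a - b \<in> C"
  by (metis diff_conv_add_uminus subring_add subring_uminus)

lemma subring_power: "is_subring C \<Longrightarrow> a \<in> C \<Longrightarrow> a ^ n \<in> C"
  by (induction n) (auto simp: subring_one subring_mult)

lemma subring_prod: "is_subring C \<Longrightarrow> (\<And>i. i \<in> A \<Longrightarrow> f i \<in> C) \<Longrightarrow> prod f A \<in> C"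
  by (induction A rule: infinite_finite_induct) (auto simp: subring_one subring_mult)

lemma subring_zero: "is_subring C \<Longrightarrow> 0 \<in> C"
  by (metis subring_one subring_uminus subring_add add.right_inverse)

lemma subring_sum: "is_subring C \<Longrightarrow> (\<And>i. i \<in> A \<Longrightarrow> f i \<in> C) \<Longrightarrow> sum f A \<in> C"
  by (induction A rule: infinite_finite_induct) (auto simp: subring_zero subring_add)

text \<open>In the manner of Nakayama's lemma, multiples by elements of \<open>1 + x C\<close> dispense with one generator
  after the other, until such an element is itself zero. So a subring \<open>C\<close> over which a field, here
  the ring modulo \<open>M\<close>, is a finite module is a field.\<close>

lemma module_finite_inverse:
  fixes g :: "'i \<Rightarrow> 'a::comm_ring_1"
  assumes M: "is_ideal M" and C: "is_subring C" and x: "x \<in> C" and y: "x * y - 1 \<in> M"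
    and fin: "finite A"
    and gen: "\<And>f. \<exists>c. (\<forall>i. c i \<in> C) \<and> f - (\<Sum>i\<in>A. c i * g i) \<in> M"
  shows "\<exists>e\<in>C. x * e - 1 \<in> M"
proof -
  have "\<exists>e\<in>C. \<forall>f. \<exists>c. (\<forall>i. c i \<in> C) \<and> (1 + x * e) * f - (\<Sum>i\<in>A - B. c i * g i) \<in> M"
    if "finite B" "B \<subseteq> A" for B
    using that
  proof (induction B rule: finite_induct)
    case empty
    then show ?case using gen subring_zero[OF C] by (intro bexI[of _ 0]) auto
  next
    case (insert b B)
    let ?A = "A - insert b B"
    have A: "A - B = insert b ?A" "finite ?A" "b \<notin> ?A" using insert fin by auto
    obtain e where e: "e \<in> C"
      and IH: "\<And>f. \<exists>c. (\<forall>i. c i \<in> C) \<and> (1 + x * e) * f - (\<Sum>i\<in>A - B. c i * g i) \<in> M"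
      using insert by auto
    define u where "u = 1 + x * e"
    have IH': "\<exists>c. (\<forall>i. c i \<in> C) \<and> u * f - (c b * g b + (\<Sum>i\<in>?A. c i * g i)) \<in> M" for f
    proof -
      have "(\<Sum>i\<in>A - B. c i * g i) = c b * g b + (\<Sum>i\<in>?A. c i * g i)" for c
        by (subst A(1)) (rule sum.insert[OF A(2,3)])
      then show ?thesis using IH[of f] unfolding u_def by metis
    qed
    obtain a where a: "\<And>i. a i \<in> C" "u * (y * g b) - (a b * g b + (\<Sum>i\<in>?A. a i * g i)) \<in> M"
      using IH'[of "y * g b"] by blast
    let ?u = "u - x * a b"
    have gb: "?u * g b - (\<Sum>i\<in>?A. x * a i * g i) \<in> M"
    proof -
      have "?u * g b - (\<Sum>i\<in>?A. x * a i * g i) =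
          x * (u * (y * g b) - (a b * g b + (\<Sum>i\<in>?A. a i * g i))) - (u * g b) * (x * y - 1)"
        by (simp add: algebra_simps sum_distrib_left)
      also have "\<dots> \<in> M" by (rule ideal_diff[OF M ideal_mult[OF M a(2)] ideal_mult[OF M y]])
      finally show ?thesis .
    qed
    define e' where "e' = e + (e - a b) + x * e * (e - a b)"
    have e': "1 + x * e' = ?u * u" by (simp add: e'_def u_def algebra_simps)
    have "e' \<in> C" unfolding e'_def
      by (intro subring_add[OF C] subring_mult[OF C] subring_diff[OF C] e x a)
    moreover have "\<exists>c. (\<forall>i. c i \<in> C) \<and> (1 + x * e') * f - (\<Sum>i\<in>?A. c i * g i) \<in> M" for f
    proof -
      obtain c where c: "\<And>i. c i \<in> C" "u * f - (c b * g b + (\<Sum>i\<in>?A. c i * g i)) \<in> M"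
        using IH'[of f] by blast
      let ?c = "\<lambda>i. ?u * c i + c b * (x * a i)"
      have uC: "?u \<in> C" unfolding u_def
        by (intro subring_add[OF C] subring_mult[OF C] subring_diff[OF C] subring_one[OF C] e x a)
      have "(1 + x * e') * f - (\<Sum>i\<in>?A. ?c i * g i) =
          ?u * (u * f - (c b * g b + (\<Sum>i\<in>?A. c i * g i))) + c b * (?u * g b - (\<Sum>i\<in>?A. x * a i * g i))"
        unfolding e' by (simp add: algebra_simps sum_distrib_left sum.distrib sum_subtractf)
      also have "\<dots> \<in> M" by (rule ideal_add[OF M ideal_mult[OF M c(2)] ideal_mult[OF M gb]])
      finally have "(1 + x * e') * f - (\<Sum>i\<in>?A. ?c i * g i) \<in> M" .
      moreover have "\<forall>i. ?c i \<in> C"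
        using uC x a c by (intro allI subring_add[OF C] subring_mult[OF C])
      ultimately show ?thesis by (intro exI[of _ ?c]) (rule conjI)
    qed
    ultimately show ?case by blast
  qed
  from this[OF fin subset_refl] obtain e where e0: "e \<in> C"
    and "\<forall>f. \<exists>c. (\<forall>i. c i \<in> C) \<and> (1 + x * e) * f - (\<Sum>i\<in>A - A. c i * g i) \<in> M"
    by (elim bexE)
  from this(2)[rule_format, of 1] have e: "e \<in> C" "(1 + x * e) * 1 \<in> M" using e0 by auto
  have "x * (- e) - 1 = - ((1 + x * e) * 1)" by simp
  also have "\<dots> \<in> M" using e M by (intro ideal_uminus)
  finally show ?thesis using e C by (intro bexI[of _ "- e"] subring_uminus)
qed

definition polys_in :: "'v set \<Rightarrow> ('v, 'k::field) mpoly set"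
  where "polys_in T = {f. \<forall>a\<in>support f. Poly_Mapping.keys a \<subseteq> T}"

lemma polys_in_single: "Poly_Mapping.keys a \<subseteq> T \<Longrightarrow> Poly_Mapping.single a c \<in> polys_in T"
  by (simp add: polys_in_def)

lemma polys_in_subring: "is_subring (polys_in T :: ('v, 'k::field) mpoly set)"
  unfolding is_subring_def
proof (intro conjI ballI)
  fix f g :: "('v, 'k) mpoly" assume fg: "f \<in> polys_in T" "g \<in> polys_in T"
  show "f + g \<in> polys_in T" using fg keys_add[of f g] by (auto simp: polys_in_def)
  show "f * g \<in> polys_in T"
    unfolding polys_in_def
  proof (intro CollectI ballI)
    fix a assume "a \<in> support (f * g)"
    then obtain b c where "a = b + c" "b \<in> support f" "c \<in> support g" using keys_mult[of f g] by auto
    then have "Poly_Mapping.keys a \<subseteq> Poly_Mapping.keys b \<union> Poly_Mapping.keys c"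
      "Poly_Mapping.keys b \<subseteq> T" "Poly_Mapping.keys c \<subseteq> T"
      using fg keys_add[of b c] by (auto simp: polys_in_def)
    then show "Poly_Mapping.keys a \<subseteq> T" by blast
  qed
qed (auto simp: polys_in_def in_keys_iff)

lemma polys_in_empty: "f \<in> polys_in {} \<Longrightarrow> f = const (coefficient f 0)"
proof (rule poly_mapping_eqI)
  fix a assume "f \<in> polys_in {}"
  then show "coefficient f a = coefficient (const (coefficient f 0)) a"
    by (cases "a = 0") (auto simp: polys_in_def lookup_single in_keys_iff)
qed

lemma component_polys_in: "f \<in> polys_in T \<Longrightarrow> component w n f \<in> polys_in T"
  by (auto simp: polys_in_def in_keys_iff coefficient_component split: if_splits)

lemma var_nonzero: "var v \<noteq> (0 :: ('v, 'k::field) mpoly)"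
  by (metis var_def lookup_single_eq lookup_zero one_neq_zero)

lemma leading_component:
  assumes "f \<noteq> 0"
  obtains n where "deg_less w (Suc n) f" "component w n f \<noteq> 0"
proof -
  obtain N where N: "deg_less w N f" by (rule deg_less_exists)
  define n where "n = (LEAST n. deg_less w n f)"
  have n: "deg_less w n f" unfolding n_def using N by (rule LeastI)
  then obtain m where m: "n = Suc m" using assms by (cases n) auto
  have "\<not> deg_less w m f" using not_less_Least[of m "\<lambda>n. deg_less w n f"] m by (simp add: n_def)
  then show ?thesis using that[of m] n m deg_less_pred by blast
qed

lemma expand_in_variable:
  fixes h :: "('v::finite, 'k::field) mpoly"
  assumes "h \<in> polys_in (insert v T)" "h \<noteq> 0"
  obtains A m where "\<And>i. A i \<in> polys_in T" "h = (\<Sum>i\<le>m. A i * var v ^ i)" "A m \<noteq> 0"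
proof -
  define A where "A i = (\<Sum>a | a \<in> support h \<and> exponent a v = i.
    Poly_Mapping.single (a - Poly_Mapping.single v i) (coefficient h a))" for i
  have AT: "A i \<in> polys_in T" for i
    unfolding A_def
  proof (rule subring_sum[OF polys_in_subring], rule polys_in_single)
    fix a assume a: "a \<in> {a. a \<in> support h \<and> exponent a v = i}"
    then have "Poly_Mapping.keys a \<subseteq> insert v T" using assms by (auto simp: polys_in_def)
    moreover have "Poly_Mapping.keys (a - Poly_Mapping.single v i) \<subseteq> Poly_Mapping.keys a - {v}"
      using a by (auto simp: in_keys_iff lookup_minus lookup_single when_def split: if_splits)
    ultimately show "Poly_Mapping.keys (a - Poly_Mapping.single v i) \<subseteq> T" by blast
  qed
  define N where "N = (\<Sum>a\<in>support h. exponent a v)"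
  have "(\<Sum>i\<le>N. A i * var v ^ i) = (\<Sum>i\<le>N. \<Sum>a | a \<in> support h \<and> exponent a v = i.
      Poly_Mapping.single a (coefficient h a))"
  proof (rule sum.cong[OF refl])
    fix i
    have "(a - Poly_Mapping.single v i) + Poly_Mapping.single v i = a" if "exponent a v = i" for a :: "'v \<Rightarrow>\<^sub>0 nat"
      using that by (intro poly_mapping_eqI) (auto simp: lookup_add lookup_minus lookup_single when_def)
    then show "A i * var v ^ i = (\<Sum>a | a \<in> support h \<and> exponent a v = i.
        Poly_Mapping.single a (coefficient h a))"
      unfolding A_def sum_distrib_right by (intro sum.cong) (auto simp: var_power mult_single)
  qed
  also have "\<dots> = (\<Sum>a\<in>support h. Poly_Mapping.single a (coefficient h a))"
    by (rule sum.group) (auto simp: N_def intro: member_le_sum)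
  finally have h: "h = (\<Sum>i\<le>N. A i * var v ^ i)" using poly_eq_sum_terms[of h] by simp
  let ?I = "{i. i \<le> N \<and> A i \<noteq> 0}"
  have "?I \<noteq> {}"
  proof
    assume "?I = {}"
    then have "h = 0" by (subst h, intro sum.neutral) auto
    then show False using assms by simp
  qed
  then have m: "Max ?I \<in> ?I" by (intro Max_in) auto
  have "h = (\<Sum>i\<le>Max ?I. A i * var v ^ i)"
    unfolding h
  proof (rule sum.mono_neutral_right)
    show "\<forall>i\<in>{..N} - {..Max ?I}. A i * var v ^ i = 0"
    proof
      fix i assume "i \<in> {..N} - {..Max ?I}"
      then have "i \<notin> ?I" "i \<le> N" using Max_ge[of ?I i] by auto
      then show "A i * var v ^ i = 0" by simp
    qed
  qed (use m in auto)
  then show ?thesis using that AT m by blast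
qed

text \<open>Zariski's lemma. Let \<open>T\<close> be a maximal set of variables that are algebraically independent
  modulo the maximal ideal \<open>M\<close>. Inverting the product \<open>g\<close> of the leading coefficients of
  relations for the other variables makes the residue field finite over \<open>C = K[T, 1/g]\<close>, so
  that \<open>C\<close> is a field. If \<open>T\<close> contained a variable \<open>t\<close>, then \<open>1 + t g\<close> would divide a power of
  \<open>g\<close>, hence be a unit of \<open>K[T]\<close>, which contradicts its degree.\<close>

theorem zariski_lemma:
  fixes M :: "('v::finite, 'k::field) mpoly set"
  assumes M: "is_maximal M"
  shows "\<exists>Y. finite Y \<and> (\<forall>f. \<exists>y\<in>mpoly.span Y. f - y \<in> M)"
proof -
  have pM: "is_prime M" and inv: "\<And>x. x \<notin> M \<Longrightarrow> \<exists>y. x * y - 1 \<in> M"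
    using M by (auto simp: is_maximal_def)
  have iM: "is_ideal M" by (rule prime_is_ideal[OF pM])
  let ?I = "\<lambda>T. polys_in T \<inter> M \<subseteq> {0}"
  have "?I {}"
  proof
    fix f assume f: "f \<in> polys_in {} \<inter> M"
    then have "f = const (coefficient f 0)" by (intro polys_in_empty) simp
    moreover from this have "coefficient f 0 = 0" using f prime_const[OF pM] by auto
    ultimately show "f \<in> {0}" by simp
  qed
  moreover have "card T \<le> card (UNIV :: 'v set)" for T :: "'v set" by (rule card_mono) auto
  ultimately obtain T where T: "?I T" and Tmax: "\<And>T'. ?I T' \<Longrightarrow> card T' \<le> card T"
    using ex_has_greatest_nat[of ?I "{}" card "Suc (card (UNIV :: 'v set))"]
    by (auto simp: less_Suc_eq_le)
  let ?P = "polys_in T :: ('v, 'k) mpoly set"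
  have sP: "is_subring ?P" by (rule polys_in_subring)
  have PM: "p = 0" if "p \<in> ?P" "p \<in> M" for p using T that by auto
  have "\<forall>v. \<exists>A m. v \<notin> T \<longrightarrow> (\<forall>i. A i \<in> ?P) \<and> (\<Sum>i\<le>m. A i * var v ^ i) \<in> M \<and> A m \<noteq> 0"
  proof (rule allI)
    fix v
    have "\<exists>A m. (\<forall>i. A i \<in> ?P) \<and> (\<Sum>i\<le>m. A i * var v ^ i) \<in> M \<and> A m \<noteq> 0" if "v \<notin> T"
    proof -
      have "card (insert v T) > card T" using that by (simp add: card_insert_if)
      then have "\<not> ?I (insert v T)" using Tmax[of "insert v T"] by linarith
      then obtain h where h: "h \<in> polys_in (insert v T)" "h \<in> M" "h \<noteq> 0" by blast
      show ?thesis by (rule expand_in_variable[OF h(1,3)]) (use h in blast)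
    qed
    then show "\<exists>A m. v \<notin> T \<longrightarrow> (\<forall>i. A i \<in> ?P) \<and> (\<Sum>i\<le>m. A i * var v ^ i) \<in> M \<and> A m \<noteq> 0"
      by blast
  qed
  from choice[OF this] obtain A
    where "\<forall>v. \<exists>m. v \<notin> T \<longrightarrow> (\<forall>i. A v i \<in> ?P) \<and> (\<Sum>i\<le>m. A v i * var v ^ i) \<in> M \<and> A v m \<noteq> 0"
    by (rule exE)
  from choice[OF this] obtain m where A: "\<And>v i. v \<notin> T \<Longrightarrow> A v i \<in> ?P"
    "\<And>v. v \<notin> T \<Longrightarrow> (\<Sum>i\<le>m v. A v i * var v ^ i) \<in> M" "\<And>v. v \<notin> T \<Longrightarrow> A v (m v) \<noteq> 0"
    by blast
  have m0: "0 < m v" if "v \<notin> T" for v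
  proof (rule ccontr)
    assume "\<not> 0 < m v"
    then have "A v (m v) \<in> M" using A(2)[OF that] by simp
    then show False using A that PM by blast
  qed
  \<comment> \<open>Outside the zeros of \<open>g\<close> all relations become monic in their variable.\<close>
  define g where "g = (\<Prod>v\<in>- T. A v (m v))"
  have gP: "g \<in> ?P" unfolding g_def using A by (intro subring_prod[OF sP]) auto
  have gM: "g \<notin> M"
  proof
    assume "g \<in> M"
    then obtain v where "v \<in> - T" "A v (m v) \<in> M"
      unfolding g_def by (rule prime_prod[OF pM, rotated]) auto
    then show False using A PM by blast
  qed
  define C where "C = {f. \<exists>N. \<exists>p\<in>?P. g ^ N * f - p \<in> M}"
  have PC: "p \<in> C" if "p \<in> ?P" for p
    unfolding C_def using that ideal_zero[OF iM] by (auto intro!: exI[of _ 0] bexI[of _ p])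
  have sC: "is_subring C"
    unfolding is_subring_def
  proof (intro conjI ballI)
    show "1 \<in> C" using PC subring_one[OF sP] .
  next
    fix a b assume "a \<in> C" "b \<in> C"
    then obtain N p N' p' where a: "p \<in> ?P" "g ^ N * a - p \<in> M" and b: "p' \<in> ?P" "g ^ N' * b - p' \<in> M"
      unfolding C_def by blast
    have "g ^ (N + N') * (a + b) - (g ^ N' * p + g ^ N * p') =
        g ^ N' * (g ^ N * a - p) + g ^ N * (g ^ N' * b - p')"
      by (simp add: power_add algebra_simps)
    also have "\<dots> \<in> M" using a b iM by (intro ideal_add ideal_mult)
    finally have "g ^ (N + N') * (a + b) - (g ^ N' * p + g ^ N * p') \<in> M" .
    moreover have "g ^ N' * p + g ^ N * p' \<in> ?P"
      using a b gP by (intro subring_add[OF sP] subring_mult[OF sP] subring_power[OF sP])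
    ultimately show "a + b \<in> C" unfolding C_def by blast
    have "g ^ (N + N') * (a * b) - p * p' = (g ^ N' * b) * (g ^ N * a - p) + p * (g ^ N' * b - p')"
      by (simp add: power_add algebra_simps)
    also have "\<dots> \<in> M" using a b iM by (intro ideal_add ideal_mult)
    finally have "g ^ (N + N') * (a * b) - p * p' \<in> M" .
    moreover have "p * p' \<in> ?P" using a b by (intro subring_mult[OF sP])
    ultimately show "a * b \<in> C" unfolding C_def by blast
  next
    fix a assume "a \<in> C"
    then obtain N p where a: "p \<in> ?P" "g ^ N * a - p \<in> M" unfolding C_def by blast
    have "g ^ N * (- a) - (- p) \<in> M" using ideal_uminus[OF iM a(2)] by simp
    then show "- a \<in> C" unfolding C_def using subring_uminus[OF sP a(1)] by blast
  qed
  have lead: "\<exists>w\<in>C. w * A v (m v) - 1 \<in> M" if v: "v \<notin> T" for v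
  proof -
    have "A v (m v) \<notin> M" using A[OF v] PM by blast
    then obtain w where w: "A v (m v) * w - 1 \<in> M" using inv by blast
    let ?r = "\<Prod>u\<in>- T - {v}. A u (m u)"
    have g: "g = A v (m v) * ?r" unfolding g_def by (rule prod.remove) (use v in auto)
    have "g ^ 1 * w - ?r = ?r * (A v (m v) * w - 1)" by (simp add: g algebra_simps)
    also have "\<dots> \<in> M" using w iM by (intro ideal_mult)
    finally have "g ^ 1 * w - ?r \<in> M" .
    moreover have "?r \<in> ?P" using A by (intro subring_prod[OF sP]) auto
    ultimately have "w \<in> C" unfolding C_def by blast
    then show ?thesis using w by (auto simp: mult.commute)
  qed
  define b where "b v = (if v \<in> T then 1 else m v)" for v
  have b: "v \<notin> T \<Longrightarrow> b v = m v" "0 < b v" for v using m0 by (auto simp: b_def)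
  define Box where "Box = {\<alpha>. \<forall>v. exponent \<alpha> v < b v}"
  have finB: "finite Box" unfolding Box_def by (rule finite_exponents_below)
  \<comment> \<open>The \<open>C\<close>-module \<open>H\<close> spanned by the monomials of \<open>Box\<close> is stable under multiplication by the
    variables, hence is the whole ring.\<close>
  define H where "H = {f. \<exists>c. (\<forall>\<alpha>. c \<alpha> \<in> C) \<and> f - (\<Sum>\<alpha>\<in>Box. c \<alpha> * monom \<alpha>) \<in> M}"
  have H_add: "f + f' \<in> H" if ff: "f \<in> H" "f' \<in> H" for f f'
  proof -
    obtain c c' where c: "\<forall>\<alpha>. c \<alpha> \<in> C" "f - (\<Sum>\<alpha>\<in>Box. c \<alpha> * monom \<alpha>) \<in> M"
      and c': "\<forall>\<alpha>. c' \<alpha> \<in> C" "f' - (\<Sum>\<alpha>\<in>Box. c' \<alpha> * monom \<alpha>) \<in> M"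
      using ff unfolding H_def by blast
    have "(f + f') - (\<Sum>\<alpha>\<in>Box. (c \<alpha> + c' \<alpha>) * monom \<alpha>) =
        (f - (\<Sum>\<alpha>\<in>Box. c \<alpha> * monom \<alpha>)) + (f' - (\<Sum>\<alpha>\<in>Box. c' \<alpha> * monom \<alpha>))"
      by (simp add: distrib_right sum.distrib)
    also have "\<dots> \<in> M" using c c' iM by (intro ideal_add) auto
    finally show ?thesis unfolding H_def using c c' subring_add[OF sC]
      by (intro CollectI exI[of _ "\<lambda>\<alpha>. c \<alpha> + c' \<alpha>"]) auto
  qed
  have H_mult: "a * f \<in> H" if af: "a \<in> C" "f \<in> H" for a f
  proof -
    obtain c where c: "\<forall>\<alpha>. c \<alpha> \<in> C" "f - (\<Sum>\<alpha>\<in>Box. c \<alpha> * monom \<alpha>) \<in> M"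
      using af unfolding H_def by blast
    have "a * f - (\<Sum>\<alpha>\<in>Box. (a * c \<alpha>) * monom \<alpha>) = a * (f - (\<Sum>\<alpha>\<in>Box. c \<alpha> * monom \<alpha>))"
      by (simp add: right_diff_distrib sum_distrib_left mult.assoc)
    also have "\<dots> \<in> M" using c iM by (intro ideal_mult) auto
    finally show ?thesis unfolding H_def using c af subring_mult[OF sC]
      by (intro CollectI exI[of _ "\<lambda>\<alpha>. a * c \<alpha>"]) auto
  qed
  have H_ideal: "f \<in> H" if "f \<in> M" for f
    unfolding H_def using that subring_zero[OF sC] by (intro CollectI exI[of _ "\<lambda>_. 0"]) auto
  have H_sum: "sum f S \<in> H" if "\<And>i. i \<in> S \<Longrightarrow> f i \<in> H" for f :: "'i \<Rightarrow> _" and S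
    using that by (induction S rule: infinite_finite_induct) (auto intro: H_add H_ideal ideal_zero[OF iM])
  have H_box: "monom \<alpha> \<in> H" if "\<alpha> \<in> Box" for \<alpha>
  proof -
    have "(\<Sum>\<beta>\<in>Box. (if \<beta> = \<alpha> then 1 else 0) * (monom \<beta> :: ('v, 'k) mpoly)) = monom \<alpha>"
    proof -
      have "(\<Sum>\<beta>\<in>Box. (if \<beta> = \<alpha> then 1 else 0) * (monom \<beta> :: ('v, 'k) mpoly)) =
          (\<Sum>\<beta>\<in>Box. if \<beta> = \<alpha> then monom \<beta> else 0)" by (rule sum.cong) auto
      also have "\<dots> = monom \<alpha>" using that finB by simp
      finally show ?thesis .
    qed
    then show ?thesis unfolding H_def
      using subring_zero[OF sC] subring_one[OF sC] ideal_zero[OF iM]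
      by (intro CollectI exI[of _ "\<lambda>\<beta>. if \<beta> = \<alpha> then 1 else 0"]) auto
  qed
  have H_var_box: "var v * monom \<alpha> \<in> H" if \<alpha>: "\<alpha> \<in> Box" for v \<alpha>
  proof (cases "v \<in> T")
    case True
    then have "var v \<in> C" by (intro PC) (simp add: var_def polys_in_single)
    then show ?thesis using H_mult H_box \<alpha> by blast
  next
    case v: False
    have lt: "exponent \<alpha> v < m v" using \<alpha> b(1)[OF v] unfolding Box_def by (metis mem_Collect_eq)
    show ?thesis
    proof (cases "Suc (exponent \<alpha> v) < m v")
      case True
      have "var v * monom \<alpha> = (monom (Poly_Mapping.single v 1 + \<alpha>) :: ('v, 'k) mpoly)"
        by (simp add: var_def mult_single)
      moreover have "Poly_Mapping.single v 1 + \<alpha> \<in> Box"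
        using \<alpha> True b(1)[OF v] by (auto simp: Box_def lookup_add lookup_single when_def)
      ultimately show ?thesis using H_box by simp
    next
      case False
      let ?e = "exponent \<alpha> v"
      have e: "m v = Suc ?e" using False lt by simp
      obtain \<beta> where \<beta>: "\<alpha> = Poly_Mapping.single v ?e + \<beta>"
        by (rule exponent_minus[of "Poly_Mapping.single v ?e" \<alpha>]) (auto simp: lookup_single when_def)
      have \<beta>v: "exponent \<beta> v = 0" using arg_cong[OF \<beta>, of "\<lambda>a. exponent a v"] by (simp add: lookup_add)
      have \<beta>B: "Poly_Mapping.single v i + \<beta> \<in> Box" if "i < m v" for i
      proof -
        have "exponent \<beta> u = exponent \<alpha> u" if "u \<noteq> v" for u
          using arg_cong[OF \<beta>, of "\<lambda>a. exponent a u"] that by (simp add: lookup_add lookup_single)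
        then show ?thesis
          using \<alpha> that b(1)[OF v] \<beta>v by (auto simp: Box_def lookup_add lookup_single when_def)
      qed
      obtain w where w: "w \<in> C" "w * A v (m v) - 1 \<in> M" using lead[OF v] by blast
      let ?S = "\<Sum>i<m v. A v i * var v ^ i"
      have rel: "A v (m v) * var v ^ m v + ?S \<in> M"
        using A(2)[OF v] by (simp add: lessThan_Suc_atMost[symmetric] add.commute)
      have x: "var v * monom \<alpha> = var v ^ m v * (monom \<beta> :: ('v, 'k) mpoly)"
      proof -
        have "monom \<alpha> = var v ^ ?e * (monom \<beta> :: ('v, 'k) mpoly)"
          by (subst \<beta>) (simp add: var_power mult_single)
        then show ?thesis by (simp add: e mult.assoc)
      qed
      let ?z = "(var v ^ m v * monom \<beta>) * (w * A v (m v) - 1) - (w * monom \<beta>) * (A v (m v) * var v ^ m v + ?S)"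
      have "?z \<in> M" by (rule ideal_diff[OF iM ideal_mult[OF iM w(2)] ideal_mult[OF iM rel]])
      then have zH: "- ?z \<in> H" using ideal_uminus[OF iM] H_ideal by blast
      have "(- w) * (\<Sum>i<m v. A v i * (var v ^ i * monom \<beta>)) \<in> H"
      proof (rule H_mult[OF subring_uminus[OF sC w(1)]], rule H_sum, rule H_mult)
        fix i assume "i \<in> {..<m v}"
        then show "A v i \<in> C" "var v ^ i * monom \<beta> \<in> H"
          using A(1)[OF v] PC H_box[OF \<beta>B] by (auto simp: var_power mult_single)
      qed
      with zH have "- ?z + (- w) * (\<Sum>i<m v. A v i * (var v ^ i * monom \<beta>)) \<in> H" by (rule H_add)
      moreover have "(\<Sum>i<m v. A v i * (var v ^ i * monom \<beta>)) = ?S * monom \<beta>"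
        by (simp add: sum_distrib_right mult.assoc)
      then have "- ?z + (- w) * (\<Sum>i<m v. A v i * (var v ^ i * monom \<beta>)) = var v ^ m v * monom \<beta>"
        by (simp only:) (simp add: algebra_simps)
      ultimately show ?thesis using x by simp
    qed
  qed
  have H_var: "var v * f \<in> H" if fH: "f \<in> H" for v f
  proof -
    obtain c where c: "\<forall>\<alpha>. c \<alpha> \<in> C" "f - (\<Sum>\<alpha>\<in>Box. c \<alpha> * monom \<alpha>) \<in> M"
      using fH unfolding H_def by blast
    have "(\<Sum>\<alpha>\<in>Box. c \<alpha> * (var v * monom \<alpha>)) \<in> H"
      using c H_var_box by (intro H_sum, intro H_mult[OF _ H_var_box]) auto
    moreover have "var v * (f - (\<Sum>\<alpha>\<in>Box. c \<alpha> * monom \<alpha>)) \<in> H"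
      by (rule H_ideal[OF ideal_mult[OF iM c(2)]])
    ultimately have "(\<Sum>\<alpha>\<in>Box. c \<alpha> * (var v * monom \<alpha>)) + var v * (f - (\<Sum>\<alpha>\<in>Box. c \<alpha> * monom \<alpha>)) \<in> H"
      by (rule H_add)
    then show ?thesis by (simp add: right_diff_distrib sum_distrib_left mult.left_commute)
  qed
  have H_monom: "monom a \<in> H" for a
  proof (induction "wdeg (\<lambda>_. 1) a" arbitrary: a rule: less_induct)
    case less
    show ?case
    proof (cases "a = 0")
      case True
      have "0 \<in> Box" using b(2) by (auto simp: Box_def)
      then show ?thesis using H_box True by blast
    next
      case False
      then obtain v where v: "exponent a v \<noteq> 0" by (metis lookup_zero poly_mapping_eqI)
      obtain d where d: "a = Poly_Mapping.single v 1 + d"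
        by (rule exponent_minus[of "Poly_Mapping.single v 1" a])
          (use v in \<open>auto simp: lookup_single when_def\<close>)
      then have "monom d \<in> H" by (intro less) simp
      then have "var v * monom d \<in> H" by (rule H_var)
      then show ?thesis by (simp add: d var_def mult_single)
    qed
  qed
  have H_all: "f \<in> H" for f
  proof (induction f rule: poly_induct)
    case zero
    show ?case using H_ideal ideal_zero[OF iM] .
  next
    case (add f g)
    then show ?case by (rule H_add)
  next
    case (monomial a c)
    have "const c \<in> C" by (intro PC polys_in_single) simp
    then show ?case using H_mult[OF _ H_monom] by (subst term_eq_const_mult)
  qed
  have "T = {}"
  proof (rule ccontr)
    assume "T \<noteq> {}"
    then obtain t where t: "t \<in> T" by blast
    let ?c = "1 + var t * g"
    have tP: "var t \<in> ?P" using t by (simp add: var_def polys_in_single)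
    have cP: "?c \<in> ?P" using tP gP by (intro subring_add[OF sP] subring_mult[OF sP] subring_one[OF sP])
    have "coefficient ?c 0 = 1"
    proof -
      have "Poly_Mapping.single t (1 :: nat) \<noteq> 0"
        by (metis lookup_single_eq lookup_zero one_neq_zero)
      then show ?thesis by (simp add: lookup_add coefficient_mult_zero var_def lookup_single when_def)
    qed
    then have "?c \<noteq> 0" by auto
    then have "?c \<notin> M" using PM cP by blast
    then obtain y where y: "?c * y - 1 \<in> M" using inv by blast
    have gen: "\<exists>c. (\<forall>\<alpha>. c \<alpha> \<in> C) \<and> f - (\<Sum>\<alpha>\<in>Box. c \<alpha> * monom \<alpha>) \<in> M" for f
      using H_all[of f] by (simp add: H_def)
    obtain e where e: "e \<in> C" "?c * e - 1 \<in> M"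
      using module_finite_inverse[OF iM sC PC[OF cP] y finB gen] by blast
    then obtain N p where p: "p \<in> ?P" "g ^ N * e - p \<in> M" unfolding C_def by blast
    have "?c * p - g ^ N = g ^ N * (?c * e - 1) - ?c * (g ^ N * e - p)" by (simp add: algebra_simps)
    also have "\<dots> \<in> M" by (rule ideal_diff[OF iM ideal_mult[OF iM e(2)] ideal_mult[OF iM p(2)]])
    finally have "?c * p - g ^ N = 0"
      using cP p gP by (intro PM subring_diff[OF sP] subring_mult[OF sP] subring_power[OF sP])
    then have cp: "?c * p = g ^ N" by simp
    \<comment> \<open>Modulo \<open>1 + t g\<close> the element \<open>t g\<close> equals \<open>- 1\<close>, so a divisor of \<open>g\<^bsup>N\<^esup>\<close> of this form
      divides \<open>1\<close>.\<close>
    have "\<exists>q\<in>?P. (?c - 1) ^ n = ?c * q + (- 1) ^ n" for n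
    proof (induction n)
      case 0
      then show ?case using subring_zero[OF sP] by (intro bexI[of _ 0]) auto
    next
      case (Suc n)
      then obtain q where q: "q \<in> ?P" "(?c - 1) ^ n = ?c * q + (- 1) ^ n" by blast
      let ?q = "(?c - 1) * q + (- 1) ^ n"
      have "(?c - 1) ^ Suc n = (?c - 1) * (?c * q + (- 1) ^ n)" using q(2) by simp
      also have "\<dots> = ?c * ?q + (- 1) ^ Suc n" by (simp add: algebra_simps)
      finally have "(?c - 1) ^ Suc n = ?c * ?q + (- 1) ^ Suc n" .
      moreover have "?q \<in> ?P"
        using q tP gP by (intro subring_add[OF sP] subring_mult[OF sP] subring_diff[OF sP]
            subring_one[OF sP] subring_power[OF sP] subring_uminus[OF sP])
      ultimately show ?case by blast
    qed
    then obtain q where q: "q \<in> ?P" "(?c - 1) ^ N = ?c * q + (- 1) ^ N" by blast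
    have "(?c - 1) ^ N = var t ^ N * (?c * p)" by (simp add: power_mult_distrib cp)
    then have cq: "?c * (var t ^ N * p - q) = (- 1) ^ N" using q(2) by (simp add: algebra_simps)
    let ?q = "var t ^ N * p - q"
    have qP: "?q \<in> ?P"
      using tP p q by (intro subring_diff[OF sP] subring_mult[OF sP] subring_power[OF sP])
    have "?q \<noteq> 0"
    proof
      assume "?q = 0"
      then have "(- 1 :: ('v, 'k) mpoly) ^ N = 0" using cq by simp
      then have "(- 1 :: ('v, 'k) mpoly) ^ N * (- 1) ^ N = 0" by simp
      then show False by (simp add: power_mult_distrib[symmetric])
    qed
    then obtain n where n: "deg_less (\<lambda>_. 1) (Suc n) ?q" "component (\<lambda>_. 1) n ?q \<noteq> 0"
      by (rule leading_component)
    have "g \<noteq> 0" using gM ideal_zero[OF iM] by auto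
    then obtain k where k: "deg_less (\<lambda>_. 1) (Suc k) g" "component (\<lambda>_. 1) k g \<noteq> 0"
      by (rule leading_component)
    have ht: "homogeneous (\<lambda>_. 1) 1 (var t)" unfolding var_def using homogeneous_term[of "\<lambda>_. 1"] by (metis wdeg_single mult_1)
    have h1: "homogeneous (\<lambda>_. 1) 0 ((- 1) ^ N :: ('v, 'k) mpoly)"
      using homogeneous_power[of _ 0 "- 1 :: ('v, 'k) mpoly" N] by (simp add: homogeneous_def)
    have "deg_less (\<lambda>_. 1) (Suc (Suc k)) ?c"
    proof (rule deg_less_add)
      show "deg_less (\<lambda>_. 1) (Suc (Suc k)) (1 :: ('v, 'k) mpoly)"
        by (rule homogeneous_imp_deg_less[OF homogeneous_one]) simp
      have "deg_less (\<lambda>_. 1) (1 + Suc k) (var t * g)"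
        by (rule deg_less_mult[OF _ k(1)], rule homogeneous_imp_deg_less[OF ht]) simp
      then show "deg_less (\<lambda>_. 1) (Suc (Suc k)) (var t * g)" by simp
    qed
    from component_mult_top[OF this n(1)]
    have "component (\<lambda>_. 1) (Suc k) ?c * component (\<lambda>_. 1) n ?q = component (\<lambda>_. 1) (Suc k + n) ((- 1) ^ N)"
      using cq by simp
    also have "\<dots> = 0" by (subst component_homogeneous[OF h1]) simp
    also have "component (\<lambda>_. 1) (Suc k) ?c = var t * component (\<lambda>_. 1) k g"
      unfolding component_add component_homogeneous[OF homogeneous_one] component_homogeneous_mult[OF ht]
      by simp
    finally have "var t * component (\<lambda>_. 1) k g * component (\<lambda>_. 1) n ?q \<in> M"
      using ideal_zero[OF iM] by simp
    then have "var t \<in> M \<or> component (\<lambda>_. 1) k g \<in> M \<or> component (\<lambda>_. 1) n ?q \<in> M"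
      using prime_mult[OF pM] by blast
    then show False
      using PM tP var_nonzero k n component_polys_in[OF gP] component_polys_in[OF qP] by metis
  qed
  have C_const: "\<exists>b. a - const b \<in> M" if aC: "a \<in> C" for a
  proof -
    obtain N p where p: "p \<in> ?P" "g ^ N * a - p \<in> M" using aC unfolding C_def by blast
    have const: "f = const (coefficient f 0)" if "f \<in> ?P" for f
      using that \<open>T = {}\<close> by (intro polys_in_empty) simp
    let ?d = "coefficient (g ^ N) 0" and ?b = "coefficient p 0"
    have gN: "g ^ N = const ?d" "p = const ?b" using const subring_power[OF sP gP] p by auto
    have "g ^ N \<notin> M" using gM prime_power[OF pM] by blast
    then have "?d \<noteq> 0" using gN(1) ideal_zero[OF iM] by (metis single_zero)
    then have d: "const (inverse ?d) * const ?d = (1 :: ('v, 'k) mpoly)" by (simp add: mult_single)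
    have "const (inverse ?d) * (const ?d * a - const ?b) \<in> M"
      using p(2) gN ideal_mult[OF iM] by metis
    moreover have "const (inverse ?d) * (const ?d * a - const ?b) = a - const (inverse ?d * ?b)"
    proof -
      have "const (inverse ?d) * (const ?d * a - const ?b) =
          (const (inverse ?d) * const ?d) * a - const (inverse ?d) * const ?b"
        by (simp only: right_diff_distrib mult.assoc)
      then show ?thesis unfolding d by (simp add: mult_single)
    qed
    ultimately show ?thesis by metis
  qed
  show ?thesis
  proof (intro exI[of _ "monom ` Box"] conjI allI)
    show "finite (monom ` Box)" using finB by simp
    fix f
    obtain c where c: "\<forall>\<alpha>. c \<alpha> \<in> C" "f - (\<Sum>\<alpha>\<in>Box. c \<alpha> * monom \<alpha>) \<in> M"
      using H_all[of f] unfolding H_def by blast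
    have "\<forall>\<alpha>. \<exists>b. c \<alpha> - const b \<in> M" using C_const c(1) by blast
    from choice[OF this] obtain b where b: "\<forall>\<alpha>. c \<alpha> - const (b \<alpha>) \<in> M" by (rule exE)
    let ?y = "\<Sum>\<alpha>\<in>Box. const (b \<alpha>) * monom \<alpha>"
    have "f - ?y = (f - (\<Sum>\<alpha>\<in>Box. c \<alpha> * monom \<alpha>)) + (\<Sum>\<alpha>\<in>Box. monom \<alpha> * (c \<alpha> - const (b \<alpha>)))"
      by (simp add: right_diff_distrib sum_subtractf mult.commute)
    also have "\<dots> \<in> M" using b by (intro ideal_add[OF iM c(2)] ideal_sum[OF iM] ideal_mult[OF iM]) simp
    finally have "f - ?y \<in> M" .
    moreover have "?y \<in> mpoly.span (monom ` Box)"
      by (intro mpoly.span_sum mpoly.span_scale mpoly.span_base) auto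
    ultimately show "\<exists>y\<in>mpoly.span (monom ` Box). f - y \<in> M" by blast
  qed
qed

text \<open>In the finite-dimensional residue field the powers of \<open>f\<close> are dependent; a relation is made
  monic by dividing by its last nonzero coefficient.\<close>

lemma maximal_algebraic:
  fixes M :: "('v::finite, 'k::field) mpoly set"
  assumes M: "is_maximal M"
  obtains m c where "0 < m" "f ^ m + (\<Sum>i<m. const (c i) * f ^ i) \<in> M"
proof -
  have pM: "is_prime M" using M by (simp add: is_maximal_def)
  have iM: "is_ideal M" by (rule prime_is_ideal[OF pM])
  obtain Y where Y: "finite Y" "\<forall>f. \<exists>y\<in>mpoly.span Y. f - y \<in> M"
    using zariski_lemma[OF M] by blast
  obtain c where c: "\<exists>i\<in>{..card Y}. c i \<noteq> 0" "(\<Sum>i\<le>card Y. const (c i) * f ^ i) \<in> M"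
    using span_mod_dependent[OF iM finite_atMost Y(1), of "card Y" "\<lambda>i. f ^ i"] Y(2) by auto
  let ?I = "{i. i \<le> card Y \<and> c i \<noteq> 0}"
  define m where "m = Max ?I"
  have m: "m \<in> ?I" unfolding m_def using c(1) by (intro Max_in) auto
  have "(\<Sum>i\<le>card Y. const (c i) * f ^ i) = (\<Sum>i\<le>m. const (c i) * f ^ i)"
  proof (rule sum.mono_neutral_right)
    show "\<forall>i\<in>{..card Y} - {..m}. const (c i) * f ^ i = 0"
    proof
      fix i assume "i \<in> {..card Y} - {..m}"
      then have "i \<notin> ?I" "i \<le> card Y" using Max_ge[of ?I i] by (auto simp: m_def)
      then show "const (c i) * f ^ i = 0" by simp
    qed
  qed (use m in auto)
  then have r: "(\<Sum>i\<le>m. const (c i) * f ^ i) \<in> M" using c by simp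
  have d: "const (inverse (c m) * c m) = (1 :: ('v, 'k) mpoly)" using m by simp
  have "const (inverse (c m)) * (\<Sum>i\<le>m. const (c i) * f ^ i) =
      f ^ m + (\<Sum>i<m. const (inverse (c m) * c i) * f ^ i)"
  proof -
    have "const (inverse (c m)) * (\<Sum>i\<le>m. const (c i) * f ^ i) =
        (\<Sum>i\<le>m. const (inverse (c m) * c i) * f ^ i)"
      by (simp add: sum_distrib_left mult_single flip: mult.assoc)
    also have "\<dots> = (\<Sum>i<m. const (inverse (c m) * c i) * f ^ i) + 1 * f ^ m"
      by (simp only: lessThan_Suc_atMost[symmetric] sum.lessThan_Suc d)
    finally show ?thesis by (simp add: add.commute)
  qed
  then have rel: "f ^ m + (\<Sum>i<m. const (inverse (c m) * c i) * f ^ i) \<in> M"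
    using ideal_mult[OF iM r] by metis
  have "0 < m"
  proof (rule ccontr)
    assume "\<not> 0 < m"
    then have "1 \<in> M" using rel by simp
    then show False using prime_one[OF pM] by blast
  qed
  then show ?thesis by (rule that) (rule rel)
qed

section \<open>Stretching exponents\<close>

definition stretch :: "('v::finite \<Rightarrow> nat) \<Rightarrow> ('v \<Rightarrow>\<^sub>0 nat) \<Rightarrow> ('v \<Rightarrow>\<^sub>0 nat)"
  where "stretch e a = exponent_of (\<lambda>v. e v * exponent a v)"

definition residues_below :: "('v::finite \<Rightarrow> nat) \<Rightarrow> ('v \<Rightarrow>\<^sub>0 nat) set"
  where "residues_below e = {\<rho>. \<forall>v. exponent \<rho> v < e v}"

text \<open>The polynomial ring is free over its subring generated by the powers \<open>x\<^sub>v\<^bsup>e v\<^esup>\<close>, with the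
  monomials of exponent \<open>\<rho>\<close> in \<open>residues_below e\<close> as a basis. The coordinate of \<open>f\<close> at \<open>\<rho>\<close>,
  with each \<open>x\<^sub>v\<^bsup>e v\<^esup>\<close> renamed to \<open>x\<^sub>v\<close>, is \<open>coordinate e \<rho> f\<close>.\<close>

definition coordinate :: "('v::finite \<Rightarrow> nat) \<Rightarrow> ('v \<Rightarrow>\<^sub>0 nat) \<Rightarrow> ('v, 'k::field) mpoly \<Rightarrow> ('v, 'k) mpoly"
  where "coordinate e \<rho> f = (\<Sum>a | a \<in> support f \<and> (\<forall>v. exponent a v mod e v = exponent \<rho> v).
    Poly_Mapping.single (exponent_of (\<lambda>v. exponent a v div e v)) (coefficient f a))"

definition from_coordinate :: "('v::finite \<Rightarrow> nat) \<Rightarrow> ('v \<Rightarrow>\<^sub>0 nat) \<Rightarrow> ('v, 'k::field) mpoly \<Rightarrow> ('v, 'k) mpoly"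
  where "from_coordinate e \<rho> g = (\<Sum>b\<in>support g. Poly_Mapping.single (\<rho> + stretch e b) (coefficient g b))"

lemma finite_residues_below: "finite (residues_below e)"
  unfolding residues_below_def by (rule finite_exponents_below)

lemma exponent_stretch [simp]: "exponent (stretch e a) v = e v * exponent a v"
  by (simp add: stretch_def)

lemma stretch_add: "stretch e (a + b) = stretch e a + stretch e b"
  by (rule poly_mapping_eqI) (simp add: lookup_add distrib_left)

lemma residue_decompose:
  assumes "\<And>v. 0 < e v" "\<rho> \<in> residues_below e"
  shows "a = \<rho> + stretch e b \<longleftrightarrow>
    (\<forall>v. exponent a v mod e v = exponent \<rho> v) \<and> exponent_of (\<lambda>v. exponent a v div e v) = b"
proof
  assume "a = \<rho> + stretch e b"
  then show "(\<forall>v. exponent a v mod e v = exponent \<rho> v) \<and> exponent_of (\<lambda>v. exponent a v div e v) = b"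
    using assms by (auto simp: lookup_add residues_below_def less_imp_neq[symmetric] intro!: poly_mapping_eqI)
next
  assume a: "(\<forall>v. exponent a v mod e v = exponent \<rho> v) \<and> exponent_of (\<lambda>v. exponent a v div e v) = b"
  show "a = \<rho> + stretch e b"
  proof (rule poly_mapping_eqI)
    fix v
    have "exponent b v = exponent a v div e v" using a by auto
    moreover have "exponent \<rho> v = exponent a v mod e v" using a by simp
    ultimately show "exponent a v = exponent (\<rho> + stretch e b) v"
      by (simp only: lookup_add exponent_stretch mod_mult_div_eq)
  qed
qed

lemma coefficient_coordinate:
  assumes "\<And>v. 0 < e v" "\<rho> \<in> residues_below e"
  shows "coefficient (coordinate e \<rho> f) b = coefficient f (\<rho> + stretch e b)"
proof -
  have "coefficient (coordinate e \<rho> f) b =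
      (\<Sum>a | a \<in> support f \<and> (\<forall>v. exponent a v mod e v = exponent \<rho> v).
        if a = \<rho> + stretch e b then coefficient f a else 0)"
    unfolding coordinate_def lookup_sum
    by (rule sum.cong) (auto simp: lookup_single when_def residue_decompose[OF assms])
  also have "\<dots> = coefficient f (\<rho> + stretch e b)"
  proof (cases "\<rho> + stretch e b \<in> support f")
    case True
    then have "\<rho> + stretch e b \<in> {a. a \<in> support f \<and> (\<forall>v. exponent a v mod e v = exponent \<rho> v)}"
      using residue_decompose[OF assms, of "\<rho> + stretch e b" b] by simp
    then show ?thesis by (subst sum.delta) auto
  next
    case False
    then have "coefficient f (\<rho> + stretch e b) = 0" by (simp add: in_keys_iff)
    then show ?thesis using False by (subst sum.delta) auto
  qed
  finally show ?thesis .
qed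

lemma coefficient_from_coordinate:
  assumes "\<And>v. 0 < e v" "\<rho> \<in> residues_below e" and \<sigma>: "\<sigma> \<in> residues_below e"
  shows "coefficient (from_coordinate e \<rho> g) (\<sigma> + stretch e b) =
    (if \<sigma> = \<rho> then coefficient g b else 0)"
proof -
  have eq: "\<rho> + stretch e c = \<sigma> + stretch e b \<longleftrightarrow> \<sigma> = \<rho> \<and> c = b" for c
  proof
    assume *: "\<rho> + stretch e c = \<sigma> + stretch e b"
    have "\<forall>v. exponent (\<rho> + stretch e c) v mod e v = exponent \<rho> v"
      "exponent_of (\<lambda>v. exponent (\<rho> + stretch e c) v div e v) = c"
      "\<forall>v. exponent (\<sigma> + stretch e b) v mod e v = exponent \<sigma> v"
      "exponent_of (\<lambda>v. exponent (\<sigma> + stretch e b) v div e v) = b"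
      using residue_decompose[OF assms(1,2), of "\<rho> + stretch e c" c]
        residue_decompose[OF assms(1) \<sigma>, of "\<sigma> + stretch e b" b] by auto
    then show "\<sigma> = \<rho> \<and> c = b" unfolding * by (auto intro: poly_mapping_eqI)
  qed simp
  have "coefficient (from_coordinate e \<rho> g) (\<sigma> + stretch e b) =
      (\<Sum>c\<in>support g. if c = b then (if \<sigma> = \<rho> then coefficient g b else 0) else 0)"
    unfolding from_coordinate_def lookup_sum
    by (rule sum.cong) (auto simp: lookup_single when_def eq)
  then show ?thesis by (auto simp: in_keys_iff)
qed

lemma coordinate_from_coordinate:
  assumes "\<And>v. 0 < e v" "\<rho> \<in> residues_below e" "\<sigma> \<in> residues_below e"
  shows "coordinate e \<sigma> (from_coordinate e \<rho> g) = (if \<sigma> = \<rho> then g else 0)"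
  by (rule poly_mapping_eqI)
    (simp add: coefficient_coordinate[OF assms(1,3)] coefficient_from_coordinate[OF assms])

lemma coordinate_add:
  assumes "\<And>v. 0 < e v" "\<rho> \<in> residues_below e"
  shows "coordinate e \<rho> (f + g) = coordinate e \<rho> f + coordinate e \<rho> g"
  by (rule poly_mapping_eqI) (simp add: coefficient_coordinate[OF assms] lookup_add)

lemma coordinate_diff:
  assumes "\<And>v. 0 < e v" "\<rho> \<in> residues_below e"
  shows "coordinate e \<rho> (f - g) = coordinate e \<rho> f - coordinate e \<rho> g"
  by (rule poly_mapping_eqI) (simp add: coefficient_coordinate[OF assms] lookup_minus)

lemma coordinate_zero [simp]: "coordinate e \<rho> 0 = 0"
  by (simp add: coordinate_def)

lemma coordinate_sum:
  assumes "\<And>v. 0 < e v" "\<rho> \<in> residues_below e"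
  shows "coordinate e \<rho> (sum f A) = (\<Sum>i\<in>A. coordinate e \<rho> (f i))"
  by (induction A rule: infinite_finite_induct) (auto simp: coordinate_add[OF assms])

text \<open>Multiplication by \<open>T\<close> acts on all coordinates as multiplication by \<open>t\<close>: this says that
  \<open>T\<close> arises from \<open>t\<close> by substituting \<open>x\<^sub>v\<^bsup>e v\<^esup>\<close> for \<open>x\<^sub>v\<close>.\<close>

definition stretches :: "('v::finite \<Rightarrow> nat) \<Rightarrow> ('v, 'k::field) mpoly \<Rightarrow> ('v, 'k) mpoly \<Rightarrow> bool"
  where "stretches e T t \<longleftrightarrow>
    (\<forall>\<rho>\<in>residues_below e. \<forall>f. coordinate e \<rho> (T * f) = t * coordinate e \<rho> f)"

lemma stretches_one: "stretches e 1 1"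
  by (simp add: stretches_def)

lemma stretches_zero: "stretches e 0 0"
  by (simp add: stretches_def)

lemma stretches_mult: "stretches e T t \<Longrightarrow> stretches e T' t' \<Longrightarrow> stretches e (T * T') (t * t')"
  by (simp add: stretches_def mult.assoc)

lemma stretches_power: "stretches e T t \<Longrightarrow> stretches e (T ^ n) (t ^ n)"
  by (induction n) (simp_all add: stretches_one stretches_mult)

lemma stretches_add:
  "(\<And>v. 0 < e v) \<Longrightarrow> stretches e T t \<Longrightarrow> stretches e T' t' \<Longrightarrow> stretches e (T + T') (t + t')"
  by (simp add: stretches_def distrib_right coordinate_add)

lemma stretches_sum:
  "(\<And>v. 0 < e v) \<Longrightarrow> (\<And>i. i \<in> A \<Longrightarrow> stretches e (T i) (t i)) \<Longrightarrow> stretches e (sum T A) (sum t A)"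
  by (induction A rule: infinite_finite_induct) (auto simp: stretches_zero intro: stretches_add)

lemma stretches_prod:
  "(\<And>i. i \<in> A \<Longrightarrow> stretches e (T i) (t i)) \<Longrightarrow> stretches e (prod T A) (prod t A)"
  by (induction A rule: infinite_finite_induct) (auto simp: stretches_one intro: stretches_mult)

lemma stretches_var:
  assumes e: "\<And>v. 0 < e v"
  shows "stretches e (var v ^ e v :: ('v::finite, 'k::field) mpoly) (var v)"
  unfolding stretches_def
proof (intro ballI allI poly_mapping_eqI)
  fix \<rho> :: "'v \<Rightarrow>\<^sub>0 nat" and f :: "('v, 'k) mpoly" and b :: "'v \<Rightarrow>\<^sub>0 nat"
  assume \<rho>: "\<rho> \<in> residues_below e"
  note coef = coefficient_coordinate[OF e \<rho>]
  show "coefficient (coordinate e \<rho> (var v ^ e v * f)) b = coefficient (var v * coordinate e \<rho> f) b"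
  proof (cases "exponent b v = 0")
    case True
    have "b \<noteq> Poly_Mapping.single v 1 + b'" for b'
      using True by (auto simp: lookup_add)
    then have "coefficient (var v * coordinate e \<rho> f) b = 0"
      unfolding var_eq_monom by (rule coefficient_term_mult_eq_0)
    moreover have "\<rho> + stretch e b \<noteq> Poly_Mapping.single v (e v) + b'" for b'
    proof
      assume "\<rho> + stretch e b = Poly_Mapping.single v (e v) + b'"
      then have "exponent \<rho> v + e v * exponent b v = e v + exponent b' v"
        by (metis exponent_stretch lookup_add lookup_single_eq)
      then show False using True \<rho> by (auto simp: residues_below_def) (metis leD le_add1)
    qed
    then have "coefficient (var v ^ e v * f) (\<rho> + stretch e b) = 0"
      unfolding var_power by (rule coefficient_term_mult_eq_0)
    ultimately show ?thesis by (simp add: coef)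
  next
    case False
    obtain b' where b': "b = Poly_Mapping.single v 1 + b'"
      by (rule exponent_minus[of "Poly_Mapping.single v 1" b])
        (use False in \<open>auto simp: lookup_single when_def\<close>)
    have "\<rho> + stretch e b = Poly_Mapping.single v (e v) + (\<rho> + stretch e b')"
      by (rule poly_mapping_eqI) (simp add: b' lookup_add lookup_single when_def)
    then have "coefficient (coordinate e \<rho> (var v ^ e v * f)) b = coefficient f (\<rho> + stretch e b')"
      unfolding coef var_power by (simp only: coefficient_term_mult mult_1)
    also have "\<dots> = coefficient (var v * coordinate e \<rho> f) b"
      unfolding b' var_eq_monom coefficient_term_mult by (simp add: coef)
    finally show ?thesis .
  qed
qed

lemma stretches_parameter:
  assumes "\<And>v. 0 < e v"
  shows "stretches e (parameter e k :: ('v::finite, 'k::field) mpoly) (parameter (\<lambda>_. 1) k)"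
  unfolding parameter_def elem_sym_def
  using assms by (intro stretches_sum stretches_prod) (auto intro: stretches_var)

text \<open>The coordinates of the members of \<open>J\<close> range over the ideals \<open>Jc \<rho>\<close> independently of each other:
  the residue module of \<open>J\<close> is the direct sum of those of the ideals \<open>Jc \<rho>\<close>.\<close>

definition coordinatewise ::
  "('v::finite \<Rightarrow> nat) \<Rightarrow> ('v, 'k::field) mpoly set \<Rightarrow> (('v \<Rightarrow>\<^sub>0 nat) \<Rightarrow> ('v, 'k) mpoly set) \<Rightarrow> bool"
  where "coordinatewise e J Jc \<longleftrightarrow> (\<forall>\<rho>\<in>residues_below e. is_ideal (Jc \<rho>)) \<and>
    (\<forall>f. f \<in> J \<longleftrightarrow> (\<forall>\<rho>\<in>residues_below e. coordinate e \<rho> f \<in> Jc \<rho>))"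

lemma coordinatewise_nonzerodivisor:
  assumes e: "\<And>v. 0 < e v" and J: "coordinatewise e J Jc" and T: "stretches e T t"
  shows "nonzerodivisor_mod T J \<longleftrightarrow> (\<forall>\<rho>\<in>residues_below e. nonzerodivisor_mod t (Jc \<rho>))"
proof (intro iffI ballI)
  fix \<rho> assume T_reg: "nonzerodivisor_mod T J" and \<rho>: "\<rho> \<in> residues_below e"
  show "nonzerodivisor_mod t (Jc \<rho>)"
    unfolding nonzerodivisor_mod_def
  proof (intro allI impI)
    fix g assume g: "t * g \<in> Jc \<rho>"
    let ?f = "from_coordinate e \<rho> g"
    have "coordinate e \<sigma> (T * ?f) \<in> Jc \<sigma>" if "\<sigma> \<in> residues_below e" for \<sigma>
    proof -
      have "coordinate e \<sigma> (T * ?f) = t * (if \<sigma> = \<rho> then g else 0)"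
        using T that coordinate_from_coordinate[OF e \<rho> that, of g] by (simp add: stretches_def)
      then show ?thesis
        using g J that ideal_zero[of "Jc \<sigma>"] by (auto simp: coordinatewise_def)
    qed
    then have "T * ?f \<in> J" using J by (simp add: coordinatewise_def)
    then have "?f \<in> J" using T_reg by (simp add: nonzerodivisor_mod_def)
    then have "coordinate e \<rho> ?f \<in> Jc \<rho>" using J \<rho> by (simp add: coordinatewise_def)
    then show "g \<in> Jc \<rho>" by (simp add: coordinate_from_coordinate[OF e \<rho> \<rho>])
  qed
next
  assume "\<forall>\<rho>\<in>residues_below e. nonzerodivisor_mod t (Jc \<rho>)"
  then show "nonzerodivisor_mod T J"
    using J T by (simp add: nonzerodivisor_mod_def coordinatewise_def stretches_def)
qed

lemma coordinatewise_adjoin: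
  assumes e: "\<And>v. 0 < e v" and J: "coordinatewise e J Jc" and T: "stretches e T t"
  shows "coordinatewise e (adjoin J T) (\<lambda>\<rho>. adjoin (Jc \<rho>) t)"
  unfolding coordinatewise_def
proof (intro conjI ballI allI iffI)
  show "is_ideal (adjoin (Jc \<rho>) t)" if "\<rho> \<in> residues_below e" for \<rho>
    using J that by (simp add: coordinatewise_def ideal_adjoin)
next
  fix f \<rho> assume "f \<in> adjoin J T" and \<rho>: "\<rho> \<in> residues_below e"
  then obtain j a where f: "j \<in> J" "f = j + a * T" by (auto simp: adjoin_def)
  have "coordinate e \<rho> f = coordinate e \<rho> j + coordinate e \<rho> a * t"
    using T \<rho> by (simp add: f coordinate_add[OF e \<rho>] stretches_def mult.commute[of a])
  moreover have "coordinate e \<rho> j \<in> Jc \<rho>" using J f \<rho> by (simp add: coordinatewise_def)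
  ultimately show "coordinate e \<rho> f \<in> adjoin (Jc \<rho>) t" unfolding adjoin_def by blast
next
  fix f assume f: "\<forall>\<rho>\<in>residues_below e. coordinate e \<rho> f \<in> adjoin (Jc \<rho>) t"
  have "\<forall>\<rho>. \<exists>a. \<rho> \<in> residues_below e \<longrightarrow> coordinate e \<rho> f - a * t \<in> Jc \<rho>"
  proof
    fix \<rho>
    show "\<exists>a. \<rho> \<in> residues_below e \<longrightarrow> coordinate e \<rho> f - a * t \<in> Jc \<rho>"
    proof (cases "\<rho> \<in> residues_below e")
      case True
      then obtain j a where "j \<in> Jc \<rho>" "coordinate e \<rho> f = j + a * t"
        using f unfolding adjoin_def by blast
      then show ?thesis by (intro exI[of _ a]) simp
    qed blast
  qed
  from choice[OF this] obtain a
    where a: "\<And>\<rho>. \<rho> \<in> residues_below e \<Longrightarrow> coordinate e \<rho> f - a \<rho> * t \<in> Jc \<rho>" by blast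
  let ?a = "\<Sum>\<rho>\<in>residues_below e. from_coordinate e \<rho> (a \<rho>)"
  have ca: "coordinate e \<sigma> ?a = a \<sigma>" if \<sigma>: "\<sigma> \<in> residues_below e" for \<sigma>
  proof -
    have "coordinate e \<sigma> ?a = (\<Sum>\<rho>\<in>residues_below e. if \<sigma> = \<rho> then a \<rho> else 0)"
      unfolding coordinate_sum[OF e \<sigma>]
      by (rule sum.cong[OF refl]) (simp add: coordinate_from_coordinate[OF e _ \<sigma>])
    then show ?thesis using \<sigma> by (simp add: finite_residues_below)
  qed
  have "coordinate e \<sigma> (f - T * ?a) = coordinate e \<sigma> f - a \<sigma> * t" if "\<sigma> \<in> residues_below e" for \<sigma>
  proof -
    have "coordinate e \<sigma> (T * ?a) = t * a \<sigma>" using T that ca[OF that] by (simp add: stretches_def)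
    then show ?thesis by (simp add: coordinate_diff[OF e that] mult.commute)
  qed
  then have "f - T * ?a \<in> J" using J a by (simp add: coordinatewise_def)
  moreover have "f = (f - T * ?a) + ?a * T" by (simp add: mult.commute)
  ultimately show "f \<in> adjoin J T" unfolding adjoin_def by blast
qed

text \<open>Along the sequence, both the nonzerodivisor condition and the passage to the next ideal split
  over the coordinates.\<close>

theorem coordinatewise_regular_seq:
  assumes e: "\<And>v. 0 < e v" and "coordinatewise e J Jc" "list_all2 (stretches e) Ts ts"
  shows "regular_seq J Ts \<longleftrightarrow> (\<forall>\<rho>\<in>residues_below e. regular_seq (Jc \<rho>) ts)"
  using assms(3,2)
proof (induction arbitrary: J Jc rule: list_all2_induct)
  case (Cons T Ts t ts)
  show ?case
    using coordinatewise_nonzerodivisor[OF e Cons.prems Cons.hyps(1)]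
      Cons.IH[OF coordinatewise_adjoin[OF e Cons.prems Cons.hyps(1)]] by auto
qed simp

section \<open>Monomial ideals\<close>

definition monomial_ideal :: "('v \<Rightarrow>\<^sub>0 nat) set \<Rightarrow> ('v, 'k::field) mpoly set"
  where "monomial_ideal U = {f. support f \<subseteq> U}"

definition up_closed :: "('v \<Rightarrow>\<^sub>0 nat) set \<Rightarrow> bool"
  where "up_closed U \<longleftrightarrow> (\<forall>a\<in>U. \<forall>b. a + b \<in> U)"

lemma monomial_ideal_is_ideal:
  assumes U: "up_closed U"
  shows "is_ideal (monomial_ideal U :: ('v, 'k::field) mpoly set)"
proof (rule is_idealI)
  fix f g :: "('v, 'k) mpoly" assume "f \<in> monomial_ideal U" "g \<in> monomial_ideal U"
  then show "f + g \<in> monomial_ideal U" using keys_add[of f g] by (auto simp: monomial_ideal_def)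
next
  fix r f :: "('v, 'k) mpoly" assume f: "f \<in> monomial_ideal U"
  show "r * f \<in> monomial_ideal U"
    unfolding monomial_ideal_def
  proof (intro CollectI subsetI)
    fix a assume "a \<in> support (r * f)"
    then obtain b c where "a = c + b" "c \<in> support f"
      using keys_mult[of r f] by (auto simp: add.commute)
    then show "a \<in> U" using f U by (auto simp: monomial_ideal_def up_closed_def)
  qed
qed (simp add: monomial_ideal_def)

lemma monomial_ideal_homogeneous:
  "up_closed U \<Longrightarrow> homogeneous_ideal w (monomial_ideal U)"
  unfolding homogeneous_ideal_def
  by (auto simp: monomial_ideal_is_ideal)
    (auto simp: monomial_ideal_def in_keys_iff coefficient_component subset_iff split: if_splits)

lemma monom_in_monomial_ideal: "a \<in> U \<Longrightarrow> Poly_Mapping.single a c \<in> monomial_ideal U"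
  by (simp add: monomial_ideal_def)

text \<open>A monomial ideal contains all terms of its members, hence the parts of a member that belong
  to the various residues.\<close>

lemma monomial_ideal_coordinatewise:
  assumes e: "\<And>v. 0 < e v" and U: "up_closed U"
  shows "coordinatewise e (monomial_ideal U) (\<lambda>\<rho>. monomial_ideal {b. \<rho> + stretch e b \<in> U})"
  unfolding coordinatewise_def
proof (intro conjI ballI allI iffI)
  show "is_ideal (monomial_ideal {b. \<rho> + stretch e b \<in> U})" for \<rho>
  proof (rule monomial_ideal_is_ideal)
    show "up_closed {b. \<rho> + stretch e b \<in> U}"
      using U by (auto simp: up_closed_def stretch_add simp flip: add.assoc)
  qed
next
  fix f \<rho> assume f: "f \<in> monomial_ideal U" and \<rho>: "\<rho> \<in> residues_below e"
  show "coordinate e \<rho> f \<in> monomial_ideal {b. \<rho> + stretch e b \<in> U}"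
    using f by (auto simp: monomial_ideal_def in_keys_iff coefficient_coordinate[OF e \<rho>])
next
  fix f assume f: "\<forall>\<rho>\<in>residues_below e. coordinate e \<rho> f \<in> monomial_ideal {b. \<rho> + stretch e b \<in> U}"
  show "f \<in> monomial_ideal U"
    unfolding monomial_ideal_def
  proof (intro CollectI subsetI)
    fix a assume a: "a \<in> support f"
    let ?\<rho> = "exponent_of (\<lambda>v. exponent a v mod e v)" and ?b = "exponent_of (\<lambda>v. exponent a v div e v)"
    have \<rho>: "?\<rho> \<in> residues_below e" using e by (simp add: residues_below_def)
    have dec: "a = ?\<rho> + stretch e ?b" by (simp add: residue_decompose[OF e \<rho>])
    then have "?b \<in> support (coordinate e ?\<rho> f)"
      using a by (simp add: in_keys_iff coefficient_coordinate[OF e \<rho>])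
    then have "?\<rho> + stretch e ?b \<in> U" using f \<rho> by (auto simp: monomial_ideal_def)
    then show "a \<in> U" using dec by metis
  qed
qed

lemma homogeneous_parameter:
  assumes "\<And>v. w v * c v = L"
  shows "homogeneous w (k * L) (parameter c k)"
  unfolding parameter_def elem_sym_def
proof (rule homogeneous_sum)
  fix F :: "'a set" assume "F \<in> {F. card F = k}"
  moreover have "homogeneous w (\<Sum>v\<in>F. L) (\<Prod>v\<in>F. var v ^ c v)"
  proof (rule homogeneous_prod)
    fix v
    show "homogeneous w L (var v ^ c v)"
      unfolding var_power using homogeneous_term[of w "Poly_Mapping.single v (c v)" 1] by (simp add: assms)
  qed
  ultimately show "homogeneous w (k * L) (\<Prod>v\<in>F. var v ^ c v)" by simp
qed

section \<open>The polynomial ring is Noetherian\<close>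

definition linear_combinations :: "'a::comm_ring_1 set \<Rightarrow> 'a set \<Rightarrow> 'a set"
  where "linear_combinations S B = {\<Sum>b\<in>B. c b * b | c. \<forall>b. c b \<in> S}"

definition ideal_of :: "'a::comm_ring_1 set \<Rightarrow> 'a set \<Rightarrow> bool"
  where "ideal_of S L \<longleftrightarrow> L \<subseteq> S \<and> 0 \<in> L \<and> (\<forall>a\<in>L. \<forall>b\<in>L. a + b \<in> L) \<and> (\<forall>s\<in>S. \<forall>a\<in>L. s * a \<in> L)"

definition noetherian_subring :: "'a::comm_ring_1 set \<Rightarrow> bool"
  where "noetherian_subring S \<longleftrightarrow>
    (\<forall>L. ideal_of S L \<longrightarrow> (\<exists>B. finite B \<and> B \<subseteq> L \<and> L \<subseteq> linear_combinations S B))"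

definition adjoin_element :: "'a::comm_ring_1 set \<Rightarrow> 'a \<Rightarrow> 'a set"
  where "adjoin_element S x = {\<Sum>i<n. a i * x ^ i | a n. \<forall>i. a i \<in> S}"

lemma ideal_of_sum: "ideal_of S L \<Longrightarrow> (\<And>i. i \<in> A \<Longrightarrow> f i \<in> L) \<Longrightarrow> sum f A \<in> L"
  by (induction A rule: infinite_finite_induct) (auto simp: ideal_of_def)

lemma linear_combinations_add:
  assumes "is_subring S" "f \<in> linear_combinations S B" "g \<in> linear_combinations S B"
  shows "f + g \<in> linear_combinations S B"
proof -
  obtain c d where "\<forall>b. c b \<in> S" "f = (\<Sum>b\<in>B. c b * b)" "\<forall>b. d b \<in> S" "g = (\<Sum>b\<in>B. d b * b)"
    using assms unfolding linear_combinations_def by blast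
  then have "f + g = (\<Sum>b\<in>B. (c b + d b) * b)" "\<forall>b. c b + d b \<in> S"
    using assms(1) by (auto simp: distrib_right sum.distrib subring_add)
  then show ?thesis unfolding linear_combinations_def
    by (intro CollectI exI[of _ "\<lambda>b. c b + d b"] conjI)
qed

lemma linear_combinations_mult:
  assumes "is_subring S" "s \<in> S" "f \<in> linear_combinations S B"
  shows "s * f \<in> linear_combinations S B"
proof -
  obtain c where "\<forall>b. c b \<in> S" "f = (\<Sum>b\<in>B. c b * b)"
    using assms unfolding linear_combinations_def by blast
  then have "s * f = (\<Sum>b\<in>B. (s * c b) * b)" "\<forall>b. s * c b \<in> S"
    using assms by (auto simp: sum_distrib_left mult.assoc subring_mult)
  then show ?thesis unfolding linear_combinations_def
    by (intro CollectI exI[of _ "\<lambda>b. s * c b"] conjI)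
qed

lemma linear_combinations_zero: "is_subring S \<Longrightarrow> 0 \<in> linear_combinations S B"
  unfolding linear_combinations_def
  by (intro CollectI exI[of _ "\<lambda>_. 0"]) (auto simp: subring_zero)

lemma linear_combinations_sum:
  "is_subring S \<Longrightarrow> (\<And>i. i \<in> A \<Longrightarrow> f i \<in> linear_combinations S B) \<Longrightarrow> sum f A \<in> linear_combinations S B"
  by (induction A rule: infinite_finite_induct)
    (auto intro: linear_combinations_zero linear_combinations_add)

lemma linear_combinations_base:
  assumes "is_subring S" "finite B" "b \<in> B"
  shows "b \<in> linear_combinations S B"
proof -
  have "b = (\<Sum>b'\<in>B. (if b' = b then 1 else 0) * b')"
    using assms by (simp add: if_distrib[of "\<lambda>c. c * _"] cong: if_cong)
  moreover have "\<forall>b'. (if b' = b then 1 else 0) \<in> S"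
    using assms by (simp add: subring_one subring_zero)
  ultimately show ?thesis unfolding linear_combinations_def
    by (intro CollectI exI[of _ "\<lambda>b'. if b' = b then 1 else 0"] conjI)
qed

lemma adjoin_element_mult_power:
  assumes S: "is_subring S" and "s \<in> S"
  shows "s * x ^ k \<in> adjoin_element S x"
proof -
  have "s * x ^ k = (\<Sum>i<Suc k. (if i = k then s else 0) * x ^ i)"
  proof -
    have "(\<Sum>i<Suc k. (if i = k then s else 0) * x ^ i) = (\<Sum>i<Suc k. if i = k then s * x ^ i else 0)"
      by (rule sum.cong) auto
    then show ?thesis by simp
  qed
  moreover have "\<forall>i. (if i = k then s else 0) \<in> S" using assms by (simp add: subring_zero)
  ultimately show ?thesis unfolding adjoin_element_def
    by (intro CollectI exI[of _ "\<lambda>i. if i = k then s else 0"] exI[of _ "Suc k"] conjI)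
qed

text \<open>Hilbert's basis theorem, for a subring \<open>S\<close> of the ambient ring and an arbitrary element
  \<open>x\<close>: finitely many elements whose leading coefficients generate the ideals of leading
  coefficients in each degree suffice to lower the degree of every element of the ideal.\<close>

theorem hilbert_basis:
  assumes S: "is_subring S" and N: "noetherian_subring S" and Sx: "is_subring (adjoin_element S x)"
  shows "noetherian_subring (adjoin_element S x)"
  unfolding noetherian_subring_def
proof (intro allI impI)
  let ?Sx = "adjoin_element S x"
  fix J assume J: "ideal_of ?Sx J"
  have J_add: "a + b \<in> J" if "a \<in> J" "b \<in> J" for a b using J that by (simp add: ideal_of_def)
  have J_mult: "s * a \<in> J" if "s \<in> ?Sx" "a \<in> J" for s a using J that by (simp add: ideal_of_def)
  have xS: "s * x ^ k \<in> ?Sx" if "s \<in> S" for s k using adjoin_element_mult_power[OF S that] .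
  define L where "L n = {s \<in> S. \<exists>a. (\<forall>i. a i \<in> S) \<and> (\<Sum>i<n. a i * x ^ i) + s * x ^ n \<in> J}" for n
  have L_ideal: "ideal_of S (L n)" for n
    unfolding ideal_of_def
  proof (intro conjI ballI)
    show "L n \<subseteq> S" by (auto simp: L_def)
    have "0 \<in> J" using J by (simp add: ideal_of_def)
    then show "0 \<in> L n" unfolding L_def using subring_zero[OF S]
      by (intro CollectI conjI exI[of _ "\<lambda>_. 0"]) auto
  next
    fix s t assume "s \<in> L n" "t \<in> L n"
    then obtain a b where a: "s \<in> S" "\<forall>i. a i \<in> S" "(\<Sum>i<n. a i * x ^ i) + s * x ^ n \<in> J"
      and b: "t \<in> S" "\<forall>i. b i \<in> S" "(\<Sum>i<n. b i * x ^ i) + t * x ^ n \<in> J"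
      unfolding L_def by blast
    have "(\<Sum>i<n. (a i + b i) * x ^ i) + (s + t) * x ^ n =
        ((\<Sum>i<n. a i * x ^ i) + s * x ^ n) + ((\<Sum>i<n. b i * x ^ i) + t * x ^ n)"
      by (simp add: distrib_right sum.distrib)
    then have "(\<Sum>i<n. (a i + b i) * x ^ i) + (s + t) * x ^ n \<in> J" using J_add[OF a(3) b(3)] by simp
    then show "s + t \<in> L n" unfolding L_def using a b S
      by (intro CollectI conjI exI[of _ "\<lambda>i. a i + b i"]) (auto simp: subring_add)
  next
    fix r s assume r: "r \<in> S" and "s \<in> L n"
    then obtain a where a: "s \<in> S" "\<forall>i. a i \<in> S" "(\<Sum>i<n. a i * x ^ i) + s * x ^ n \<in> J"
      unfolding L_def by blast
    have "(\<Sum>i<n. (r * a i) * x ^ i) + (r * s) * x ^ n = (r * x ^ 0) * ((\<Sum>i<n. a i * x ^ i) + s * x ^ n)"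
      by (simp add: distrib_left sum_distrib_left mult.assoc)
    then have "(\<Sum>i<n. (r * a i) * x ^ i) + (r * s) * x ^ n \<in> J" using J_mult[OF xS[OF r] a(3)] by metis
    then show "r * s \<in> L n" unfolding L_def using a r S
      by (intro CollectI conjI exI[of _ "\<lambda>i. r * a i"]) (auto simp: subring_mult)
  qed
  have L_Suc: "L n \<subseteq> L (Suc n)" for n
  proof
    fix s assume "s \<in> L n"
    then obtain a where a: "s \<in> S" "\<forall>i. a i \<in> S" "(\<Sum>i<n. a i * x ^ i) + s * x ^ n \<in> J"
      unfolding L_def by blast
    let ?a = "\<lambda>i. case i of 0 \<Rightarrow> 0 | Suc j \<Rightarrow> a j"
    have "(\<Sum>i<Suc n. ?a i * x ^ i) + s * x ^ Suc n = (1 * x ^ 1) * ((\<Sum>i<n. a i * x ^ i) + s * x ^ n)"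
      unfolding sum.lessThan_Suc_shift by (simp add: distrib_left sum_distrib_left mult_ac)
    then have "(\<Sum>i<Suc n. ?a i * x ^ i) + s * x ^ Suc n \<in> J"
      using J_mult[OF xS[OF subring_one[OF S]] a(3)] by metis
    moreover have "\<forall>i. ?a i \<in> S" using a subring_zero[OF S] by (auto split: nat.split)
    ultimately show "s \<in> L (Suc n)" unfolding L_def using a by blast
  qed
  have L_mono: "L m \<subseteq> L n" if "m \<le> n" for m n using lift_Suc_mono_le[of L, OF L_Suc that] .
  have "ideal_of S (\<Union>n. L n)"
    unfolding ideal_of_def
  proof (intro conjI ballI)
    show "(\<Union>n. L n) \<subseteq> S" "0 \<in> (\<Union>n. L n)" using L_ideal unfolding ideal_of_def by blast+
  next
    fix a b assume "a \<in> (\<Union>n. L n)" "b \<in> (\<Union>n. L n)"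
    then obtain m n where "a \<in> L m" "b \<in> L n" by blast
    then have "a \<in> L (max m n)" "b \<in> L (max m n)" using L_mono by (meson max.cobounded1 max.cobounded2 subsetD)+
    then have "a + b \<in> L (max m n)" using L_ideal by (simp add: ideal_of_def)
    then show "a + b \<in> (\<Union>n. L n)" by blast
  next
    fix s a assume "s \<in> S" "a \<in> (\<Union>n. L n)"
    then show "s * a \<in> (\<Union>n. L n)" using L_ideal unfolding ideal_of_def by blast
  qed
  then obtain B0 where B0: "finite B0" "B0 \<subseteq> (\<Union>n. L n)" "(\<Union>n. L n) \<subseteq> linear_combinations S B0"
    using N unfolding noetherian_subring_def by blast
  have "\<exists>N. B0 \<subseteq> L N"
    using B0(1,2)
  proof (induction B0 rule: finite_induct)
    case (insert b B)
    then obtain N n where "B \<subseteq> L N" "b \<in> L n" by auto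
    then have "insert b B \<subseteq> L (max N n)" using L_mono[of N "max N n"] L_mono[of n "max N n"] by auto
    then show ?case by blast
  qed simp
  then obtain N0 where N0: "B0 \<subseteq> L N0" by blast
  have L_top: "L n \<subseteq> L N0" for n
  proof
    fix s assume "s \<in> L n"
    then have "s \<in> linear_combinations S B0" using B0(3) by blast
    then obtain c where "\<forall>b. c b \<in> S" "s = (\<Sum>b\<in>B0. c b * b)" unfolding linear_combinations_def by blast
    then show "s \<in> L N0"
      using N0 L_ideal[of N0] by (auto simp: ideal_of_def intro!: ideal_of_sum[OF L_ideal])
  qed
  have "\<forall>n. \<exists>B. finite B \<and> B \<subseteq> L n \<and> L n \<subseteq> linear_combinations S B"
    using N L_ideal unfolding noetherian_subring_def by blast
  from choice[OF this] obtain B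
    where B: "\<And>n. finite (B n)" "\<And>n. B n \<subseteq> L n" "\<And>n. L n \<subseteq> linear_combinations S (B n)" by blast
  define lift where "lift n s = (SOME f. f \<in> J \<and> (\<exists>a. (\<forall>i. a i \<in> S) \<and> f = (\<Sum>i<n. a i * x ^ i) + s * x ^ n))" for n s
  have lift: "lift n s \<in> J \<and> (\<exists>a. (\<forall>i. a i \<in> S) \<and> lift n s = (\<Sum>i<n. a i * x ^ i) + s * x ^ n)"
    if "s \<in> L n" for n s
  proof -
    obtain a where "\<forall>i. a i \<in> S" "(\<Sum>i<n. a i * x ^ i) + s * x ^ n \<in> J"
      using \<open>s \<in> L n\<close> unfolding L_def by blast
    then have "\<exists>f. f \<in> J \<and> (\<exists>a. (\<forall>i. a i \<in> S) \<and> f = (\<Sum>i<n. a i * x ^ i) + s * x ^ n)"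
      by (intro exI[of _ "(\<Sum>i<n. a i * x ^ i) + s * x ^ n"] conjI exI[of _ a]) auto
    then show ?thesis unfolding lift_def by (rule someI_ex)
  qed
  let ?G = "\<Union>n\<in>{..N0}. lift n ` B n"
  have finG: "finite ?G" using B by blast
  have GJ: "?G \<subseteq> J" using lift B(2) by blast
  have "f \<in> linear_combinations ?Sx ?G" if "f \<in> J" "\<forall>i. a i \<in> S" "f = (\<Sum>i<n. a i * x ^ i)" for f a n
    using that
  proof (induction n arbitrary: f a)
    case 0
    then show ?case using linear_combinations_zero[OF Sx] by simp
  next
    case (Suc n)
    define k where "k = min n N0"
    have "a n \<in> L n" using Suc.prems by (auto simp: L_def)
    then have "a n \<in> L k" using L_top unfolding k_def by (cases "n \<le> N0") (auto simp: min_def)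
    then obtain c where c: "\<And>b. c b \<in> S" "a n = (\<Sum>b\<in>B k. c b * b)"
      using B(3) unfolding linear_combinations_def by blast
    have Lk: "b \<in> L k" if "b \<in> B k" for b using B(2) that by blast
    have "\<forall>b. \<exists>d. b \<in> B k \<longrightarrow> (\<forall>i. d i \<in> S) \<and> lift k b = (\<Sum>i<k. d i * x ^ i) + b * x ^ k"
      using lift Lk by blast
    from choice[OF this] obtain d where d: "\<And>b i. b \<in> B k \<Longrightarrow> d b i \<in> S"
      "\<And>b. b \<in> B k \<Longrightarrow> lift k b = (\<Sum>i<k. d b i * x ^ i) + b * x ^ k" by blast
    let ?h = "\<Sum>b\<in>B k. (c b * x ^ (n - k)) * lift k b"
    have hG: "?h \<in> linear_combinations ?Sx ?G"
    proof (intro linear_combinations_sum[OF Sx] linear_combinations_mult[OF Sx] linear_combinations_base[OF Sx finG])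
      fix b assume "b \<in> B k"
      show "c b * x ^ (n - k) \<in> ?Sx" using xS c by blast
      show "lift k b \<in> ?G" using \<open>b \<in> B k\<close> by (auto simp: k_def)
    qed
    have hJ: "?h \<in> J" using c xS lift Lk by (intro ideal_of_sum[OF J] J_mult) auto
    have kn: "x ^ (n - k) * x ^ k = x ^ n" by (simp add: k_def flip: power_add)
    define a' where "a' i = a i - (if n - k \<le> i then \<Sum>b\<in>B k. c b * d b (i - (n - k)) else 0)" for i
    have "f - ?h = (\<Sum>i<n. a' i * x ^ i)"
    proof -
      have "?h = (\<Sum>b\<in>B k. c b * (x ^ (n - k) * (\<Sum>i<k. d b i * x ^ i)) + c b * b * x ^ n)"
      proof (rule sum.cong[OF refl])
        fix b assume b: "b \<in> B k"
        have "c b * x ^ (n - k) * lift k b =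
            c b * (x ^ (n - k) * (\<Sum>i<k. d b i * x ^ i)) + c b * b * (x ^ (n - k) * x ^ k)"
          by (simp only: d(2)[OF b] distrib_left mult_ac)
        then show "c b * x ^ (n - k) * lift k b =
            c b * (x ^ (n - k) * (\<Sum>i<k. d b i * x ^ i)) + c b * b * x ^ n"
          by (simp only: kn)
      qed
      also have "\<dots> = (\<Sum>b\<in>B k. c b * (x ^ (n - k) * (\<Sum>i<k. d b i * x ^ i))) + a n * x ^ n"
        by (simp add: sum.distrib c(2) sum_distrib_right)
      also have "(\<Sum>b\<in>B k. c b * (x ^ (n - k) * (\<Sum>i<k. d b i * x ^ i))) =
          (\<Sum>i<k. (\<Sum>b\<in>B k. c b * d b i) * x ^ (i + (n - k)))"
        by (simp add: sum_distrib_left sum_distrib_right power_add mult_ac sum.swap[of _ "B k"])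
      also have "\<dots> = (\<Sum>i\<in>{n - k..<n}. (\<Sum>b\<in>B k. c b * d b (i - (n - k))) * x ^ i)"
        by (rule sum.reindex_bij_witness[of _ "\<lambda>i. i - (n - k)" "\<lambda>i. i + (n - k)"]) (auto simp: k_def)
      also have "\<dots> = (\<Sum>i<n. (if n - k \<le> i then \<Sum>b\<in>B k. c b * d b (i - (n - k)) else 0) * x ^ i)"
        by (rule sum.mono_neutral_cong_left) auto
      finally show ?thesis
        unfolding Suc.prems(3) a'_def by (simp add: left_diff_distrib sum_subtractf)
    qed
    moreover have "\<forall>i. a' i \<in> S"
      unfolding a'_def using Suc.prems(2) c d S
      by (auto intro!: subring_diff subring_sum subring_mult subring_zero)
    moreover have "f - ?h \<in> J"
    proof -
      have "f - ?h = f + (- 1 * x ^ 0) * ?h" by simp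
      also have "\<dots> \<in> J"
        by (rule J_add[OF Suc.prems(1) J_mult[OF xS[OF subring_uminus[OF S subring_one[OF S]]] hJ]])
      finally show ?thesis .
    qed
    ultimately have "f - ?h \<in> linear_combinations ?Sx ?G" by (intro Suc.IH)
    then have "(f - ?h) + ?h \<in> linear_combinations ?Sx ?G" using hG by (rule linear_combinations_add[OF Sx])
    then show ?case by simp
  qed
  moreover have "J \<subseteq> ?Sx" using J by (simp add: ideal_of_def)
  ultimately have "J \<subseteq> linear_combinations ?Sx ?G" unfolding adjoin_element_def by blast
  then show "\<exists>B. finite B \<and> B \<subseteq> J \<and> J \<subseteq> linear_combinations ?Sx B" using finG GJ by blast
qed

lemma noetherian_consts: "noetherian_subring (polys_in {} :: ('v, 'k::field) mpoly set)"
  unfolding noetherian_subring_def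
proof (intro allI impI)
  fix L :: "('v, 'k) mpoly set" assume L: "ideal_of (polys_in {}) L"
  show "\<exists>B. finite B \<and> B \<subseteq> L \<and> L \<subseteq> linear_combinations (polys_in {}) B"
  proof (cases "L \<subseteq> {0}")
    case True
    then show ?thesis using linear_combinations_zero[OF polys_in_subring]
      by (intro exI[of _ "{}"]) auto
  next
    case False
    then obtain b where b: "b \<in> L" "b \<noteq> 0" by blast
    have "b \<in> polys_in {}" using L b unfolding ideal_of_def by blast
    then obtain c where c: "b = const c" using polys_in_empty by blast
    have "f \<in> linear_combinations (polys_in {}) {b}" if "f \<in> L" for f
    proof -
      have "c \<noteq> 0" using b(2) c by auto
      then have "f = (f * const (inverse c)) * b" by (simp add: c mult_single mult.assoc)
      moreover have "f * const (inverse c) \<in> polys_in {}"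
        using L that by (intro subring_mult[OF polys_in_subring] polys_in_single) (auto simp: ideal_of_def)
      moreover have "b \<in> linear_combinations (polys_in {}) {b}"
        by (rule linear_combinations_base[OF polys_in_subring]) auto
      ultimately show ?thesis using linear_combinations_mult[OF polys_in_subring] by metis
    qed
    then show ?thesis using b by (intro exI[of _ "{b}"]) auto
  qed
qed

lemma polys_in_insert:
  fixes T :: "'v::finite set"
  shows "(polys_in (insert v T) :: ('v, 'k::field) mpoly set) = adjoin_element (polys_in T) (var v)"
proof
  show "(polys_in (insert v T) :: ('v, 'k) mpoly set) \<subseteq> adjoin_element (polys_in T) (var v)"
  proof
    fix h :: "('v, 'k) mpoly" assume h: "h \<in> polys_in (insert v T)"
    show "h \<in> adjoin_element (polys_in T) (var v)"
    proof (cases "h = 0")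
      case True
      have "(0 :: ('v, 'k) mpoly) * var v ^ 0 \<in> adjoin_element (polys_in T) (var v)"
        by (intro adjoin_element_mult_power polys_in_subring subring_zero)
      then show ?thesis using True by simp
    next
      case False
      obtain A m where "\<And>i. A i \<in> polys_in T" "h = (\<Sum>i\<le>m. A i * var v ^ i)"
        using expand_in_variable[OF h False] by blast
      then show ?thesis unfolding adjoin_element_def lessThan_Suc_atMost[symmetric] by blast
    qed
  qed
  have sub: "f \<in> polys_in (insert v T)" if "f \<in> polys_in T" for f :: "('v, 'k) mpoly"
    using that by (auto simp: polys_in_def)
  have "var v \<in> (polys_in (insert v T) :: ('v, 'k) mpoly set)" by (simp add: var_def polys_in_single)
  then have "a i * var v ^ i \<in> polys_in (insert v T)" if "\<forall>i. a i \<in> polys_in T"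
    for a :: "nat \<Rightarrow> ('v, 'k) mpoly" and i
    using sub[OF that[rule_format]]
    by (intro subring_mult[OF polys_in_subring] subring_power[OF polys_in_subring])
  then show "adjoin_element (polys_in T) (var v) \<subseteq> (polys_in (insert v T) :: ('v, 'k) mpoly set)"
    unfolding adjoin_element_def by (blast intro: subring_sum[OF polys_in_subring])
qed

theorem noetherian_mpoly: "noetherian TYPE(('v::finite, 'k::field) mpoly)"
proof -
  have "noetherian_subring (polys_in T :: ('v, 'k) mpoly set)" for T :: "'v set"
    using finite[of T]
  proof (induction T rule: finite_induct)
    case empty
    show ?case by (rule noetherian_consts)
  next
    case (insert v T)
    then show ?case unfolding polys_in_insert
      by (intro hilbert_basis polys_in_subring) (auto simp: polys_in_subring simp flip: polys_in_insert)
  qed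
  moreover have "polys_in UNIV = (UNIV :: ('v, 'k) mpoly set)" by (simp add: polys_in_def)
  ultimately have N: "noetherian_subring (UNIV :: ('v, 'k) mpoly set)" by metis
  show ?thesis
    unfolding noetherian_def
  proof (intro allI impI)
    fix F :: "('v, 'k) mpoly set set"
    assume F: "F \<noteq> {} \<and> (\<forall>J\<in>F. is_ideal J)"
    show "\<exists>J\<in>F. \<forall>J'\<in>F. J \<subseteq> J' \<longrightarrow> J' = J"
    proof (rule subset_Zorn_nonempty)
      show "F \<noteq> {}" using F by blast
      fix \<C> assume \<C>: "\<C> \<noteq> {}" "subset.chain F \<C>"
      have id: "is_ideal J" if "J \<in> \<C>" for J using \<C>(2) F that by (auto simp: subset.chain_def)
      have dir: "\<exists>J\<in>\<C>. a \<in> J \<and> b \<in> J" if "a \<in> \<Union>\<C>" "b \<in> \<Union>\<C>" for a b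
        using \<C>(2) that unfolding subset.chain_def by blast
      have iU: "is_ideal (\<Union>\<C>)"
      proof (rule is_idealI)
        show "0 \<in> \<Union>\<C>" using \<C>(1) id ideal_zero by blast
        show "a + b \<in> \<Union>\<C>" if "a \<in> \<Union>\<C>" "b \<in> \<Union>\<C>" for a b
          using dir[OF that] id ideal_add by blast
        show "r * a \<in> \<Union>\<C>" if "a \<in> \<Union>\<C>" for r a using that id ideal_mult by blast
      qed
      then have "ideal_of UNIV (\<Union>\<C>)"
        unfolding ideal_of_def using ideal_zero ideal_add ideal_mult by blast
      then obtain B where B: "finite B" "B \<subseteq> \<Union>\<C>" "\<Union>\<C> \<subseteq> linear_combinations UNIV B"
        using N unfolding noetherian_subring_def by blast
      obtain J where J: "J \<in> \<C>" "B \<subseteq> J"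
        using finite_subset_Union_chain[OF B(1,2) \<C>] by blast
      have "\<Union>\<C> \<subseteq> J"
      proof
        fix f assume "f \<in> \<Union>\<C>"
        then obtain c where "f = (\<Sum>b\<in>B. c b * b)" using B(3) unfolding linear_combinations_def by blast
        then show "f \<in> J" using J id by (auto intro!: ideal_sum ideal_mult)
      qed
      then have "\<Union>\<C> = J" using J by blast
      then show "\<Union>\<C> \<in> F" using J \<C>(2) by (auto simp: subset.chain_def)
    qed
  qed
qed

section \<open>Rings of fractions of residue rings\<close>

text \<open>A ring \<open>L\<close> whose elements are the fractions \<open>fr a s\<close> with denominators in a multiplicative set
  \<open>D\<close>, modulo the ideal \<open>I\<close>. Residue rings (\<open>D = {1}\<close>) and their localizations at a prime ideal
  (\<open>D = - M\<close>) are both of this form; their ideals are the \<open>D\<close>-saturated ideals above \<open>I\<close>.\<close>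

locale fraction_ring =
  fixes L :: "('l, 'm) ring_scheme" and D I :: "'a::comm_ring_1 set" and fr :: "'a \<Rightarrow> 'a \<Rightarrow> 'l"
  assumes D_one: "1 \<in> D" and D_mult: "s \<in> D \<Longrightarrow> t \<in> D \<Longrightarrow> s * t \<in> D"
    and I_ideal: "is_ideal I"
    and L_carrier: "carrier L = {fr a s | a s. s \<in> D}"
    and fr_eq: "s \<in> D \<Longrightarrow> t \<in> D \<Longrightarrow> fr a s = fr b t \<longleftrightarrow> (\<exists>u\<in>D. u * (t * a - s * b) \<in> I)"
    and fr_mult: "s \<in> D \<Longrightarrow> t \<in> D \<Longrightarrow> fr a s \<otimes>\<^bsub>L\<^esub> fr b t = fr (a * b) (s * t)"
    and fr_add: "s \<in> D \<Longrightarrow> t \<in> D \<Longrightarrow> fr a s \<oplus>\<^bsub>L\<^esub> fr b t = fr (t * a + s * b) (s * t)"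
    and fr_one: "\<one>\<^bsub>L\<^esub> = fr 1 1" and fr_zero: "\<zero>\<^bsub>L\<^esub> = fr 0 1"
begin

lemma fr_carrier [simp]: "s \<in> D \<Longrightarrow> fr a s \<in> carrier L"
  by (auto simp: L_carrier)

lemma carrierE:
  assumes "x \<in> carrier L" obtains a s where "s \<in> D" "x = fr a s"
  using assms by (auto simp: L_carrier)

lemma fr_cong: "s \<in> D \<Longrightarrow> t \<in> D \<Longrightarrow> t * a = s * b \<Longrightarrow> fr a s = fr b t"
  using D_one ideal_zero[OF I_ideal] by (auto simp: fr_eq intro!: bexI[of _ 1])

lemma cring_L: "cring L"
proof (rule cringI)
  show "abelian_group L"
  proof (rule abelian_groupI)
    fix x y z assume "x \<in> carrier L" "y \<in> carrier L" "z \<in> carrier L"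
    then obtain a s b t c u where x: "s \<in> D" "x = fr a s" and y: "t \<in> D" "y = fr b t"
      and z: "u \<in> D" "z = fr c u" by (elim carrierE)
    show "x \<oplus>\<^bsub>L\<^esub> y \<in> carrier L" using x y by (simp add: fr_add D_mult)
    show "x \<oplus>\<^bsub>L\<^esub> y \<oplus>\<^bsub>L\<^esub> z = x \<oplus>\<^bsub>L\<^esub> (y \<oplus>\<^bsub>L\<^esub> z)"
      using x y z by (simp add: fr_add D_mult) (rule fr_cong, auto simp: D_mult algebra_simps)
    show "x \<oplus>\<^bsub>L\<^esub> y = y \<oplus>\<^bsub>L\<^esub> x"
      using x y by (simp add: fr_add D_mult) (rule fr_cong, auto simp: D_mult algebra_simps)
    show "\<zero>\<^bsub>L\<^esub> \<oplus>\<^bsub>L\<^esub> x = x"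
      using x by (simp add: fr_add fr_zero D_one)
    have "fr (- a) s \<oplus>\<^bsub>L\<^esub> x = \<zero>\<^bsub>L\<^esub>"
      using x by (simp add: fr_add fr_zero) (rule fr_cong, auto simp: D_mult D_one)
    then show "\<exists>y\<in>carrier L. y \<oplus>\<^bsub>L\<^esub> x = \<zero>\<^bsub>L\<^esub>" using x by (intro bexI[of _ "fr (- a) s"]) auto
  qed (auto simp: fr_zero D_one)
  show "comm_monoid L"
  proof (rule comm_monoidI)
    fix x y z assume "x \<in> carrier L" "y \<in> carrier L" "z \<in> carrier L"
    then obtain a s b t c u where x: "s \<in> D" "x = fr a s" and y: "t \<in> D" "y = fr b t"
      and z: "u \<in> D" "z = fr c u" by (elim carrierE)
    show "x \<otimes>\<^bsub>L\<^esub> y \<in> carrier L" using x y by (simp add: fr_mult D_mult)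
    show "x \<otimes>\<^bsub>L\<^esub> y \<otimes>\<^bsub>L\<^esub> z = x \<otimes>\<^bsub>L\<^esub> (y \<otimes>\<^bsub>L\<^esub> z)" using x y z by (simp add: fr_mult D_mult mult.assoc)
    show "x \<otimes>\<^bsub>L\<^esub> y = y \<otimes>\<^bsub>L\<^esub> x" using x y by (simp add: fr_mult D_mult mult.commute)
    show "\<one>\<^bsub>L\<^esub> \<otimes>\<^bsub>L\<^esub> x = x" using x by (simp add: fr_mult fr_one D_one)
  qed (auto simp: fr_one D_one)
  fix x y z assume "x \<in> carrier L" "y \<in> carrier L" "z \<in> carrier L"
  then obtain a s b t c u where x: "s \<in> D" "x = fr a s" and y: "t \<in> D" "y = fr b t"
    and z: "u \<in> D" "z = fr c u" by (elim carrierE)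
  show "(x \<oplus>\<^bsub>L\<^esub> y) \<otimes>\<^bsub>L\<^esub> z = x \<otimes>\<^bsub>L\<^esub> z \<oplus>\<^bsub>L\<^esub> y \<otimes>\<^bsub>L\<^esub> z"
    using x y z by (simp add: fr_add fr_mult D_mult) (rule fr_cong, auto simp: D_mult algebra_simps)
qed

sublocale L: cring L by (rule cring_L)

definition contraction :: "'l set \<Rightarrow> 'a set"
  where "contraction H = {a. fr a 1 \<in> H}"

definition extension :: "'a set \<Rightarrow> 'l set"
  where "extension J = {fr a s | a s. a \<in> J \<and> s \<in> D}"

definition D_saturated :: "'a set \<Rightarrow> bool"
  where "D_saturated J \<longleftrightarrow> is_ideal J \<and> I \<subseteq> J \<and> (\<forall>s\<in>D. \<forall>a. s * a \<in> J \<longrightarrow> a \<in> J)"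

lemma fr_mem_iff:
  assumes H: "ideal H L" and s: "s \<in> D"
  shows "fr a s \<in> H \<longleftrightarrow> a \<in> contraction H"
proof -
  have "fr s 1 \<otimes>\<^bsub>L\<^esub> fr a s = fr a 1"
    using s D_one by (simp add: fr_mult) (rule fr_cong, auto)
  moreover have "fr 1 s \<otimes>\<^bsub>L\<^esub> fr a 1 = fr a s"
    using s D_one by (simp add: fr_mult)
  ultimately show ?thesis
    using ideal.I_l_closed[OF H, of "fr a s" "fr s 1"] ideal.I_l_closed[OF H, of "fr a 1" "fr 1 s"] s D_one
    by (auto simp: contraction_def)
qed

lemma contraction_saturated:
  assumes H: "ideal H L"
  shows "D_saturated (contraction H)"
  unfolding D_saturated_def
proof (intro conjI ballI allI impI)
  interpret H: ideal H L by fact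
  have zero: "fr 0 1 \<in> H" using H.zero_closed by (simp add: fr_zero)
  show "is_ideal (contraction H)"
  proof (rule is_idealI)
    show "0 \<in> contraction H" using zero by (simp add: contraction_def)
    show "a + b \<in> contraction H" if "a \<in> contraction H" "b \<in> contraction H" for a b
      using that H.a_closed[of "fr a 1" "fr b 1"] D_one by (simp add: contraction_def fr_add)
    show "r * a \<in> contraction H" if "a \<in> contraction H" for r a
      using that H.I_l_closed[of "fr a 1" "fr r 1"] D_one by (simp add: contraction_def fr_mult)
  qed
  show "I \<subseteq> contraction H"
  proof
    fix a assume "a \<in> I"
    then have "fr a 1 = fr 0 1" using D_one by (auto simp: fr_eq intro!: bexI[of _ 1])
    then show "a \<in> contraction H" using zero by (simp add: contraction_def)
  qed
  fix s a assume s: "s \<in> D" and "s * a \<in> contraction H"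
  then have "fr (s * a) s \<in> H" by (simp add: fr_mem_iff[OF H])
  moreover have "fr (s * a) s = fr a 1" using s D_one by (intro fr_cong) auto
  ultimately show "a \<in> contraction H" by (simp add: contraction_def)
qed

lemma extension_contraction:
  assumes H: "ideal H L" shows "extension (contraction H) = H"
proof
  interpret H: ideal H L by fact
  show "extension (contraction H) \<subseteq> H" by (auto simp: extension_def fr_mem_iff[OF H])
  show "H \<subseteq> extension (contraction H)"
  proof
    fix x assume x: "x \<in> H"
    then obtain a s where "s \<in> D" "x = fr a s" using carrierE H.a_subset by blast
    then show "x \<in> extension (contraction H)"
      using x by (auto simp: extension_def fr_mem_iff[OF H])
  qed
qed

lemma extensionI: "a \<in> J \<Longrightarrow> s \<in> D \<Longrightarrow> fr a s \<in> extension J"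
  unfolding extension_def by blast

lemma fr_mem_extension:
  assumes J: "D_saturated J" and s: "s \<in> D"
  shows "fr a s \<in> extension J \<longleftrightarrow> a \<in> J"
proof
  have iJ: "is_ideal J" using J by (simp add: D_saturated_def)
  assume "fr a s \<in> extension J"
  then obtain b t where b: "b \<in> J" "t \<in> D" "fr a s = fr b t" by (auto simp: extension_def)
  then obtain u where u: "u \<in> D" "u * (t * a - s * b) \<in> I" using s by (auto simp: fr_eq)
  then have "u * (t * a - s * b) \<in> J" using J by (auto simp: D_saturated_def)
  then have "t * a - s * b \<in> J" using J u by (auto simp: D_saturated_def)
  then have "t * a \<in> J" using ideal_cong[OF iJ] ideal_mult[OF iJ b(1)] by blast
  then show "a \<in> J" using J b by (auto simp: D_saturated_def)
qed (rule extensionI[OF _ s])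

lemma extension_ideal:
  assumes J: "D_saturated J" shows "ideal (extension J) L"
proof (rule idealI)
  have iJ: "is_ideal J" using J by (simp add: D_saturated_def)
  show "ring L" by (rule L.ring_axioms)
  show "subgroup (extension J) (add_monoid L)"
  proof (rule group.subgroupI)
    show "group (add_monoid L)" by (rule L.a_group)
    show "extension J \<subseteq> carrier (add_monoid L)" by (auto simp: extension_def)
    show "extension J \<noteq> {}" using ideal_zero[OF iJ] D_one by (auto simp: extension_def)
    fix x y assume "x \<in> extension J" "y \<in> extension J"
    then obtain a s b t where x: "s \<in> D" "x = fr a s" "a \<in> J" and y: "t \<in> D" "y = fr b t" "b \<in> J"
      by (auto simp: extension_def)
    show "x \<otimes>\<^bsub>add_monoid L\<^esub> y \<in> extension J"
      using x y ideal_add[OF iJ ideal_mult[OF iJ] ideal_mult[OF iJ]]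
      by (simp add: fr_add extensionI D_mult)
    have "fr (- a) s \<oplus>\<^bsub>L\<^esub> x = \<zero>\<^bsub>L\<^esub>"
      using x by (simp add: fr_add fr_zero) (rule fr_cong, auto simp: D_mult D_one)
    then have "\<ominus>\<^bsub>L\<^esub> x = fr (- a) s" using x by (intro L.minus_equality) auto
    then show "inv\<^bsub>add_monoid L\<^esub> x \<in> extension J"
      using x ideal_uminus[OF iJ] by (simp add: extensionI flip: a_inv_def)
  qed
  fix x y assume "x \<in> extension J" and "y \<in> carrier L"
  then obtain a s b t where x: "s \<in> D" "x = fr a s" "a \<in> J" and y: "t \<in> D" "y = fr b t"
    by (auto simp: extension_def L_carrier)
  then show "y \<otimes>\<^bsub>L\<^esub> x \<in> extension J" "x \<otimes>\<^bsub>L\<^esub> y \<in> extension J"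
    using ideal_mult[OF iJ, of a b] ideal_mult_right[OF iJ, of a b]
    by (simp_all add: fr_mult extensionI D_mult mult.commute)
qed

lemma contraction_extension: "D_saturated J \<Longrightarrow> contraction (extension J) = J"
  by (auto simp: contraction_def fr_mem_extension D_one)

lemma contraction_mono_iff:
  "ideal H L \<Longrightarrow> ideal H' L \<Longrightarrow> contraction H \<subseteq> contraction H' \<longleftrightarrow> H \<subseteq> H'"
proof
  assume H: "ideal H L" "ideal H' L"
  show "contraction H \<subseteq> contraction H' \<Longrightarrow> H \<subseteq> H'"
  proof -
    assume "contraction H \<subseteq> contraction H'"
    then have "extension (contraction H) \<subseteq> extension (contraction H')"
      unfolding extension_def by blast
    then show "H \<subseteq> H'" by (simp only: extension_contraction H)
  qed
  show "H \<subseteq> H' \<Longrightarrow> contraction H \<subseteq> contraction H'" unfolding contraction_def by blast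
qed

lemma contraction_UNIV_iff: "ideal H L \<Longrightarrow> 1 \<in> contraction H \<longleftrightarrow> H = carrier L"
  using ideal.one_imp_carrier[of H L] L.one_closed by (auto simp: contraction_def fr_one)

lemma noetherian_ring_L:
  assumes noeth: "noetherian TYPE('a)" shows "noetherian_ring L"
proof (rule L.trivial_ideal_chain_imp_noetherian)
  fix C assume C: "C \<noteq> {}" "subset.chain {H. ideal H L} C"
  have id: "ideal H L" if "H \<in> C" for H using C(2) that by (auto simp: subset.chain_def)
  obtain H0 where "H0 \<in> C" using C(1) by blast
  then have "contraction H0 \<in> contraction ` C" by blast
  moreover have "is_ideal J" if "J \<in> contraction ` C" for J
    using that id contraction_saturated by (auto simp: D_saturated_def)
  ultimately have "\<exists>J\<in>contraction ` C. \<forall>J'\<in>contraction ` C. J \<subseteq> J' \<longrightarrow> J' = J"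
    by (rule noetherian_maximal[OF noeth])
  then obtain H where H: "H \<in> C"
    "\<And>H'. H' \<in> C \<Longrightarrow> contraction H \<subseteq> contraction H' \<Longrightarrow> contraction H' = contraction H"
    by auto
  have "H' \<subseteq> H" if "H' \<in> C" for H'
  proof -
    have "H' \<subseteq> H \<or> H \<subseteq> H'" using C(2) H(1) that by (auto simp: subset.chain_def)
    then show ?thesis
    proof
      assume "H \<subseteq> H'"
      then have "contraction H \<subseteq> contraction H'"
        using contraction_mono_iff[OF id[OF H(1)] id[OF that]] by simp
      then have "contraction H' = contraction H" by (rule H(2)[OF that])
      then have "extension (contraction H') = extension (contraction H)" by simp
      then show ?thesis
        by (simp add: extension_contraction[OF id[OF that]] extension_contraction[OF id[OF H(1)]])
    qed
  qed
  then have "\<Union>C = H" using H(1) by blast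
  then show "\<Union>C \<in> C" using H(1) by simp
qed

lemma contraction_prime:
  assumes "primeideal H L" shows "is_prime (contraction H)"
proof -
  interpret H: primeideal H L by fact
  have id: "ideal H L" by (rule H.is_ideal)
  show ?thesis
    unfolding is_prime_def
  proof (intro conjI allI impI)
    show "is_ideal (contraction H)" using contraction_saturated[OF id] by (simp add: D_saturated_def)
    show "1 \<notin> contraction H" using contraction_UNIV_iff[OF id] H.I_notcarr by auto
    fix a b assume "a * b \<in> contraction H"
    then have "fr a 1 \<otimes>\<^bsub>L\<^esub> fr b 1 \<in> H" using D_one by (simp add: contraction_def fr_mult)
    then show "a \<in> contraction H \<or> b \<in> contraction H"
      using H.I_prime[of "fr a 1" "fr b 1"] D_one by (simp add: contraction_def)
  qed
qed

lemma extension_prime: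
  assumes P: "is_prime P" "D_saturated P" shows "primeideal (extension P) L"
proof (rule primeidealI)
  show id: "ideal (extension P) L" using P by (intro extension_ideal)
  show "cring L" by (rule cring_L)
  show "carrier L \<noteq> extension P"
    using contraction_UNIV_iff[OF id] contraction_extension[OF P(2)] prime_one[OF P(1)] by auto
  fix x y assume "x \<in> carrier L" "y \<in> carrier L" and xy: "x \<otimes>\<^bsub>L\<^esub> y \<in> extension P"
  then obtain a s b t where x: "s \<in> D" "x = fr a s" and y: "t \<in> D" "y = fr b t"
    by (elim carrierE)
  then have "a * b \<in> P" using xy by (simp add: fr_mult fr_mem_extension[OF P(2)] D_mult)
  then show "x \<in> extension P \<or> y \<in> extension P"
    using prime_mult[OF P(1)] x y by (auto simp: fr_mem_extension[OF P(2)])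
qed

end

section \<open>The local ring at a prime ideal\<close>

locale local_fraction_ring = fraction_ring L "- M" I fr + local_noetherian M
  for L :: "('l, 'm) ring_scheme" and M I :: "'a::comm_ring_1 set" and fr +
  assumes I_subset: "I \<subseteq> M"
begin

lemma D_saturated_iff: "D_saturated J \<longleftrightarrow> sat J \<and> I \<subseteq> J"
  by (auto simp: D_saturated_def saturated_def)

lemma sat_subset_M: "sat J \<Longrightarrow> 1 \<notin> J \<Longrightarrow> J \<subseteq> M"
  using satD[of J _ 1] by auto

lemma sat_prime: "is_prime P \<Longrightarrow> P \<subseteq> M \<Longrightarrow> sat P"
  by (auto simp: saturated_def prime_is_ideal dest: prime_mult)

lemma sat_M: "D_saturated M"
  using sat_prime[OF prime_M] I_subset by (simp add: D_saturated_iff)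

lemma extension_M_ideal: "ideal (extension M) L" by (rule extension_ideal[OF sat_M])

lemma proper_ideal_subset:
  assumes H: "ideal H L" "H \<noteq> carrier L" shows "H \<subseteq> extension M"
proof -
  have "contraction H \<subseteq> M"
    using contraction_saturated[OF H(1)] contraction_UNIV_iff[OF H(1)] H(2)
    by (intro sat_subset_M) (auto simp: D_saturated_iff)
  then show ?thesis
    using contraction_mono_iff[OF H(1) extension_M_ideal] contraction_extension[OF sat_M] by simp
qed

lemma extension_M_proper: "extension M \<noteq> carrier L"
  using contraction_UNIV_iff[OF extension_M_ideal] contraction_extension[OF sat_M] prime_one[OF prime_M]
  by auto

lemma maximalideal_iff: "maximalideal H L \<longleftrightarrow> H = extension M"
proof
  assume "maximalideal H L"
  then interpret H: maximalideal H L .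
  have "H \<subseteq> extension M" using proper_ideal_subset[OF H.is_ideal] H.I_notcarr by blast
  then show "H = extension M"
    using H.I_maximal[OF extension_M_ideal] extension_M_proper ideal.Icarr[OF extension_M_ideal] by blast
next
  assume "H = extension M"
  then show "maximalideal H L"
    using extension_M_ideal extension_M_proper proper_ideal_subset by (intro maximalidealI) auto
qed

lemma chain_mono:
  assumes "prime_chain Ps k" "i \<le> j" "j \<le> k" shows "Ps i \<subseteq> Ps j"
  using assms(2,3)
proof (induction j rule: dec_induct)
  case (step n)
  then have "Ps n \<subset> Ps (Suc n)" using assms(1) by (simp add: prime_chain_def)
  then show ?case using step by auto
qed simp

lemma krull_dim_eq:
  "krull_dim L = Sup {enat k | k. \<exists>Ps. prime_chain Ps k \<and> I \<subseteq> Ps 0 \<and> Ps k \<subseteq> M}"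
proof -
  have "(\<exists>P. (\<forall>i\<le>k. primeideal (P i) L) \<and> (\<forall>i<k. P i \<subset> P (Suc i))) \<longleftrightarrow>
      (\<exists>Ps. prime_chain Ps k \<and> I \<subseteq> Ps 0 \<and> Ps k \<subseteq> M)" for k
  proof
    assume "\<exists>P. (\<forall>i\<le>k. primeideal (P i) L) \<and> (\<forall>i<k. P i \<subset> P (Suc i))"
    then obtain P where P: "\<And>i. i \<le> k \<Longrightarrow> primeideal (P i) L" "\<And>i. i < k \<Longrightarrow> P i \<subset> P (Suc i)" by blast
    have id: "ideal (P i) L" if "i \<le> k" for i using P(1)[OF that] by (rule primeideal.axioms(1))
    have "contraction (P i) \<subset> contraction (P (Suc i))" if "i < k" for i
    proof -
      have i: "ideal (P i) L" "ideal (P (Suc i)) L" using id that by auto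
      show ?thesis
        using P(2)[OF that] contraction_mono_iff[OF i] contraction_mono_iff[OF i(2,1)] by blast
    qed
    then have "prime_chain (\<lambda>i. contraction (P i)) k"
      using P(1) contraction_prime by (auto simp: prime_chain_def)
    moreover have "I \<subseteq> contraction (P 0)" using contraction_saturated[OF id[of 0]] by (simp add: D_saturated_def)
    moreover have "contraction (P k) \<subseteq> M"
      using contraction_saturated[OF id[of k]] prime_one[OF contraction_prime[OF P(1)[of k]]]
      by (intro sat_subset_M) (auto simp: D_saturated_iff)
    ultimately show "\<exists>Ps. prime_chain Ps k \<and> I \<subseteq> Ps 0 \<and> Ps k \<subseteq> M" by blast
  next
    assume "\<exists>Ps. prime_chain Ps k \<and> I \<subseteq> Ps 0 \<and> Ps k \<subseteq> M"
    then obtain Ps where Ps: "prime_chain Ps k" "I \<subseteq> Ps 0" "Ps k \<subseteq> M" by blast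
    have D: "is_prime (Ps i)" "D_saturated (Ps i)" if "i \<le> k" for i
    proof -
      show p: "is_prime (Ps i)" using Ps(1) that by (simp add: prime_chain_def)
      have "Ps 0 \<subseteq> Ps i" "Ps i \<subseteq> Ps k" using chain_mono[OF Ps(1)] that by auto
      then show "D_saturated (Ps i)" using Ps sat_prime[OF p] by (auto simp: D_saturated_iff)
    qed
    have "extension (Ps i) \<subset> extension (Ps (Suc i))" if "i < k" for i
    proof -
      have "Ps i \<subset> Ps (Suc i)" using Ps(1) that by (simp add: prime_chain_def)
      then show ?thesis
        using contraction_extension D(2)[of i] D(2)[of "Suc i"] that
        by (metis Suc_leI contraction_mono_iff extension_ideal less_imp_le psubset_eq)
    qed
    then show "\<exists>P. (\<forall>i\<le>k. primeideal (P i) L) \<and> (\<forall>i<k. P i \<subset> P (Suc i))"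
      using extension_prime D by (intro exI[of _ "\<lambda>i. extension (Ps i)"]) auto
  qed
  then show ?thesis unfolding krull_dim_def by simp
qed

lemma regular_iff_nth:
  "regular J xs \<longleftrightarrow> (\<forall>i<length xs. nonzerodivisor_mod (xs ! i) (foldl quot J (take i xs)))"
proof (induction xs arbitrary: J)
  case (Cons x xs)
  then show ?case by (auto simp: less_Suc_eq_0_disj)
qed simp

text \<open>Under the correspondence of ideals, adjoining a fraction to an ideal of \<open>L\<close> is adjoining its
  numerator followed by saturation, because denominators are units.\<close>

lemma contraction_genideal_insert:
  assumes Z: "Z \<subseteq> carrier L" and s: "s \<notin> M"
  shows "contraction (Idl\<^bsub>L\<^esub> (insert (fr a s) Z)) = quot (contraction (Idl\<^bsub>L\<^esub> Z)) a"
proof -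
  let ?Z = "insert (fr a s) Z"
  have Z': "?Z \<subseteq> carrier L" using Z s by simp
  have idZ: "ideal (Idl\<^bsub>L\<^esub> Z) L" and idZ': "ideal (Idl\<^bsub>L\<^esub> ?Z) L"
    using L.genideal_ideal Z Z' by blast+
  have dZ: "D_saturated (contraction (Idl\<^bsub>L\<^esub> Z))" and dZ': "D_saturated (contraction (Idl\<^bsub>L\<^esub> ?Z))"
    using contraction_saturated idZ idZ' by blast+
  show ?thesis
  proof
    have q: "D_saturated (quot (contraction (Idl\<^bsub>L\<^esub> Z)) a)"
      using dZ sat_quot quot_superset by (fastforce simp: D_saturated_iff)
    have "?Z \<subseteq> extension (quot (contraction (Idl\<^bsub>L\<^esub> Z)) a)"
    proof
      fix z assume "z \<in> ?Z"
      then consider "z = fr a s" | "z \<in> Z" by blast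
      then show "z \<in> extension (quot (contraction (Idl\<^bsub>L\<^esub> Z)) a)"
      proof cases
        case 1
        then show ?thesis using fr_mem_extension[OF q] s quot_self dZ by (simp add: D_saturated_iff)
      next
        case 2
        then have "z \<in> Idl\<^bsub>L\<^esub> Z" using L.genideal_self[OF Z] by blast
        then have "z \<in> extension (contraction (Idl\<^bsub>L\<^esub> Z))" using extension_contraction[OF idZ] by simp
        then show ?thesis using quot_superset by (fastforce simp: extension_def)
      qed
    qed
    then have "Idl\<^bsub>L\<^esub> ?Z \<subseteq> extension (quot (contraction (Idl\<^bsub>L\<^esub> Z)) a)"
      by (rule L.genideal_minimal[OF extension_ideal[OF q]])
    then show "contraction (Idl\<^bsub>L\<^esub> ?Z) \<subseteq> quot (contraction (Idl\<^bsub>L\<^esub> Z)) a"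
      using contraction_mono_iff[OF idZ' extension_ideal[OF q]] contraction_extension[OF q] by simp
    show "quot (contraction (Idl\<^bsub>L\<^esub> Z)) a \<subseteq> contraction (Idl\<^bsub>L\<^esub> ?Z)"
    proof (rule quot_least)
      show "sat (contraction (Idl\<^bsub>L\<^esub> ?Z))" using dZ' by (simp add: D_saturated_iff)
      have "Idl\<^bsub>L\<^esub> Z \<subseteq> Idl\<^bsub>L\<^esub> ?Z"
        by (rule L.genideal_minimal[OF idZ']) (use L.genideal_self[OF Z'] in blast)
      then show "contraction (Idl\<^bsub>L\<^esub> Z) \<subseteq> contraction (Idl\<^bsub>L\<^esub> ?Z)"
        using contraction_mono_iff[OF idZ idZ'] by simp
      have "fr a s \<in> Idl\<^bsub>L\<^esub> ?Z" using L.genideal_self[OF Z'] by blast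
      then show "a \<in> contraction (Idl\<^bsub>L\<^esub> ?Z)" using fr_mem_iff[OF idZ'] s by simp
    qed
  qed
qed

lemma contraction_genideal_empty: "contraction (Idl\<^bsub>L\<^esub> {}) = saturation M I"
proof
  have id: "ideal (Idl\<^bsub>L\<^esub> {}) L" by (rule L.genideal_ideal) simp
  have d: "D_saturated (saturation M I)"
    using sat_saturation[OF I_ideal] saturation_superset by (simp add: D_saturated_iff)
  have "Idl\<^bsub>L\<^esub> {} \<subseteq> extension (saturation M I)" by (rule L.genideal_minimal[OF extension_ideal[OF d]]) simp
  then show "contraction (Idl\<^bsub>L\<^esub> {}) \<subseteq> saturation M I"
    using contraction_mono_iff[OF id extension_ideal[OF d]] contraction_extension[OF d] by simp
  show "saturation M I \<subseteq> contraction (Idl\<^bsub>L\<^esub> {})"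
    using contraction_saturated[OF id] by (intro saturation_least) (auto simp: D_saturated_iff)
qed

lemma fractions_in_carrier:
  "list_all2 (\<lambda>x a. \<exists>s. s \<notin> M \<and> x = fr a s) xs as \<Longrightarrow> set xs \<subseteq> carrier L"
  by (induction rule: list_all2_induct) auto

lemma fractions_in_extension:
  "list_all2 (\<lambda>x a. \<exists>s. s \<notin> M \<and> x = fr a s) xs as \<Longrightarrow> set as \<subseteq> M \<Longrightarrow> set xs \<subseteq> extension M"
  by (induction rule: list_all2_induct) (auto intro: extensionI)

lemma contraction_genideal:
  assumes "list_all2 (\<lambda>x a. \<exists>s. s \<notin> M \<and> x = fr a s) xs as"
  shows "contraction (Idl\<^bsub>L\<^esub> (set xs)) = foldl quot (saturation M I) as"
  using assms
proof (induction xs arbitrary: as rule: rev_induct)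
  case Nil
  then show ?case by (simp add: contraction_genideal_empty)
next
  case (snoc x xs)
  then obtain bs b s where as: "as = bs @ [b]" "list_all2 (\<lambda>x a. \<exists>s. s \<notin> M \<and> x = fr a s) xs bs"
    "s \<notin> M" "x = fr b s" by (auto simp: list_all2_append1 list_all2_Cons1)
  have "set xs \<subseteq> carrier L" by (rule fractions_in_carrier[OF as(2)])
  then show ?case using contraction_genideal_insert[of "set xs" s b] snoc.IH[OF as(2)] as by simp
qed

text \<open>Denominators are units, so regularity in \<open>L\<close> depends only on the numerators.\<close>

lemma regular_sequence_iff:
  assumes *: "list_all2 (\<lambda>x a. \<exists>s. s \<notin> M \<and> x = fr a s) xs as" and M: "set as \<subseteq> M"
  shows "regular_sequence L xs \<longleftrightarrow> regular (saturation M I) as"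
proof -
  have len: "length xs = length as" using * by (rule list_all2_lengthD)
  have xs: "set xs \<subseteq> carrier L" by (rule fractions_in_carrier[OF *])
  have step: "(\<forall>b\<in>carrier L. (xs ! i) \<otimes>\<^bsub>L\<^esub> b \<in> Idl\<^bsub>L\<^esub> (set (take i xs)) \<longrightarrow> b \<in> Idl\<^bsub>L\<^esub> (set (take i xs))) \<longleftrightarrow>
      nonzerodivisor_mod (as ! i) (foldl quot (saturation M I) (take i as))" if i: "i < length xs" for i
  proof -
    let ?K = "Idl\<^bsub>L\<^esub> (set (take i xs))"
    have id: "ideal ?K L" by (rule L.genideal_ideal) (use xs set_take_subset in fast)
    have con: "contraction ?K = foldl quot (saturation M I) (take i as)"
      using * by (intro contraction_genideal list_all2_takeI)
    obtain s where s: "s \<notin> M" "xs ! i = fr (as ! i) s" using * i by (auto simp: list_all2_conv_all_nth)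
    have "(\<forall>b\<in>carrier L. (xs ! i) \<otimes>\<^bsub>L\<^esub> b \<in> ?K \<longrightarrow> b \<in> ?K) \<longleftrightarrow>
        (\<forall>c t. t \<notin> M \<longrightarrow> fr (as ! i) s \<otimes>\<^bsub>L\<^esub> fr c t \<in> ?K \<longrightarrow> fr c t \<in> ?K)"
      unfolding s(2) by (auto simp: L_carrier)
    also have "\<dots> \<longleftrightarrow> (\<forall>c t. t \<notin> M \<longrightarrow> as ! i * c \<in> contraction ?K \<longrightarrow> c \<in> contraction ?K)"
      using s(1) by (simp add: fr_mult fr_mem_iff[OF id] M_mult)
    also have "\<dots> \<longleftrightarrow> nonzerodivisor_mod (as ! i) (contraction ?K)"
      using prime_one[OF prime_M] by (auto simp: nonzerodivisor_mod_def)
    finally show ?thesis by (simp add: con)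
  qed
  have "set xs \<subseteq> extension M"
    by (rule fractions_in_extension[OF * M])
  then have "Idl\<^bsub>L\<^esub> (set xs) \<subseteq> extension M" by (rule L.genideal_minimal[OF extension_M_ideal])
  then have "Idl\<^bsub>L\<^esub> (set xs) \<noteq> carrier L"
    using extension_M_proper ideal.Icarr[OF extension_M_ideal] by blast
  then show ?thesis
    unfolding regular_sequence_def regular_iff_nth using xs step len by simp
qed

lemma depth_eq:
  "depth L (extension M) = Sup {enat (length as) | as. set as \<subseteq> M \<and> regular (saturation M I) as}"
proof -
  have "{enat (length xs) | xs. regular_sequence L xs \<and> set xs \<subseteq> extension M} =
      {enat (length as) | as. set as \<subseteq> M \<and> regular (saturation M I) as}"
  proof (intro equalityI subsetI; clarsimp)
    fix xs assume xs: "regular_sequence L xs" "set xs \<subseteq> extension M"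
    have "\<exists>as. list_all2 (\<lambda>x a. \<exists>s. s \<notin> M \<and> x = fr a s) xs as \<and> set as \<subseteq> M"
      using xs(2)
    proof (induction xs)
      case (Cons x xs)
      then obtain as a s where "list_all2 (\<lambda>x a. \<exists>s. s \<notin> M \<and> x = fr a s) xs as" "set as \<subseteq> M"
        "a \<in> M" "s \<notin> M" "x = fr a s" by (auto simp: extension_def)
      then show ?case by (intro exI[of _ "a # as"]) auto
    qed simp
    then obtain as where as: "list_all2 (\<lambda>x a. \<exists>s. s \<notin> M \<and> x = fr a s) xs as" "set as \<subseteq> M" by blast
    then show "\<exists>as. length xs = length as \<and> set as \<subseteq> M \<and> regular (saturation M I) as"
      using regular_sequence_iff[OF as] xs(1) list_all2_lengthD[OF as(1)] by blast
  next
    fix as assume as: "set as \<subseteq> M" "regular (saturation M I) as"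
    have l: "list_all2 (\<lambda>x a. \<exists>s. s \<notin> M \<and> x = fr a s) (map (\<lambda>a. fr a 1) as) as"
      using prime_one[OF prime_M] by (auto simp: list_all2_conv_all_nth)
    show "\<exists>xs. length as = length xs \<and> regular_sequence L xs \<and> set xs \<subseteq> extension M"
      using regular_sequence_iff[OF l as(1)] as prime_one[OF prime_M]
      by (intro exI[of _ "map (\<lambda>a. fr a 1) as"]) (auto simp: extension_def)
  qed
  then show ?thesis unfolding depth_def by simp
qed

end

text \<open>Depth and Krull dimension of the localization of the residue ring of \<open>I\<close> at \<open>M\<close>, expressed in
  the ring itself.\<close>

definition local_cohen_macaulay :: "'a::comm_ring_1 set \<Rightarrow> 'a set \<Rightarrow> bool"
  where "local_cohen_macaulay I M \<longleftrightarrow>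
    Sup {enat (length as) | as. set as \<subseteq> M \<and> local_noetherian.regular M (saturation M I) as} =
    Sup {enat k | k. \<exists>Ps. prime_chain Ps k \<and> I \<subseteq> Ps 0 \<and> Ps k \<subseteq> M}"

lemma (in local_fraction_ring) cohen_macaulay_local_iff:
  "cohen_macaulay_local L \<longleftrightarrow> local_cohen_macaulay I M"
  unfolding cohen_macaulay_local_def local_cohen_macaulay_def maximalideal_iff
  using cring_L noetherian_ring_L[OF noeth] by (simp add: depth_eq krull_dim_eq)

section \<open>Localizations of residue rings\<close>

lemma ring_of_type_algebra_simps: 
  fixes R :: "'a::comm_ring_1 ring"
  defines "R \<equiv> ring_of_type_algebra"
  shows "carrier R = UNIV" "x \<otimes>\<^bsub>R\<^esub> y = x * y" "x \<oplus>\<^bsub>R\<^esub> y = x + y" "\<one>\<^bsub>R\<^esub> = 1" "\<zero>\<^bsub>R\<^esub> = 0"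
  by (simp_all add: R_def ring_of_type_algebra_def)

lemma ideal_ring_of_type_algebra_iff:
  fixes J :: "'a::comm_ring_1 set"
  shows "ideal J ring_of_type_algebra \<longleftrightarrow> is_ideal J"
proof
  let ?R = "ring_of_type_algebra :: 'a ring"
  assume "ideal J ?R"
  then interpret ideal J ?R .
  have s: "additive_subgroup J ?R" by (rule is_additive_subgroup)
  show "is_ideal J"
    using additive_subgroup.zero_closed[OF s] additive_subgroup.a_closed[OF s] I_l_closed
    by (intro is_idealI) (auto simp: ring_of_type_algebra_simps)
next
  let ?R = "ring_of_type_algebra :: 'a ring"
  assume J: "is_ideal J"
  interpret R: ring ?R by (rule ring_from_type_algebra)
  show "ideal J ?R"
  proof (rule idealI[OF ring_from_type_algebra])
    show "subgroup J (add_monoid ?R)"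
    proof (rule group.subgroupI[OF R.a_group])
      show "J \<subseteq> carrier (add_monoid ?R)" by (simp add: ring_of_type_algebra_simps)
      show "J \<noteq> {}" using ideal_zero[OF J] by blast
      fix a assume a: "a \<in> J"
      have "\<ominus>\<^bsub>?R\<^esub> a = - a" by (rule R.minus_equality) (auto simp: ring_of_type_algebra_simps)
      then show "inv\<^bsub>add_monoid ?R\<^esub> a \<in> J" using ideal_uminus[OF J a] by (simp add: a_inv_def)
    qed (use ideal_add[OF J] in \<open>simp add: ring_of_type_algebra_simps\<close>)
  qed (use ideal_mult[OF J] ideal_mult_right[OF J] in \<open>auto simp: ring_of_type_algebra_simps\<close>)
qed

locale residue_ring_of_type =
  fixes I :: "'a::comm_ring_1 set"
  assumes I: "is_ideal I"
begin

abbreviation R :: "'a ring" where "R \<equiv> ring_of_type_algebra"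

abbreviation A :: "'a set ring" where "A \<equiv> R Quot I"

abbreviation q :: "'a \<Rightarrow> 'a set" where "q a \<equiv> I +>\<^bsub>R\<^esub> a"

lemmas R_simps = ring_of_type_algebra_simps
lemmas ideal_R_iff = ideal_ring_of_type_algebra_iff

sublocale ideal I R using I by (simp add: ideal_R_iff)

lemma q_eq_iff: "q a = q b \<longleftrightarrow> a - b \<in> I"
proof -
  have q: "q a = {h + a | h. h \<in> I}" for a by (auto simp: a_r_coset_def' R_simps)
  show ?thesis
  proof
    assume "q a = q b"
    moreover have "0 + a \<in> q a" using ideal_zero[OF I] unfolding q by blast
    ultimately obtain h where "h \<in> I" "a = h + b" unfolding q by auto
    then show "a - b \<in> I" by simp
  next
    assume ab: "a - b \<in> I"
    show "q a = q b"
      unfolding q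
    proof (intro equalityI subsetI; clarsimp)
      fix h assume "h \<in> I"
      then show "\<exists>h'. h + a = h' + b \<and> h' \<in> I"
        using ideal_add[OF I _ ab] by (intro exI[of _ "h + (a - b)"]) auto
      show "\<exists>h'. h + b = h' + a \<and> h' \<in> I"
        using ideal_diff[OF I \<open>h \<in> I\<close> ab] by (intro exI[of _ "h - (a - b)"]) auto
    qed
  qed
qed

lemma A_simps:
  "carrier A = range q" "q a \<otimes>\<^bsub>A\<^esub> q b = q (a * b)" "q a \<oplus>\<^bsub>A\<^esub> q b = q (a + b)"
  "\<one>\<^bsub>A\<^esub> = q 1" "\<zero>\<^bsub>A\<^esub> = q 0"
proof -
  show "carrier A = range q" 
  proof -
    have "carrier A = q ` carrier R"
      by (auto simp: FactRing_def A_RCOSETS_def RCOSETS_def a_r_coset_def)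
    then show ?thesis by (simp only: R_simps(1))
  qed
  show "q a \<otimes>\<^bsub>A\<^esub> q b = q (a * b)" using rcoset_mult_add[of a b] by (simp add: FactRing_def R_simps)
  show "q a \<oplus>\<^bsub>A\<^esub> q b = q (a + b)" using a_rcos_sum[of a b] by (simp add: FactRing_def R_simps)
  show "\<one>\<^bsub>A\<^esub> = q 1" by (simp add: FactRing_def R_simps)
  show "\<zero>\<^bsub>A\<^esub> = q 0" by (auto simp: FactRing_def a_r_coset_def' R_simps)
qed

sublocale A: fraction_ring A "{1}" I "\<lambda>a s. q a"
  by unfold_locales (auto simp: A_simps q_eq_iff I)

lemma A_D_saturated_iff: "A.D_saturated J \<longleftrightarrow> is_ideal J \<and> I \<subseteq> J"
  by (auto simp: A.D_saturated_def)

lemma contraction_maximal: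
  assumes "maximalideal H A" shows "is_maximal (A.contraction H)" "I \<subseteq> A.contraction H"
proof -
  interpret H: maximalideal H A by fact
  have id: "ideal H A" by (rule H.is_ideal)
  let ?M = "A.contraction H"
  have M: "is_ideal ?M" "I \<subseteq> ?M" using A.contraction_saturated[OF id] by (auto simp: A_D_saturated_iff)
  have inv: "\<exists>y. x * y - 1 \<in> ?M" if x: "x \<notin> ?M" for x
  proof -
    have d: "A.D_saturated (adjoin ?M x)"
      using M ideal_adjoin adjoin_superset by (fastforce simp: A_D_saturated_iff)
    let ?H = "A.extension (adjoin ?M x)"
    have id': "ideal ?H A" by (rule A.extension_ideal[OF d])
    have con: "A.contraction ?H = adjoin ?M x" by (rule A.contraction_extension[OF d])
    have "H \<subseteq> ?H" using A.contraction_mono_iff[OF id id'] con adjoin_superset by metis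
    moreover have "?H \<noteq> H" using con x adjoin_self[OF M(1)] by metis
    ultimately have "?H = carrier A" using H.I_maximal[OF id'] ideal.Icarr[OF id'] by blast
    then have "1 \<in> adjoin ?M x" using A.contraction_UNIV_iff[OF id'] con by simp
    then obtain m y where "m \<in> ?M" "1 = m + y * x" unfolding adjoin_def by blast
    then have "x * y - 1 = - m" "- m \<in> ?M" using ideal_uminus[OF M(1)] by (auto simp: algebra_simps)
    then show ?thesis by metis
  qed
  have "1 \<notin> ?M" using A.contraction_UNIV_iff[OF id] H.I_notcarr by auto
  moreover have "b \<in> ?M" if ab: "a * b \<in> ?M" "a \<notin> ?M" for a b
  proof -
    obtain y where y: "a * y - 1 \<in> ?M" using inv[OF ab(2)] by blast
    have "b = y * (a * b) - b * (a * y - 1)" by (simp add: algebra_simps)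
    also have "\<dots> \<in> ?M"
      by (rule ideal_diff[OF M(1) ideal_mult[OF M(1) ab(1)] ideal_mult[OF M(1) y]])
    finally show ?thesis .
  qed
  ultimately show "is_maximal ?M" using M inv by (auto simp: is_maximal_def is_prime_def)
  show "I \<subseteq> ?M" by (rule M)
qed

lemma extension_maximal:
  assumes M: "is_maximal M" "I \<subseteq> M"
  shows "maximalideal (A.extension M) A" "A.contraction (A.extension M) = M"
proof -
  have pM: "is_prime M" using M by (simp add: is_maximal_def)
  have d: "A.D_saturated M" using M prime_is_ideal[OF pM] by (simp add: A_D_saturated_iff)
  have id: "ideal (A.extension M) A" by (rule A.extension_ideal[OF d])
  show con: "A.contraction (A.extension M) = M" by (rule A.contraction_extension[OF d])
  show "maximalideal (A.extension M) A"
  proof (rule maximalidealI[OF id])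
    show "carrier A \<noteq> A.extension M" using A.contraction_UNIV_iff[OF id] con prime_one[OF pM] by auto
    fix J assume J: "ideal J A" "A.extension M \<subseteq> J" "J \<subseteq> carrier A"
    have MJ: "M \<subseteq> A.contraction J" using A.contraction_mono_iff[OF id J(1)] J(2) con by simp
    have iJ: "is_ideal (A.contraction J)" using A.contraction_saturated[OF J(1)] by (simp add: A_D_saturated_iff)
    show "J = A.extension M \<or> J = carrier A"
    proof (cases "A.contraction J \<subseteq> M")
      case True
      then show ?thesis using MJ A.extension_contraction[OF J(1)] by auto
    next
      case False
      then obtain x where x: "x \<in> A.contraction J" "x \<notin> M" by blast
      then obtain y where "x * y - 1 \<in> M" using M by (auto simp: is_maximal_def)
      then have "1 \<in> A.contraction J"
        using ideal_cong[OF iJ] ideal_mult_right[OF iJ x(1)] MJ by blast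
      then show ?thesis using A.contraction_UNIV_iff[OF J(1)] by simp
    qed
  qed
qed

lemma UN_eq_const: "B \<noteq> {} \<Longrightarrow> (\<And>x. x \<in> B \<Longrightarrow> F x = C) \<Longrightarrow> (\<Union>x\<in>B. F x) = C"
  by auto

text \<open>Fractions of residue classes modulo \<open>I\<close> are equal exactly if the usual relation holds for
  representatives, up to \<open>I\<close>. The operations, which are unions over all representatives, are
  computed by choosing one.\<close>

lemma localization_fraction_ring:
  assumes M: "is_prime M" "I \<subseteq> M"
  defines "S \<equiv> carrier A - A.extension M"
  shows "fraction_ring (localization A S) (- M) I (\<lambda>a s. fraction A S (q a) (q s))"
proof -
  have iM: "is_ideal M" by (rule prime_is_ideal[OF M(1)])
  have d: "A.D_saturated M" using M iM by (simp add: A_D_saturated_iff)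
  have qS: "q s \<in> S \<longleftrightarrow> s \<notin> M" for s
    using A.fr_mem_extension[OF d, of 1 s] by (auto simp: S_def A_simps)
  have SE: "\<exists>s. x = q s \<and> s \<notin> M" if "x \<in> S" for x
    using that qS by (auto simp: S_def A_simps)
  have mult: "s * t \<notin> M" if "s \<notin> M" "t \<notin> M" for s t using prime_mult_notin[OF M(1) that] .
  have one: "1 \<notin> M" by (rule prime_one[OF M(1)])
  define rel where "rel a s b t \<longleftrightarrow> (\<exists>u. u \<notin> M \<and> u * (t * a - s * b) \<in> I)" for a s b t
  have frac_rel_iff: "((q a, q s), (q b, q t)) \<in> frac_rel A S \<longleftrightarrow> s \<notin> M \<and> t \<notin> M \<and> rel a s b t" for a s b t
  proof -
    have "(\<exists>u\<in>S. u \<otimes>\<^bsub>A\<^esub> (q t \<otimes>\<^bsub>A\<^esub> q a) = u \<otimes>\<^bsub>A\<^esub> (q s \<otimes>\<^bsub>A\<^esub> q b)) \<longleftrightarrow> rel a s b t"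
    proof
      assume "\<exists>u\<in>S. u \<otimes>\<^bsub>A\<^esub> (q t \<otimes>\<^bsub>A\<^esub> q a) = u \<otimes>\<^bsub>A\<^esub> (q s \<otimes>\<^bsub>A\<^esub> q b)"
      then obtain u where "u \<notin> M" "q u \<otimes>\<^bsub>A\<^esub> (q t \<otimes>\<^bsub>A\<^esub> q a) = q u \<otimes>\<^bsub>A\<^esub> (q s \<otimes>\<^bsub>A\<^esub> q b)"
        using SE by metis
      then show "rel a s b t" unfolding rel_def
        by (intro exI[of _ u]) (simp add: A_simps q_eq_iff right_diff_distrib)
    next
      assume "rel a s b t"
      then obtain u where "u \<notin> M" "u * (t * a - s * b) \<in> I" unfolding rel_def by blast
      then show "\<exists>u\<in>S. u \<otimes>\<^bsub>A\<^esub> (q t \<otimes>\<^bsub>A\<^esub> q a) = u \<otimes>\<^bsub>A\<^esub> (q s \<otimes>\<^bsub>A\<^esub> q b)"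
        by (intro bexI[of _ "q u"]) (simp_all add: A_simps q_eq_iff right_diff_distrib qS)
    qed
    then show ?thesis by (auto simp: frac_rel_def qS A_simps)
  qed
  have frac_rel_E: "\<exists>b t. y = (q b, q t) \<and> t \<notin> M" if y: "(x, y) \<in> frac_rel A S" for x y
  proof -
    obtain y1 y2 where "y = (y1, y2)" "y1 \<in> carrier A" "y2 \<in> S"
      using y unfolding frac_rel_def by blast
    moreover obtain t where "y2 = q t" "t \<notin> M" using SE[OF calculation(3)] by blast
    ultimately show ?thesis by (auto simp: A_simps)
  qed
  let ?fr = "\<lambda>a s. fraction A S (q a) (q s)"
  have mem: "(q b, q t) \<in> ?fr a s \<longleftrightarrow> t \<notin> M \<and> rel a s b t" if "s \<notin> M" for a s b t
    using that by (simp add: fraction_def frac_rel_iff)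
  have memE: "\<exists>b t. y = (q b, q t) \<and> t \<notin> M \<and> rel a s b t" if "s \<notin> M" "y \<in> ?fr a s" for y a s
  proof -
    obtain b t where "y = (q b, q t)" "t \<notin> M"
      using frac_rel_E[of "(q a, q s)" y] \<open>y \<in> ?fr a s\<close> by (auto simp: fraction_def)
    then show ?thesis using mem[OF \<open>s \<notin> M\<close>] \<open>y \<in> ?fr a s\<close> by blast
  qed
  have rel_refl: "rel a s a s" for a s
    unfolding rel_def using one ideal_zero[OF I] by (intro exI[of _ 1]) simp
  have rel_sym: "rel b t a s" if "rel a s b t" for a s b t
  proof -
    obtain u where u: "u \<notin> M" "u * (t * a - s * b) \<in> I" using \<open>rel a s b t\<close> unfolding rel_def by blast
    have "u * (s * b - t * a) = - (u * (t * a - s * b))" by (simp add: algebra_simps)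
    then have "u * (s * b - t * a) \<in> I" using ideal_uminus[OF I u(2)] by simp
    then show ?thesis using u(1) unfolding rel_def by blast
  qed
  have rel_trans: "rel a s c w" if ab: "rel a s b t" and bc: "rel b t c w" and t: "t \<notin> M" for a s b t c w
  proof -
    obtain u v where u: "u \<notin> M" "u * (t * a - s * b) \<in> I" and v: "v \<notin> M" "v * (w * b - t * c) \<in> I"
      using ab bc unfolding rel_def by blast
    have "(u * v * t) * (w * a - s * c) =
        (v * w) * (u * (t * a - s * b)) + (u * s) * (v * (w * b - t * c))" by (simp add: algebra_simps)
    also have "\<dots> \<in> I" by (rule ideal_add[OF I ideal_mult[OF I u(2)] ideal_mult[OF I v(2)]])
    finally show ?thesis unfolding rel_def using mult u v t by blast
  qed
  have eq: "?fr a s = ?fr b t \<longleftrightarrow> rel a s b t" if s: "s \<notin> M" and t: "t \<notin> M" for a s b t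
  proof
    assume "?fr a s = ?fr b t"
    then have "(q b, q t) \<in> ?fr a s" using mem[OF t] t rel_refl by blast
    then show "rel a s b t" using mem[OF s] by blast
  next
    assume ab: "rel a s b t"
    have sub: "?fr a s \<subseteq> ?fr b t" if "s \<notin> M" "t \<notin> M" "rel a s b t" for a s b t
    proof
      fix y assume "y \<in> ?fr a s"
      then obtain c w where "y = (q c, q w)" "w \<notin> M" "rel a s c w" using memE \<open>s \<notin> M\<close> by blast
      then show "y \<in> ?fr b t"
        using mem[OF \<open>t \<notin> M\<close>] rel_trans[OF rel_sym[OF \<open>rel a s b t\<close>] _ \<open>s \<notin> M\<close>] by blast
    qed
    show "?fr a s = ?fr b t" using sub[OF s t ab] sub[OF t s rel_sym[OF ab]] by blast
  qed
  show ?thesis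
  proof
    show "1 \<in> - M" using one by simp
    show "s * t \<in> - M" if "s \<in> - M" "t \<in> - M" for s t using mult that by simp
    show "is_ideal I" by (rule I)
    show "\<one>\<^bsub>localization A S\<^esub> = ?fr 1 1" "\<zero>\<^bsub>localization A S\<^esub> = ?fr 0 1"
      by (simp_all add: localization_def A_simps)
    show "carrier (localization A S) = {?fr a s | a s. s \<in> - M}"
    proof -
      have "carrier (localization A S) = {frac_rel A S `` {x} | x. x \<in> carrier A \<times> S}"
        by (auto simp: localization_def quotient_def)
      also have "\<dots> = {?fr a s | a s. s \<in> - M}"
        using qS SE by (fastforce simp: fraction_def A_simps)
      finally show ?thesis .
    qed
    fix a s b t assume st: "s \<in> - M" "t \<in> - M"
    show "?fr a s = ?fr b t \<longleftrightarrow> (\<exists>u\<in>- M. u * (t * a - s * b) \<in> I)"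
      using eq[of s t a b] st by (auto simp: rel_def)
    have nonempty: "?fr a s \<noteq> {}" if "s \<in> - M" for a s using mem[of s a s a] that rel_refl by auto
    show "?fr a s \<otimes>\<^bsub>localization A S\<^esub> ?fr b t = ?fr (a * b) (s * t)"
    proof -
      have "fraction A S (x \<otimes>\<^bsub>A\<^esub> y) (w \<otimes>\<^bsub>A\<^esub> z) = ?fr (a * b) (s * t)"
        if xw: "(x, w) \<in> ?fr a s" and yz: "(y, z) \<in> ?fr b t" for x w y z
      proof -
        obtain a' s' where a': "x = q a'" "w = q s'" "s' \<notin> M" "rel a s a' s'" using memE[OF _ xw] st by auto
        obtain b' t' where b': "y = q b'" "z = q t'" "t' \<notin> M" "rel b t b' t'" using memE[OF _ yz] st by auto
        obtain u v where u: "u \<notin> M" "u * (s' * a - s * a') \<in> I" and v: "v \<notin> M" "v * (t' * b - t * b') \<in> I"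
          using a'(4) b'(4) unfolding rel_def by blast
        have "(u * v) * ((s' * t') * (a * b) - (s * t) * (a' * b')) =
            (v * t' * b) * (u * (s' * a - s * a')) + (u * s * a') * (v * (t' * b - t * b'))"
          by (simp add: algebra_simps)
        also have "\<dots> \<in> I" by (rule ideal_add[OF I ideal_mult[OF I u(2)] ideal_mult[OF I v(2)]])
        finally have "rel (a * b) (s * t) (a' * b') (s' * t')" unfolding rel_def using mult[OF u(1) v(1)] by blast
        then have "?fr (a * b) (s * t) = ?fr (a' * b') (s' * t')" using eq mult a' b' st by simp
        then show ?thesis by (simp add: a' b' A_simps)
      qed
      then show ?thesis
        unfolding localization_def using nonempty st
        by (simp, intro UN_eq_const) (auto intro!: UN_eq_const)
    qed
    show "?fr a s \<oplus>\<^bsub>localization A S\<^esub> ?fr b t = ?fr (t * a + s * b) (s * t)"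
    proof -
      have "fraction A S ((z \<otimes>\<^bsub>A\<^esub> x) \<oplus>\<^bsub>A\<^esub> (w \<otimes>\<^bsub>A\<^esub> y)) (w \<otimes>\<^bsub>A\<^esub> z) = ?fr (t * a + s * b) (s * t)"
        if xw: "(x, w) \<in> ?fr a s" and yz: "(y, z) \<in> ?fr b t" for x w y z
      proof -
        obtain a' s' where a': "x = q a'" "w = q s'" "s' \<notin> M" "rel a s a' s'" using memE[OF _ xw] st by auto
        obtain b' t' where b': "y = q b'" "z = q t'" "t' \<notin> M" "rel b t b' t'" using memE[OF _ yz] st by auto
        obtain u v where u: "u \<notin> M" "u * (s' * a - s * a') \<in> I" and v: "v \<notin> M" "v * (t' * b - t * b') \<in> I"
          using a'(4) b'(4) unfolding rel_def by blast
        have "(u * v) * ((s' * t') * (t * a + s * b) - (s * t) * (t' * a' + s' * b')) =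
            (v * t' * t) * (u * (s' * a - s * a')) + (u * s * s') * (v * (t' * b - t * b'))"
          by (simp add: algebra_simps)
        also have "\<dots> \<in> I" by (rule ideal_add[OF I ideal_mult[OF I u(2)] ideal_mult[OF I v(2)]])
        finally have "rel (t * a + s * b) (s * t) (t' * a' + s' * b') (s' * t')"
          unfolding rel_def using mult[OF u(1) v(1)] by blast
        then have "?fr (t * a + s * b) (s * t) = ?fr (t' * a' + s' * b') (s' * t')"
          using eq mult a' b' st by simp
        then show ?thesis by (simp add: a' b' A_simps)
      qed
      then show ?thesis
        unfolding localization_def using nonempty st
        by (simp, intro UN_eq_const) (auto intro!: UN_eq_const)
    qed
  qed
qed

theorem cohen_macaulay_ring_iff:
  assumes noeth: "noetherian TYPE('a)"
  shows "cohen_macaulay_ring A \<longleftrightarrow> (\<forall>M. is_maximal M \<and> I \<subseteq> M \<longrightarrow> local_cohen_macaulay I M)"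
proof -
  have iff: "cohen_macaulay_local (localization A (carrier A - A.extension M)) \<longleftrightarrow> local_cohen_macaulay I M"
    if M: "is_maximal M" "I \<subseteq> M" for M
  proof -
    have pM: "is_prime M" using M by (simp add: is_maximal_def)
    let ?S = "carrier A - A.extension M"
    interpret L: fraction_ring "localization A ?S" "- M" I "\<lambda>a s. fraction A ?S (q a) (q s)"
      by (rule localization_fraction_ring[OF pM M(2)])
    interpret L: local_fraction_ring "localization A ?S" M I "\<lambda>a s. fraction A ?S (q a) (q s)"
      by unfold_locales (rule pM, rule noeth, rule M)
    show ?thesis by (rule L.cohen_macaulay_local_iff)
  qed
  show ?thesis
  proof
    assume cm: "cohen_macaulay_ring A"
    show "\<forall>M. is_maximal M \<and> I \<subseteq> M \<longrightarrow> local_cohen_macaulay I M"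
      using cm extension_maximal(1) iff unfolding cohen_macaulay_ring_def by blast
  next
    assume cm: "\<forall>M. is_maximal M \<and> I \<subseteq> M \<longrightarrow> local_cohen_macaulay I M"
    have "cohen_macaulay_local (localization A (carrier A - H))" if "maximalideal H A" for H
    proof -
      have "ideal H A" using that by (rule maximalideal.axioms(1))
      then have "A.extension (A.contraction H) = H" by (rule A.extension_contraction)
      then show ?thesis using iff contraction_maximal[OF that] cm by metis
    qed
    then show "cohen_macaulay_ring A"
      using A.cring_L A.noetherian_ring_L[OF noeth] by (simp add: cohen_macaulay_ring_def)
  qed
qed

end

section \<open>Cohen--Macaulay monomial ideals\<close>

definition involving :: "'v set \<Rightarrow> ('v \<Rightarrow>\<^sub>0 nat) set"
  where "involving W = {a. \<exists>v\<in>W. 0 < exponent a v}"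

lemma up_closed_involving: "up_closed (involving W)"
  by (auto simp: up_closed_def involving_def lookup_add)

text \<open>The ideals generated by variables: adjoining one variable after the other gives a chain
  whose steps are regular.\<close>

lemma adjoin_var_involving:
  fixes W :: "'v::finite set"
  shows "adjoin (monomial_ideal (involving W) :: ('v, 'k::field) mpoly set) (var v) =
    monomial_ideal (involving (insert v W))"
proof
  let ?J = "monomial_ideal (involving W) :: ('v, 'k) mpoly set"
  let ?J' = "monomial_ideal (involving (insert v W)) :: ('v, 'k) mpoly set"
  have iJ: "is_ideal ?J" and iJ': "is_ideal ?J'" by (intro monomial_ideal_is_ideal up_closed_involving)+
  show "adjoin ?J (var v) \<subseteq> ?J'"
  proof (rule adjoin_least[OF iJ'])
    show "?J \<subseteq> ?J'" by (auto simp: monomial_ideal_def involving_def)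
    show "var v \<in> ?J'" unfolding var_def by (rule monom_in_monomial_ideal) (simp add: involving_def)
  qed
  show "?J' \<subseteq> adjoin ?J (var v)"
  proof
    fix f assume f: "f \<in> ?J'"
    show "f \<in> adjoin ?J (var v)"
    proof (induction f rule: poly_induct)
      case zero
      show ?case by (intro ideal_zero ideal_adjoin iJ)
    next
      case (add f g)
      then show ?case by (intro ideal_add ideal_adjoin iJ)
    next
      case (monomial a c)
      then have "a \<in> involving (insert v W)" using f by (auto simp: monomial_ideal_def)
      then consider "a \<in> involving W" | "0 < exponent a v" by (auto simp: involving_def)
      then show ?case
      proof cases
        case 1
        then show ?thesis using monom_in_monomial_ideal adjoin_superset by blast
      next
        case 2
        obtain b where "a = Poly_Mapping.single v 1 + b"
          by (rule exponent_minus[of "Poly_Mapping.single v 1" a])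
            (use 2 in \<open>auto simp: lookup_single when_def\<close>)
        then have "Poly_Mapping.single a c = 0 + Poly_Mapping.single b c * var v"
          by (simp add: var_def mult_single add.commute)
        then show ?thesis unfolding adjoin_def using ideal_zero[OF iJ] by blast
      qed
    qed
  qed
qed

lemma nonzerodivisor_var_involving:
  fixes W :: "'v::finite set"
  assumes "v \<notin> W"
  shows "nonzerodivisor_mod (var v) (monomial_ideal (involving W) :: ('v, 'k::field) mpoly set)"
  unfolding nonzerodivisor_mod_def
proof (intro allI impI)
  fix f :: "('v, 'k) mpoly" assume f: "var v * f \<in> monomial_ideal (involving W)"
  show "f \<in> monomial_ideal (involving W)"
    unfolding monomial_ideal_def
  proof (intro CollectI subsetI)
    fix a assume "a \<in> support f"
    then have "Poly_Mapping.single v 1 + a \<in> support (var v * f)"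
      by (simp add: in_keys_iff var_eq_monom coefficient_term_mult)
    then have "Poly_Mapping.single v 1 + a \<in> involving W" using f by (auto simp: monomial_ideal_def)
    then obtain u where u: "u \<in> W" "0 < exponent (Poly_Mapping.single v 1 + a) u" by (auto simp: involving_def)
    moreover have "u \<noteq> v" using u(1) assms by auto
    ultimately have "0 < exponent a u" by (simp add: lookup_add lookup_single)
    then show "a \<in> involving W" using u by (auto simp: involving_def)
  qed
qed

lemma regular_seq_vars:
  fixes W :: "'v::finite set"
  assumes "distinct vs" "set vs \<inter> W = {}"
  shows "regular_seq (monomial_ideal (involving W) :: ('v, 'k::field) mpoly set) (map var vs)"
  using assms
proof (induction vs arbitrary: W)
  case (Cons v vs)
  then show ?case
    using Cons.IH[of "insert v W"] by (auto simp: nonzerodivisor_var_involving adjoin_var_involving)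
qed simp

lemma irrelevant_maximal: "is_maximal (irrelevant_ideal :: ('v::finite, 'k::field) mpoly set)"
  unfolding is_maximal_def
proof (intro conjI allI impI)
  fix f :: "('v, 'k) mpoly" assume "f \<notin> irrelevant_ideal"
  then have "coefficient (f * const (inverse (coefficient f 0)) - 1) 0 = 0"
    by (simp add: irrelevant_ideal_def lookup_minus coefficient_mult_zero)
  then show "\<exists>g. f * g - 1 \<in> irrelevant_ideal" unfolding irrelevant_ideal_def by blast
qed (rule irrelevant_prime)

lemma homogeneous_in_irrelevant:
  "homogeneous w n f \<Longrightarrow> 0 < n \<Longrightarrow> f \<in> irrelevant_ideal"
  by (auto simp: irrelevant_ideal_def homogeneous_def in_keys_iff dest!: bspec[of _ _ 0])

lemma enat_le_Sup_iff: "enat r \<le> Sup S \<Longrightarrow> 0 < r \<Longrightarrow> \<exists>x\<in>S. enat r \<le> x"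
proof (rule ccontr)
  assume r: "enat r \<le> Sup S" "0 < r" and "\<not> (\<exists>x\<in>S. enat r \<le> x)"
  then have "x \<le> enat (r - 1)" if "x \<in> S" for x
  proof -
    have "x < enat r" using that \<open>\<not> (\<exists>x\<in>S. enat r \<le> x)\<close> by (simp add: not_le)
    then show ?thesis by (cases x) auto
  qed
  then have "Sup S \<le> enat (r - 1)" by (rule Sup_least)
  with r(1) have "enat r \<le> enat (r - 1)" by (rule order_trans)
  then show False using r(2) by simp
qed

lemma (in local_noetherian) depth_ge_mono: "depth_ge m J \<Longrightarrow> n \<le> m \<Longrightarrow> depth_ge n J"
proof (induction m arbitrary: n J)
  case (Suc m)
  then show ?case by (cases n) auto
qed simp

text \<open>The parameters are homogeneous once the variables get suitable weights.\<close>

lemma parameter_weights: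
  fixes c :: "'v::finite \<Rightarrow> nat"
  assumes "\<And>v. 0 < c v"
  shows "\<exists>w l. (\<forall>v. 0 < w v \<and> w v * c v = l) \<and> 0 < l"
proof (intro exI conjI allI)
  show "0 < (\<Prod>u\<in>- {v}. c u)" "(\<Prod>u\<in>- {v}. c u) * c v = (\<Prod>u\<in>UNIV. c u)" for v
    using assms by (simp_all add: prod.remove[of UNIV v] Compl_eq_Diff_UNIV mult.commute)
  show "0 < (\<Prod>u\<in>UNIV. c u)" using assms by simp
qed

definition parameter_powers :: "('v::finite \<Rightarrow> nat) \<Rightarrow> (nat \<Rightarrow> nat) \<Rightarrow> nat \<Rightarrow> ('v, 'k::field) mpoly list"
  where "parameter_powers c m r = map (\<lambda>k. parameter c k ^ m k) [1..<Suc r]"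

text \<open>Let \<open>r\<close> be the largest number of variables that do not support a monomial of a monomial
  ideal, in the sense of the two assumptions below. Then the first \<open>r\<close> parameters form a system
  of parameters of the residue ring.\<close>

locale monomial_ideal_of_dimension =
  fixes U :: "('v::finite \<Rightarrow>\<^sub>0 nat) set" and I :: "('v, 'k::field) mpoly set" and r :: nat
  assumes U: "up_closed U" and I_def: "I = monomial_ideal U"
    and nonface: "\<And>P F. is_prime P \<Longrightarrow> I \<subseteq> P \<Longrightarrow> r < card F \<Longrightarrow> \<exists>v\<in>F. var v \<in> P"
    and face: "\<exists>F. card F = r \<and> U \<subseteq> involving (- F)"
begin

lemma I_ideal: "is_ideal I" unfolding I_def by (rule monomial_ideal_is_ideal[OF U])

lemma I_homogeneous: "homogeneous_ideal w I" unfolding I_def by (rule monomial_ideal_homogeneous[OF U])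

lemma r_le: "r \<le> card (UNIV :: 'v set)"
  using face card_mono[of "UNIV :: 'v set"] by auto

lemma parameter_in_prime:
  assumes "is_prime P" "I \<subseteq> P" "r < k" "\<And>v. 0 < c v"
  shows "parameter c k \<in> P"
  unfolding parameter_def elem_sym_def
proof (rule ideal_sum[OF prime_is_ideal[OF assms(1)]])
  fix F :: "'v set" assume "F \<in> {F. card F = k}"
  then obtain v where v: "v \<in> F" "var v \<in> P" using nonface[OF assms(1,2), of F] assms(3) by auto
  have iP: "is_ideal P" by (rule prime_is_ideal[OF assms(1)])
  have "(\<Prod>v\<in>F. var v ^ c v) =
      ((var v * var v ^ (c v - 1)) * (\<Prod>v\<in>F - {v}. var v ^ c v) :: ('v, 'k) mpoly)"
    using v(1) assms(4)[of v] by (subst prod.remove[of F v]) (auto simp flip: power_Suc)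
  also have "\<dots> \<in> P" by (rule ideal_mult_right[OF iP ideal_mult_right[OF iP v(2)]])
  finally show "(\<Prod>v\<in>F. var v ^ c v) \<in> P" .
qed

lemma chain_bound:
  assumes "prime_chain Ps k" "I \<subseteq> Ps 0" "i \<le> r" "\<And>v. 0 < c v"
    and "\<And>j. 1 \<le> j \<Longrightarrow> j \<le> i \<Longrightarrow> parameter c j \<in> Ps 0"
  shows "k + i \<le> r"
proof -
  have P0: "is_prime (Ps 0)" using assms(1) by (simp add: prime_chain_def)
  have "k \<le> card {Suc i..r}"
  proof (rule prime_chain_bound[OF assms(1)])
    show "{Suc i..r} \<subseteq> {1..card (UNIV :: 'v set)}" using r_le by auto
    show "0 < c v" for v by (rule assms(4))
    fix j assume "j \<in> {1..card (UNIV :: 'v set)} - {Suc i..r}"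
    then consider "1 \<le> j" "j \<le> i" | "r < j" by force
    then show "parameter c j \<in> Ps 0"
      using assms(5) parameter_in_prime[OF P0 assms(2) _ assms(4)] by cases auto
  qed
  then show ?thesis using assms(3) by simp
qed

lemma local_noetherian_mpoly: "is_prime M \<Longrightarrow> local_noetherian (M :: ('v, 'k) mpoly set)"
  by unfold_locales (auto simp: noetherian_mpoly)

lemma I_irrelevant: "I \<subseteq> irrelevant_ideal"
proof -
  have "0 \<notin> U" using face by (auto simp: involving_def)
  then show ?thesis by (auto simp: I_def monomial_ideal_def irrelevant_ideal_def in_keys_iff)
qed

text \<open>The variables of a face give a chain of \<open>r + 1\<close> primes below the irrelevant ideal, so the
  depth there is at least \<open>r\<close> and the parameters, being a system of parameters, are regular.\<close>

lemma cohen_macaulay_imp_regular: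
  assumes cm: "cohen_macaulay_ideal I" and c: "\<And>v. 0 < c v" and m: "\<And>k. 0 < m k"
  shows "regular_seq I (parameter_powers c m r)"
proof -
  let ?M = "irrelevant_ideal :: ('v, 'k) mpoly set"
  interpret residue_ring_of_type I by unfold_locales (rule I_ideal)
  interpret loc: local_noetherian ?M by (rule local_noetherian_mpoly[OF irrelevant_prime])
  obtain w l where w: "\<And>v. w v * c v = l" "\<And>v. 0 < w v" and l: "0 < l"
    using parameter_weights[of c] c by blast
  have sat: "saturated ?M I" by (rule homogeneous_ideal_saturated[OF I_homogeneous w(2)])
  have satI: "saturation ?M I = I"
    using loc.saturation_least[OF sat subset_refl] loc.saturation_superset by blast
  have local: "local_cohen_macaulay I ?M"
    using cm cohen_macaulay_ring_iff[OF noetherian_mpoly] irrelevant_maximal I_irrelevant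
    by (auto simp: cohen_macaulay_ideal_def)
  obtain F where F: "card F = r" "U \<subseteq> involving (- F)" using face by blast
  obtain vs where vs: "set vs = F" "distinct vs" using finite_distinct_list[of F] by auto
  have len: "length vs = r" using vs F by (metis distinct_card)
  let ?J = "monomial_ideal (involving (- F)) :: ('v, 'k) mpoly set"
  have iJ: "is_ideal ?J" by (intro monomial_ideal_is_ideal up_closed_involving)
  have satJ: "saturated ?M ?J"
    by (intro homogeneous_ideal_saturated[of "\<lambda>_. 1"] monomial_ideal_homogeneous up_closed_involving) simp
  have "saturation ?M ?J = ?J"
    using loc.saturation_least[OF satJ subset_refl] loc.saturation_superset by blast
  moreover have "loc.regular (saturation ?M ?J) (map var vs)"
    by (intro loc.regular_seq_localize iJ regular_seq_vars) (use vs in auto)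
  moreover have "?J \<subseteq> ?M"
    by (auto simp: monomial_ideal_def irrelevant_ideal_def involving_def in_keys_iff subset_iff)
  moreover have "set (map var vs) \<subseteq> ?M"
  proof -
    have "var v \<in> ?M" for v
    proof -
      have "Poly_Mapping.single v (1 :: nat) \<noteq> 0"
        by (metis lookup_single_eq lookup_zero one_neq_zero)
      then show ?thesis by (simp add: irrelevant_ideal_def var_def lookup_single when_def)
    qed
    then show ?thesis by auto
  qed
  ultimately obtain Ps where Ps: "prime_chain Ps r" "?J \<subseteq> Ps 0" "\<forall>i\<le>r. Ps i \<subseteq> ?M"
    using loc.regular_chain[OF satJ, of "map var vs"] by (auto simp: len)
  have "I \<subseteq> ?J" using F(2) by (auto simp: I_def monomial_ideal_def)
  then have "enat r \<in> {enat k | k. \<exists>Ps. prime_chain Ps k \<and> I \<subseteq> Ps 0 \<and> Ps k \<subseteq> ?M}"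
    using Ps by blast
  then have "enat r \<le> Sup {enat k | k. \<exists>Ps. prime_chain Ps k \<and> I \<subseteq> Ps 0 \<and> Ps k \<subseteq> ?M}"
    by (rule Sup_upper)
  then have Sup: "enat r \<le> Sup {enat (length as) | as. set as \<subseteq> ?M \<and> loc.regular I as}"
    using local by (simp add: local_cohen_macaulay_def satI)
  have depth: "loc.depth_ge r I"
  proof (cases "r = 0")
    case False
    then obtain as where "set as \<subseteq> ?M" "loc.regular I as" "r \<le> length as"
      using enat_le_Sup_iff[OF Sup] by auto
    then show ?thesis using loc.regular_imp_depth_ge loc.depth_ge_mono by blast
  qed simp
  let ?ts = "parameter_powers c m r :: ('v, 'k) mpoly list"
  have len_ts: "length ?ts = r" by (simp add: parameter_powers_def)
  have hom: "homogeneous w (m k * (k * l)) (parameter c k ^ m k :: ('v, 'k) mpoly)" for k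
    using w(1) by (intro homogeneous_power homogeneous_parameter)
  have "loc.regular I ?ts"
  proof (rule loc.parameters_regular[OF sat])
    show "loc.depth_ge (length ?ts) I" using depth by (simp add: len_ts)
    show "set ?ts \<subseteq> ?M"
      using homogeneous_in_irrelevant[OF hom] m l by (auto simp: parameter_powers_def)
    fix i k Ps
    assume i: "i \<le> length ?ts" "prime_chain Ps k" "I \<subseteq> Ps 0" "set (take i ?ts) \<subseteq> Ps 0"
    have "parameter c j \<in> Ps 0" if "1 \<le> j" "j \<le> i" for j
    proof -
      have "take i ?ts = map (\<lambda>k. parameter c k ^ m k) [1..<Suc i]"
        using i(1) by (simp add: parameter_powers_def take_map len_ts take_upt del: upt_Suc)
      moreover have "j \<in> set [1..<Suc i]" using that by (simp del: upt_Suc)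
      ultimately have "parameter c j ^ m j \<in> Ps 0" using i(4) by (auto simp del: upt_Suc)
      then show ?thesis using prime_power i(2) by (auto simp: prime_chain_def)
    qed
    then show "k + i \<le> length ?ts" using chain_bound[where c = c, OF i(2,3) _ c] i(1) by (simp add: len_ts)
  qed
  then show ?thesis
  proof (rule regular_seq_of_local[OF loc.local_noetherian_axioms w(2) I_homogeneous, rotated])
    show "list_all (\<lambda>t. \<exists>m. homogeneous w m t) ?ts"
      using hom by (auto simp: parameter_powers_def list_all_iff)
  qed
qed

text \<open>At an arbitrary maximal ideal the parameters are replaced by monic polynomials in them that
  lie in it; their leading forms are powers of the parameters. The depth is then at least \<open>r\<close>,
  while no chain of primes above \<open>I\<close> is longer than \<open>r\<close>.\<close>

lemma regular_imp_cohen_macaulay: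
  assumes c: "\<And>v. 0 < c v" and reg: "\<And>m. (\<And>k. 0 < m k) \<Longrightarrow> regular_seq I (parameter_powers c m r)"
  shows "cohen_macaulay_ideal I"
proof -
  interpret residue_ring_of_type I by unfold_locales (rule I_ideal)
  have "local_cohen_macaulay I M" if M: "is_maximal M" "I \<subseteq> M" for M
  proof -
    have pM: "is_prime M" using M by (simp add: is_maximal_def)
    interpret loc: local_noetherian M by (rule local_noetherian_mpoly[OF pM])
    let ?J = "saturation M I"
    have satJ: "saturated M ?J" by (rule loc.sat_saturation[OF I_ideal])
    have satM: "saturated M M" using pM by (auto simp: saturated_def prime_is_ideal dest: prime_mult)
    have JM: "?J \<subseteq> M" by (rule loc.saturation_least[OF satM M(2)])
    obtain w l where w: "\<And>v. w v * c v = l" and l: "0 < l" using parameter_weights[of c] c by blast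
    have "\<forall>k. \<exists>m b. 0 < m \<and> parameter c k ^ m + (\<Sum>i<m. const (b i) * parameter c k ^ i) \<in> M"
    proof
      fix k
      obtain m b where "0 < m" "parameter c k ^ m + (\<Sum>i<m. const (b i) * parameter c k ^ i) \<in> M"
        by (rule maximal_algebraic[OF M(1), of "parameter c k"])
      then show "\<exists>m b. 0 < m \<and> parameter c k ^ m + (\<Sum>i<m. const (b i) * parameter c k ^ i) \<in> M"
        by blast
    qed
    from choice[OF this] obtain m
      where "\<forall>k. \<exists>b. 0 < m k \<and> parameter c k ^ m k + (\<Sum>i<m k. const (b i) * parameter c k ^ i) \<in> M"
      by blast
    from choice[OF this] obtain b where m: "\<And>k. 0 < m k"
      and b: "\<And>k. parameter c k ^ m k + (\<Sum>i<m k. const (b k i) * parameter c k ^ i) \<in> M" by blast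
    let ?f = "\<lambda>k. parameter c k ^ m k + (\<Sum>i<m k. const (b k i) * parameter c k ^ i) :: ('v, 'k) mpoly"
    let ?fs = "map ?f [1..<Suc r]"
    have hom: "homogeneous w (i * (k * l)) (parameter c k ^ i :: ('v, 'k) mpoly)" for i k
      using w by (intro homogeneous_power homogeneous_parameter)
    have top: "deg_less w (Suc (m k * (k * l))) (?f k) \<and> component w (m k * (k * l)) (?f k) = parameter c k ^ m k"
      if k: "1 \<le> k" for k
    proof -
      let ?n = "m k * (k * l)"
      have low: "deg_less w ?n (\<Sum>i<m k. const (b k i) * (parameter c k ^ i :: ('v, 'k) mpoly))"
      proof -
        have "deg_less w ?n (const (b k i) * (parameter c k ^ i :: ('v, 'k) mpoly))" if "i < m k" for i
        proof (rule homogeneous_imp_deg_less)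
          have "homogeneous w 0 (const (b k i) :: ('v, 'k) mpoly)" by (simp add: homogeneous_def)
          then show "homogeneous w (0 + i * (k * l)) (const (b k i) * (parameter c k ^ i :: ('v, 'k) mpoly))"
            by (rule homogeneous_mult) (rule hom)
          show "0 + i * (k * l) < ?n" using that k l by simp
        qed
        note low_term = this
        have "deg_less w ?n (\<Sum>i\<in>S. const (b k i) * (parameter c k ^ i :: ('v, 'k) mpoly))"
          if "finite S" "S \<subseteq> {..<m k}" for S
          using that by (induction S rule: finite_induct) (auto intro: deg_less_add low_term)
        then show ?thesis by blast
      qed
      have "deg_less w (Suc ?n) (?f k)"
        by (intro deg_less_add homogeneous_imp_deg_less[OF hom] deg_less_mono[OF low]) auto
      moreover have "component w ?n (?f k) = parameter c k ^ m k"
        using component_eq_0[OF low order_refl] by (simp add: component_add component_homogeneous[OF hom])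
      ultimately show ?thesis by blast
    qed
    have "regular_seq I ?fs"
    proof (rule regular_seq_of_top_forms[OF top_forms_homogeneous[OF I_homogeneous]])
      show "regular_seq I (parameter_powers c m r)" using reg m by blast
      show "list_all2 (\<lambda>f F. \<exists>n. deg_less w (Suc n) f \<and> component w n f = F) ?fs (parameter_powers c m r)"
        using top by (auto simp: parameter_powers_def list_all2_conv_all_nth simp del: upt_Suc)
    qed
    then have regJ: "loc.regular ?J ?fs" by (rule loc.regular_seq_localize[OF I_ideal])
    let ?A = "{enat (length as) | as. set as \<subseteq> M \<and> loc.regular ?J as}"
    let ?B = "{enat k | k. \<exists>Ps. prime_chain Ps k \<and> I \<subseteq> Ps 0 \<and> Ps k \<subseteq> M}"
    have "enat (length ?fs) \<in> ?A" using regJ b by fastforce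
    moreover have "length ?fs = r" by (simp del: upt_Suc)
    ultimately have "enat r \<in> ?A" by metis
    then have "enat r \<le> Sup ?A" by (rule Sup_upper)
    moreover have "Sup ?A \<le> Sup ?B"
    proof (rule Sup_subset_mono, clarify)
      fix as assume as: "set as \<subseteq> M" "loc.regular ?J as"
      obtain Ps where "prime_chain Ps (length as)" "?J \<subseteq> Ps 0" "\<forall>i\<le>length as. Ps i \<subseteq> M"
        using loc.regular_chain[OF satJ JM as] by blast
      then show "\<exists>k. enat (length as) = enat k \<and> (\<exists>Ps. prime_chain Ps k \<and> I \<subseteq> Ps 0 \<and> Ps k \<subseteq> M)"
        using loc.saturation_superset by blast
    qed
    moreover have "Sup ?B \<le> enat r"
    proof (rule Sup_least, clarify)
      fix k Ps assume "prime_chain Ps k" "I \<subseteq> Ps 0"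
      then show "enat k \<le> enat r" using chain_bound[of Ps k 0 c] c by simp
    qed
    ultimately show ?thesis unfolding local_cohen_macaulay_def by (meson order_antisym order_trans)
  qed
  then show ?thesis
    using cohen_macaulay_ring_iff[OF noetherian_mpoly] by (auto simp: cohen_macaulay_ideal_def)
qed

end

section \<open>Edge ideals of weighted oriented graphs\<close>

definition edge_exponents :: "('v \<times> 'v) set \<Rightarrow> ('v \<Rightarrow> nat) \<Rightarrow> ('v \<Rightarrow>\<^sub>0 nat) set"
  where "edge_exponents E d = {a. \<exists>(u, v)\<in>E. 1 \<le> exponent a u \<and> d v \<le> exponent a v}"

lemma up_closed_edge_exponents: "up_closed (edge_exponents E d)"
  unfolding up_closed_def edge_exponents_def
  by (auto simp: lookup_add intro: trans_le_add1)

lemma edge_ideal_eq: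
  fixes E :: "('v::finite \<times> 'v) set"
  assumes E: "asym E"
  shows "(edge_ideal E d :: ('v, 'k::field) mpoly set) = monomial_ideal (edge_exponents E d)"
proof
  let ?R = "poly_ring :: ('v, 'k) mpoly ring"
  let ?G = "{var u * var v ^ d v | u v. (u, v) \<in> E} :: ('v, 'k) mpoly set"
  let ?I = "monomial_ideal (edge_exponents E d) :: ('v, 'k) mpoly set"
  interpret R: ring ?R by (rule ring_from_type_algebra)
  have G: "?G \<subseteq> carrier ?R" by (simp add: ring_of_type_algebra_simps)
  have gen: "var u * var v ^ d v = (monom (Poly_Mapping.single u 1 + Poly_Mapping.single v (d v)) :: ('v, 'k) mpoly)" for u v
    by (simp add: var_power) (simp add: var_def mult_single)
  have ne: "u \<noteq> v" if "(u, v) \<in> E" for u v using E that by (auto dest: asymD)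
  show "edge_ideal E d \<subseteq> ?I"
    unfolding edge_ideal_def
  proof (rule R.genideal_minimal)
    show "ideal ?I ?R"
      unfolding ideal_ring_of_type_algebra_iff by (intro monomial_ideal_is_ideal up_closed_edge_exponents)
    show "?G \<subseteq> ?I"
    proof
      fix g assume "g \<in> ?G"
      then obtain u v where uv: "(u, v) \<in> E" "g = var u * var v ^ d v" by blast
      have "Poly_Mapping.single u 1 + Poly_Mapping.single v (d v) \<in> edge_exponents E d"
        unfolding edge_exponents_def using uv(1) ne[OF uv(1)]
        by (intro CollectI bexI[of _ "(u, v)"]) (auto simp: lookup_add lookup_single)
      then show "g \<in> ?I" unfolding uv(2) gen by (rule monom_in_monomial_ideal)
    qed
  qed
  have id: "is_ideal (edge_ideal E d :: ('v, 'k) mpoly set)"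
    unfolding edge_ideal_def ideal_ring_of_type_algebra_iff[symmetric] by (rule R.genideal_ideal[OF G])
  show "?I \<subseteq> edge_ideal E d"
  proof
    fix f assume f: "f \<in> ?I"
    show "f \<in> edge_ideal E d"
    proof (induction f rule: poly_induct)
      case zero
      show ?case by (rule ideal_zero[OF id])
    next
      case (add f g)
      then show ?case by (rule ideal_add[OF id])
    next
      case (monomial a b)
      then have "a \<in> edge_exponents E d" using f by (auto simp: monomial_ideal_def)
      then obtain u v where uv: "(u, v) \<in> E" "1 \<le> exponent a u" "d v \<le> exponent a v"
        by (auto simp: edge_exponents_def)
      obtain a' where a': "a = (Poly_Mapping.single u 1 + Poly_Mapping.single v (d v)) + a'"
        by (rule exponent_minus[of "Poly_Mapping.single u 1 + Poly_Mapping.single v (d v)" a])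
          (use uv ne[OF uv(1)] in \<open>auto simp: lookup_add lookup_single when_def\<close>)
      have "Poly_Mapping.single a b = Poly_Mapping.single a' b * (var u * var v ^ d v)"
        unfolding gen a' by (simp add: mult_single add.commute)
      moreover have "var u * var v ^ d v \<in> (edge_ideal E d :: ('v, 'k) mpoly set)"
        unfolding edge_ideal_def using R.genideal_self[OF G] uv(1) by blast
      ultimately show ?case using ideal_mult[OF id] by metis
    qed
  qed
qed

definition independent_set :: "('v \<times> 'v) set \<Rightarrow> 'v set \<Rightarrow> bool"
  where "independent_set E F \<longleftrightarrow> (\<forall>(u, v)\<in>E. \<not> (u \<in> F \<and> v \<in> F))"

definition independence_number :: "('v::finite \<times> 'v) set \<Rightarrow> nat"
  where "independence_number E = Max (card ` {F. independent_set E F})"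

text \<open>A prime above the edge ideal contains an endpoint of every edge, and the exponents of an edge
  generator are positive at both endpoints; so the sets of variables that support no monomial
  of the ideal are the independent sets of the graph, for all weights.\<close>

lemma edge_ideal_of_dimension:
  fixes E :: "('v::finite \<times> 'v) set"
  assumes E: "asym E" and d: "\<And>v. 1 \<le> d v"
  shows "monomial_ideal_of_dimension (edge_exponents E d)
    (edge_ideal E d :: ('v, 'k::field) mpoly set) (independence_number E)"
proof
  let ?I = "edge_ideal E d :: ('v, 'k) mpoly set"
  have "independent_set E {}" by (auto simp: independent_set_def)
  then have ne: "card ` {F. independent_set E F} \<noteq> {}" by blast
  show "up_closed (edge_exponents E d)" by (rule up_closed_edge_exponents)
  show "?I = monomial_ideal (edge_exponents E d)" by (rule edge_ideal_eq[OF E])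
  have "independence_number E \<in> card ` {F. independent_set E F}"
    unfolding independence_number_def using ne by (intro Max_in) auto
  then obtain F where F: "independent_set E F" "card F = independence_number E" by auto
  have "edge_exponents E d \<subseteq> involving (- F)"
  proof
    fix a assume "a \<in> edge_exponents E d"
    then obtain u v where uv: "(u, v) \<in> E" "1 \<le> exponent a u" "d v \<le> exponent a v"
      by (auto simp: edge_exponents_def)
    have "0 < exponent a u" "0 < exponent a v" using uv d[of v] by auto
    moreover have "u \<notin> F \<or> v \<notin> F" using F(1) uv(1) by (auto simp: independent_set_def)
    ultimately show "a \<in> involving (- F)" by (auto simp: involving_def)
  qed
  then show "\<exists>F. card F = independence_number E \<and> edge_exponents E d \<subseteq> involving (- F)" using F(2) by blast
  fix P :: "('v, 'k) mpoly set" and F :: "'v set"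
  assume P: "is_prime P" "?I \<subseteq> P" and "independence_number E < card F"
  then have "\<not> card F \<le> Max (card ` {F. independent_set E F})" by (simp add: independence_number_def)
  then have "\<not> independent_set E F" using Max_ge[of "card ` {F. independent_set E F}" "card F"] by auto
  then obtain u v where uv: "(u, v) \<in> E" "u \<in> F" "v \<in> F" by (auto simp: independent_set_def)
  interpret R: ring "poly_ring :: ('v, 'k) mpoly ring" by (rule ring_from_type_algebra)
  have "{var u * var v ^ d v | u v. (u, v) \<in> E} \<subseteq> ?I"
    unfolding edge_ideal_def by (rule R.genideal_self) (simp add: ring_of_type_algebra_simps)
  then have "var u * var v ^ d v \<in> P" using uv(1) P(2) by blast
  then have "var u \<in> P \<or> var v \<in> P" using prime_mult[OF P(1)] prime_power[OF P(1)] by blast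
  then show "\<exists>v\<in>F. var v \<in> P" using uv by blast
qed

lemma stretches_parameter_powers:
  assumes "\<And>v. 0 < e v"
  shows "list_all2 (stretches e) (parameter_powers e m r :: ('v::finite, 'k::field) mpoly list)
    (parameter_powers (\<lambda>_. 1) m r)"
  unfolding parameter_powers_def list_all2_map1 list_all2_map2
  by (rule list.rel_refl) (intro stretches_power stretches_parameter assms)

text \<open>Whether a monomial lies in the edge ideal depends on each exponent only through its position
  relative to \<open>1\<close> and to the weight. For a weight \<open>d \<ge> 3\<close> the exponents \<open>\<rho> + (d - 1) * b\<close> with
  \<open>\<rho> < d - 1\<close> take, for \<open>b = 0, 1, 2, \<dots>\<close>, the same positions as the exponents \<open>b\<close> or \<open>1 + 2 * b\<close>
  relative to the weight \<open>2\<close>, according to whether \<open>\<rho> = 0\<close>.\<close>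

lemma exponent_position:
  fixes d \<rho> b :: nat
  assumes "1 \<le> d" "\<rho> < max 1 (d - 1)"
  defines "s \<equiv> if \<rho> = 0 then b else 1 + 2 * b" and "t \<equiv> \<rho> + max 1 (d - 1) * b"
  shows "1 \<le> t \<longleftrightarrow> 1 \<le> s" "d \<le> t \<longleftrightarrow> (if 2 \<le> d then 2 else d) \<le> s"
proof -
  show "1 \<le> t \<longleftrightarrow> 1 \<le> s" unfolding s_def t_def by (auto simp: max_def)
  consider "d = 1" | "d = 2" | "3 \<le> d" using assms(1) by linarith
  then show "d \<le> t \<longleftrightarrow> (if 2 \<le> d then 2 else d) \<le> s"
  proof cases
    case 3
    then have m: "max 1 (d - 1) = d - 1" by simp
    consider "b = 0" | "b = 1" | "2 \<le> b" by linarith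
    then show ?thesis
    proof cases
      case 3
      have "(d - 1) * 2 \<le> (d - 1) * b" using 3 by (intro mult_left_mono) auto
      then have "d \<le> t" using \<open>3 \<le> d\<close> unfolding t_def m by linarith
      then show ?thesis using 3 \<open>3 \<le> d\<close> by (simp add: s_def)
    qed (use 3 assms(2) in \<open>auto simp: s_def t_def m\<close>)
  qed (use assms(2) in \<open>auto simp: s_def t_def\<close>)
qed

theorem corollary6:
  fixes E :: "('v::finite \<times> 'v) set" and d d' :: "'v \<Rightarrow> nat"
    and I I\<^sub>U :: "('v, 'k::field) mpoly set"
  assumes "weighted_oriented_graph E d"
    and "\<And>v. d' v = (if d v \<ge> 2 then 2 else d v)"
    and "I = edge_ideal E d"
    and "I\<^sub>U = edge_ideal E d'"
  shows "cohen_macaulay_ideal I \<longleftrightarrow> cohen_macaulay_ideal I\<^sub>U"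
proof -
  have E: "asym E" and d: "\<And>v. 1 \<le> d v"
    using assms(1) by (auto simp: weighted_oriented_graph_def oriented_graph_def)
  have d': "\<And>v. 1 \<le> d' v" using assms(2) d by auto
  let ?U = "edge_exponents E d" and ?U' = "edge_exponents E d'" and ?r = "independence_number E"
  interpret I: monomial_ideal_of_dimension ?U I ?r unfolding assms(3) by (rule edge_ideal_of_dimension[OF E d])
  interpret IU: monomial_ideal_of_dimension ?U' I\<^sub>U ?r unfolding assms(4) by (rule edge_ideal_of_dimension[OF E d'])
  define e where "e v = max 1 (d v - 1)" for v
  have e: "0 < e v" for v by (simp add: e_def)
  \<comment> \<open>The colon ideal for \<open>\<rho>\<close> is the summand of \<open>I\<^sub>U\<close> at \<open>\<rho>2 \<rho>\<close> for the substitution that squares the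
    variables in the support of \<open>\<rho>\<close>.\<close>
  define e2 where "e2 \<rho> v = (if exponent \<rho> v = 0 then 1 else 2 :: nat)" for \<rho> :: "'v \<Rightarrow>\<^sub>0 nat" and v
  define \<rho>2 where "\<rho>2 \<rho> = exponent_of (\<lambda>v. if exponent \<rho> v = 0 then 0 else 1 :: nat)" for \<rho> :: "'v \<Rightarrow>\<^sub>0 nat"
  have e2: "0 < e2 \<rho> v" for \<rho> v by (simp add: e2_def)
  have \<rho>2: "\<rho>2 \<rho> \<in> residues_below (e2 \<rho>)" for \<rho> by (simp add: \<rho>2_def e2_def residues_below_def)
  have pieces: "{b. \<rho> + stretch e b \<in> ?U} = {b. \<rho>2 \<rho> + stretch (e2 \<rho>) b \<in> ?U'}"
    if \<rho>: "\<rho> \<in> residues_below e" for \<rho>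
  proof -
    have s: "exponent (\<rho>2 \<rho> + stretch (e2 \<rho>) b) v =
        (if exponent \<rho> v = 0 then exponent b v else 1 + 2 * exponent b v)" for b v
      by (simp add: lookup_add \<rho>2_def e2_def)
    have t: "exponent (\<rho> + stretch e b) v = exponent \<rho> v + max 1 (d v - 1) * exponent b v" for b v
      by (simp add: lookup_add e_def)
    have lt: "exponent \<rho> v < max 1 (d v - 1)" for v using \<rho> unfolding residues_below_def e_def by blast
    show ?thesis
      unfolding edge_exponents_def mem_Collect_eq s t exponent_position[OF d lt] assms(2) ..
  qed
  have regular_iff: "regular_seq (monomial_ideal U :: ('v, 'k) mpoly set) (parameter_powers c m r) \<longleftrightarrow>
      (\<forall>\<rho>\<in>residues_below c. regular_seq (monomial_ideal {b. \<rho> + stretch c b \<in> U} :: ('v, 'k) mpoly set)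
        (parameter_powers (\<lambda>_. 1) m r))"
    if "up_closed U" "\<And>v. 0 < c v" for U m r and c :: "'v \<Rightarrow> nat"
    by (rule coordinatewise_regular_seq[OF that(2) monomial_ideal_coordinatewise[OF that(2,1)]
        stretches_parameter_powers[OF that(2)]])
  show ?thesis
  proof
    assume cm: "cohen_macaulay_ideal I"
    show "cohen_macaulay_ideal I\<^sub>U"
    proof (rule IU.regular_imp_cohen_macaulay[of "\<lambda>_. 1"])
      fix m :: "nat \<Rightarrow> nat" assume m: "\<And>k. 0 < m k"
      have "regular_seq I (parameter_powers e m ?r)" by (rule I.cohen_macaulay_imp_regular[OF cm e m])
      moreover have "0 \<in> residues_below e" using e by (simp add: residues_below_def)
      ultimately have "regular_seq (monomial_ideal {b. 0 + stretch e b \<in> ?U} :: ('v, 'k) mpoly set)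
          (parameter_powers (\<lambda>_. 1) m ?r)"
        using regular_iff[where c = e, OF I.U e] unfolding I.I_def by blast
      also have "{b. 0 + stretch e b \<in> ?U} = {b. \<rho>2 0 + stretch (e2 0) b \<in> ?U'}"
        using \<open>0 \<in> residues_below e\<close> by (rule pieces)
      also have "\<dots> = ?U'"
      proof -
        have "\<rho>2 0 + stretch (e2 0) b = b" for b
          by (rule poly_mapping_eqI) (simp add: lookup_add \<rho>2_def e2_def)
        then show ?thesis by simp
      qed
      finally show "regular_seq I\<^sub>U (parameter_powers (\<lambda>_. 1) m ?r)" by (simp add: IU.I_def)
    qed simp
  next
    assume cm: "cohen_macaulay_ideal I\<^sub>U"
    show "cohen_macaulay_ideal I"
    proof (rule I.regular_imp_cohen_macaulay[OF e])
      fix m :: "nat \<Rightarrow> nat" assume m: "\<And>k. 0 < m k"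
      have "regular_seq (monomial_ideal {b. \<rho> + stretch e b \<in> ?U} :: ('v, 'k) mpoly set)
          (parameter_powers (\<lambda>_. 1) m ?r)" if \<rho>: "\<rho> \<in> residues_below e" for \<rho>
      proof -
        have "regular_seq I\<^sub>U (parameter_powers (e2 \<rho>) m ?r)"
          by (rule IU.cohen_macaulay_imp_regular[OF cm e2 m])
        then have "regular_seq (monomial_ideal {b. \<rho>2 \<rho> + stretch (e2 \<rho>) b \<in> ?U'} :: ('v, 'k) mpoly set)
            (parameter_powers (\<lambda>_. 1) m ?r)"
          using regular_iff[where c = "e2 \<rho>", OF IU.U e2] \<rho>2 unfolding IU.I_def by blast
        then show ?thesis by (simp only: pieces[OF \<rho>])
      qed
      then show "regular_seq I (parameter_powers e m ?r)"
        unfolding I.I_def using regular_iff[where c = e, OF I.U e] by blast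
    qed
  qed
qed

end
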